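(* Let $A\in\mathbb{Z}^{d\times n}$ be a totally unimodular matrix all of whose circuits are even. Then $\mathrm{mldeg}(X_{\Lambda(A)})=1$ if and only if $A$ only has circuits of size two (i.e. every circuit of $A$ has support of cardinality two).
   Context: Lawrence lift: for $A\in\mathbb{Z}^{d\times n}$, $\Lambda(A)=\begin{bmatrix} A & 0 \\ 0 & A \\ {I_n} & {I_n} \end{bmatrix}\in\mathbb{Z}^{(2d+n)\times 2n}$. Toric variety: for $B\in\mathbb{Z}^{p\times q}$ let $I_B\subseteq\mathbb{C}[x_1,\dots,x_q]$ be the kernel of the ring map $x_j\mapsto\prod_{i=1}^p t_i^{b_{ij}}\in\mathbb{C}[t_1^{\pm1},\dots,t_p^{\pm1}]$, and $X_B=\{x\in(\mathbb{C}^\times)^q: f(x)=0\ \forall f\in I_B\}$. Maximum likelihood degree: $\mathrm{mldeg}(X_B)$ is the number of points $x\in X_B$, counted with multiplicity, satisfying $Bx=Bu$ and $\sum_i x_i\neq0$, for generic $u\in\mathbb{C}^q$. Totally unimodular: every minor is $0$, $1$ or $-1$. A circuit of $A$ is a nonzero integer vector in $\ker A$ with relatively prime coordinates whose support is minimal (under inclusion) among supports of nonzero vectors of $\ker A$; its size is the cardinality of its support, and it is even if its size is even. *)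

theory Defs
  imports
    "HOL-Library.Poly_Mapping"
    "HOL-Library.Extended_Nat"
    "HOL-Computational_Algebra.Fraction_Field"
    "Jordan_Normal_Form.Determinant"
    "Jordan_Normal_Form.Matrix_Kernel"
    "Jordan_Normal_Form.DL_Submatrix"
begin

text \<open>Matrices and vectors are those of \<^theory>\<open>Jordan_Normal_Form.Matrix\<close>; all indices,
  including those of the polynomial variables, start at 0.\<close>

section \<open>Integer matrices\<close>

definition lawrence_lift :: "int mat \<Rightarrow> int mat" where
  "lawrence_lift A =
    (let d = dim_row A; n = dim_col A in
      four_block_mat A (0\<^sub>m d n) (0\<^sub>m d n) A @\<^sub>r
      four_block_mat (1\<^sub>m n) (1\<^sub>m n) (0\<^sub>m 0 n) (0\<^sub>m 0 n))"

definition totally_unimodular :: "int mat \<Rightarrow> bool" where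
  "totally_unimodular A \<longleftrightarrow>
    (\<forall>I J. I \<subseteq> {..<dim_row A} \<longrightarrow> J \<subseteq> {..<dim_col A} \<longrightarrow> card I = card J \<longrightarrow>
      det (submatrix A I J) \<in> {0, 1, -1})"

definition vec_support :: "'a :: zero vec \<Rightarrow> nat set" where
  "vec_support v = {i. i < dim_vec v \<and> v $ i \<noteq> 0}"

text \<open>The kernel is taken over the integers. As \<open>A\<close> is an integer matrix, the minimal supports
  are the same for the kernel over the rationals, the reals or the complex numbers.\<close>

definition circuit :: "int mat \<Rightarrow> int vec \<Rightarrow> bool" where
  "circuit A v \<longleftrightarrow>
    v \<in> mat_kernel A \<and> v \<noteq> 0\<^sub>v (dim_col A) \<and> Gcd (set\<^sub>v v) = 1 \<and>
    (\<forall>w \<in> mat_kernel A. w \<noteq> 0\<^sub>v (dim_col A) \<longrightarrow>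
      vec_support w \<subseteq> vec_support v \<longrightarrow> vec_support w = vec_support v)"

section \<open>Polynomials and Laurent polynomials\<close>

text \<open>Both are monoid algebras: exponent vectors are finitely supported functions from variable
  indices to \<^typ>\<open>nat\<close> respectively \<^typ>\<open>int\<close>. The ring of polynomials in the variables
  \<open>0, \<dots>, q - 1\<close> is the subset \<open>polys q\<close>.\<close>

type_synonym cpoly = "(nat \<Rightarrow>\<^sub>0 nat) \<Rightarrow>\<^sub>0 complex"
type_synonym claurent = "(nat \<Rightarrow>\<^sub>0 int) \<Rightarrow>\<^sub>0 complex"

definition polys :: "nat \<Rightarrow> cpoly set" where
  "polys q = {f. \<forall>m \<in> Poly_Mapping.keys f. Poly_Mapping.keys m \<subseteq> {..<q}}"

definition const_poly :: "complex \<Rightarrow> ('e :: comm_monoid_add) \<Rightarrow>\<^sub>0 complex" where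
  "const_poly c = Poly_Mapping.single 0 c"

definition var_poly :: "nat \<Rightarrow> cpoly" where
  "var_poly j = Poly_Mapping.single (Poly_Mapping.single j 1) 1"

text \<open>The ring map acting as \<open>\<phi>\<close> on coefficients and sending the \<open>j\<close>-th variable to \<open>t j\<close>.\<close>

definition poly_hom :: "(complex \<Rightarrow> 'r :: comm_ring_1) \<Rightarrow> (nat \<Rightarrow> 'r) \<Rightarrow> cpoly \<Rightarrow> 'r" where
  "poly_hom \<phi> t f =
    (\<Sum>m \<in> Poly_Mapping.keys f. \<phi> (Poly_Mapping.lookup f m) *
      (\<Prod>j \<in> Poly_Mapping.keys m. t j ^ Poly_Mapping.lookup m j))"

definition poly_eval :: "cpoly \<Rightarrow> complex vec \<Rightarrow> complex" where
  "poly_eval f x = poly_hom (\<lambda>c. c) (\<lambda>j. x $ j) f"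

definition poly_ideal :: "nat \<Rightarrow> cpoly set \<Rightarrow> cpoly set" where
  "poly_ideal q G = {\<Sum>g \<in> F. c g * g |F c. finite F \<and> F \<subseteq> G \<and> (\<forall>g \<in> F. c g \<in> polys q)}"

section \<open>Toric varieties\<close>

definition laurent_var_powi :: "nat \<Rightarrow> int \<Rightarrow> claurent" where
  "laurent_var_powi i k = Poly_Mapping.single (Poly_Mapping.single i k) 1"

definition toric_ideal :: "int mat \<Rightarrow> cpoly set" where
  "toric_ideal B =
    {f \<in> polys (dim_col B).
      poly_hom const_poly (\<lambda>j. \<Prod>i<dim_row B. laurent_var_powi i (B $$ (i, j))) f = 0}"

definition toric_variety :: "int mat \<Rightarrow> complex vec set" where
  "toric_variety B =
    {x \<in> carrier_vec (dim_col B).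
      (\<forall>j < dim_col B. x $ j \<noteq> 0) \<and> (\<forall>f \<in> toric_ideal B. poly_eval f x = 0)}"

section \<open>Multiplicities\<close>

text \<open>Localisation of \<open>polys q\<close> at the maximal ideal of the point \<open>x\<close>, inside its field of
  fractions, and the extension of an ideal \<open>J\<close> of \<open>polys q\<close> to it.\<close>

definition local_ring :: "nat \<Rightarrow> complex vec \<Rightarrow> cpoly fract set" where
  "local_ring q x = {Fract f g |f g. f \<in> polys q \<and> g \<in> polys q \<and> poly_eval g x \<noteq> 0}"

definition local_ideal :: "nat \<Rightarrow> complex vec \<Rightarrow> cpoly set \<Rightarrow> cpoly fract set" where
  "local_ideal q x J = {Fract f g |f g. f \<in> J \<and> g \<in> polys q \<and> poly_eval g x \<noteq> 0}"

text \<open>The dimension of the complex vector space \<open>V / W\<close>: the supremum of the sizes of finite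
  subsets of \<open>V\<close> that are linearly independent modulo \<open>W\<close>.\<close>

definition quotient_dim :: "cpoly fract set \<Rightarrow> cpoly fract set \<Rightarrow> enat" where
  "quotient_dim V W =
    (SUP S \<in> {S. finite S \<and> S \<subseteq> V \<and>
        (\<forall>c :: cpoly fract \<Rightarrow> complex.
          (\<Sum>s\<in>S. Fract (const_poly (c s)) 1 * s) \<in> W \<longrightarrow> (\<forall>s\<in>S. c s = 0))}.
      enat (card S))"

definition point_multiplicity :: "nat \<Rightarrow> cpoly set \<Rightarrow> complex vec \<Rightarrow> enat" where
  "point_multiplicity q J x = quotient_dim (local_ring q x) (local_ideal q x J)"

section \<open>Maximum likelihood degree\<close>

definition likelihood_equation :: "int mat \<Rightarrow> complex vec \<Rightarrow> nat \<Rightarrow> cpoly" where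
  "likelihood_equation B u i =
    (\<Sum>j<dim_col B. const_poly (of_int (B $$ (i, j))) * var_poly j)
    - const_poly ((map_mat of_int B *\<^sub>v u) $ i)"

definition likelihood_ideal :: "int mat \<Rightarrow> complex vec \<Rightarrow> cpoly set" where
  "likelihood_ideal B u =
    poly_ideal (dim_col B) (toric_ideal B \<union> likelihood_equation B u ` {..<dim_row B})"

definition critical_points :: "int mat \<Rightarrow> complex vec \<Rightarrow> complex vec set" where
  "critical_points B u =
    {x \<in> toric_variety B.
      map_mat of_int B *\<^sub>v x = map_mat of_int B *\<^sub>v u \<and> (\<Sum>j<dim_col B. x $ j) \<noteq> 0}"

definition critical_count :: "int mat \<Rightarrow> complex vec \<Rightarrow> enat" where
  "critical_count B u =
    (if finite (critical_points B u)
     then \<Sum>x \<in> critical_points B u. point_multiplicity (dim_col B) (likelihood_ideal B u) x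
     else \<infinity>)"

text \<open>A property holds for generic \<open>u\<close> if it holds on the complement of a hypersurface.\<close>

definition generically :: "nat \<Rightarrow> (complex vec \<Rightarrow> bool) \<Rightarrow> bool" where
  "generically q P \<longleftrightarrow>
    (\<exists>h \<in> polys q. h \<noteq> 0 \<and> (\<forall>u \<in> carrier_vec q. poly_eval h u \<noteq> 0 \<longrightarrow> P u))"

text \<open>For generic \<open>u\<close> the count is finite and constant, since \<open>x \<mapsto> B x\<close> maps the toric variety
  to a linear space of the same dimension. Hence such a \<open>k\<close> always exists, and it is unique; the
  \<open>else\<close> branch is never taken.\<close>

definition mldeg :: "int mat \<Rightarrow> nat" where
  "mldeg B =
    (if \<exists>k. generically (dim_col B) (\<lambda>u. critical_count B u = enat k)
     then THE k. generically (dim_col B) (\<lambda>u. critical_count B u = enat k)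
     else 0)"

end

theory Submission
  imports
    Defs
    "HOL-Analysis.Function_Topology"
    "HOL-Real_Asymp.Real_Asymp"
begin

text \<open>Write \<open>x\<^sub>j\<close>, \<open>y\<^sub>j\<close> for the two variables belonging to column \<open>j\<close> of \<open>A\<close> and \<open>s\<^sub>j\<close> for the prescribed
  value of \<open>x\<^sub>j + y\<^sub>j\<close>. On the torus the toric equations say that the product of the powers \<open>(x\<^sub>j / y\<^sub>j)\<close> to
  \<open>v\<^sub>j\<close> is 1 for every integer kernel vector \<open>v\<close>. Circuits of a totally unimodular matrix have entries
  0, 1, -1; if all of them are even, then the entries of every kernel vector have even sum.

  If all circuits have size two, then representatives of the parallel classes of columns are independent and, after
  interchanging \<open>x\<^sub>j\<close> and \<open>y\<^sub>j\<close> for some \<open>j\<close>, the binomials of the circuits together with the equations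
  \<open>x\<^sub>j + y\<^sub>j = s\<^sub>j\<close> are linear. They determine all coordinates, so there is one critical point, and it is
  simple.

  For a circuit of size at least four, take real data \<open>u\<close>. Where \<open>x\<^sub>j > s\<^sub>j\<close> or \<open>x\<^sub>j < 0\<close> for all \<open>j\<close>, all
  ratios \<open>x\<^sub>j / y\<^sub>j\<close> are negative and the signs cancel, so the critical points are the stationary
  points of the sum of \<open>x\<^sub>j ln |x\<^sub>j| - (x\<^sub>j - s\<^sub>j) ln |x\<^sub>j - s\<^sub>j|\<close> along the kernel. Each nonempty bounded region
  of this kind contains a maximum in its interior. For all \<open>u\<close> in some open set there are two such
  regions; generic \<open>u\<close> in it then have two critical points.\<close>

section \<open>Polynomials and their evaluation\<close>

text \<open>The kernel of the lift consists of the vectors \<open>(v, -v)\<close> with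
  \<open>v\<close> in the kernel of \<open>A\<close>, whence the ratios. Besides controlling circuit
  entries, total unimodularity equips every circuit-free set of columns with integral dual
  functionals from the row space, which vanish on the kernel. If all circuits have size two, such a
  functional isolates the equation of one parallel class; otherwise a functional with the sign
  pattern of a region bounds that region. Evenness also excludes zero columns, on which every
  functional vanishes.

  A generic count of 1 is refuted at one real point, since no hypersurface contains a whole box of
  data. The two regions differ in the signs on one parallel class \<open>S\<close> only, that of a
  column \<open>i\<close> of the longer circuit. This circuit meets \<open>S\<close> in
  \<open>i\<close> alone, so some kernel vector moves all of \<open>S\<close> in one direction and
  is balanced outside \<open>S\<close>, where the base point lies too deep in its region for the
  move to matter. With circuits of size two there is no such vector: signed sums of kernel vectors
  over a class are 0.\<close>

abbreviation point_eval :: "(nat \<Rightarrow> 'r) \<Rightarrow> (nat \<Rightarrow>\<^sub>0 nat) \<Rightarrow> 'r :: comm_ring_1" where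
  "point_eval t m \<equiv> \<Prod>j \<in> Poly_Mapping.keys m. t j ^ Poly_Mapping.lookup m j"

lemma point_eval_superset:
  assumes "finite S" "Poly_Mapping.keys m \<subseteq> S"
  shows "point_eval t m = (\<Prod>j \<in> S. t j ^ Poly_Mapping.lookup m j)"
  using assms by (intro prod.mono_neutral_left) (auto simp: not_in_keys_iff_lookup_eq_zero)

lemma point_eval_add: "point_eval t (m + m') = point_eval t m * point_eval t m'"
proof -
  let ?S = "Poly_Mapping.keys m \<union> Poly_Mapping.keys m'"
  have "Poly_Mapping.keys (m + m') \<subseteq> ?S"
    by (rule keys_add)
  then have "point_eval t (m + m') = (\<Prod>j \<in> ?S. t j ^ Poly_Mapping.lookup (m + m') j)"
    by (intro point_eval_superset) auto
  also have "\<dots> = (\<Prod>j \<in> ?S. t j ^ Poly_Mapping.lookup m j) * (\<Prod>j \<in> ?S. t j ^ Poly_Mapping.lookup m' j)"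
    by (simp add: lookup_add power_add prod.distrib)
  also have "\<dots> = point_eval t m * point_eval t m'"
    by (simp add: point_eval_superset[of ?S])
  finally show ?thesis .
qed

lemma poly_eval_conv:
  "poly_eval f x = (\<Sum>m \<in> Poly_Mapping.keys f. Poly_Mapping.lookup f m * point_eval (\<lambda>j. x $ j) m)"
  by (simp add: poly_eval_def poly_hom_def)

lemma poly_eval_superset:
  assumes "finite S" "Poly_Mapping.keys f \<subseteq> S"
  shows "poly_eval f x = (\<Sum>m \<in> S. Poly_Mapping.lookup f m * point_eval (\<lambda>j. x $ j) m)"
  unfolding poly_eval_conv
  using assms by (intro sum.mono_neutral_left) (auto simp: not_in_keys_iff_lookup_eq_zero)

lemma poly_eval_add [simp]: "poly_eval (f + g) x = poly_eval f x + poly_eval g x"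
proof -
  let ?S = "Poly_Mapping.keys f \<union> Poly_Mapping.keys g"
  have "Poly_Mapping.keys (f + g) \<subseteq> ?S"
    by (rule keys_add)
  then have "poly_eval (f + g) x = (\<Sum>m \<in> ?S. Poly_Mapping.lookup (f + g) m * point_eval (\<lambda>j. x $ j) m)"
    by (intro poly_eval_superset) auto
  also have "\<dots> = poly_eval f x + poly_eval g x"
    by (simp add: poly_eval_superset[of ?S] lookup_add algebra_simps sum.distrib)
  finally show ?thesis .
qed

lemma poly_eval_zero [simp]: "poly_eval 0 x = 0"
  by (simp add: poly_eval_conv)

lemma poly_eval_single [simp]: "poly_eval (Poly_Mapping.single m c) x = c * point_eval (\<lambda>j. x $ j) m"
  by (cases "c = 0") (simp_all add: poly_eval_conv)

lemma poly_eval_sum [simp]: "poly_eval (sum f S) x = (\<Sum>i\<in>S. poly_eval (f i) x)"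
  by (induction S rule: infinite_finite_induct) auto

lemma poly_mapping_sum_single: "f = (\<Sum>m \<in> Poly_Mapping.keys f. Poly_Mapping.single m (Poly_Mapping.lookup f m))"
  for f :: "'a \<Rightarrow>\<^sub>0 'b :: comm_monoid_add"
  by (rule poly_mapping_eqI)
     (auto simp: lookup_sum lookup_single when_def sum.delta' not_in_keys_iff_lookup_eq_zero)

lemma poly_eval_mult [simp]: "poly_eval (f * g) x = poly_eval f x * poly_eval g x"
proof -
  let ?s = "\<lambda>f m. Poly_Mapping.single m (Poly_Mapping.lookup f m)"
  have "f * g = (\<Sum>m \<in> Poly_Mapping.keys f. ?s f m) * (\<Sum>m \<in> Poly_Mapping.keys g. ?s g m)"
    using poly_mapping_sum_single[of f] poly_mapping_sum_single[of g] by simp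
  also have "poly_eval \<dots> x = (\<Sum>m \<in> Poly_Mapping.keys f. \<Sum>m' \<in> Poly_Mapping.keys g.
      poly_eval (?s f m) x * poly_eval (?s g m') x)"
    by (simp add: sum_product mult_single point_eval_add mult_ac)
  also have "\<dots> = poly_eval (\<Sum>m \<in> Poly_Mapping.keys f. ?s f m) x * poly_eval (\<Sum>m \<in> Poly_Mapping.keys g. ?s g m) x"
    by (simp only: sum_product poly_eval_sum)
  finally show ?thesis
    using poly_mapping_sum_single[of f] poly_mapping_sum_single[of g] by simp
qed

lemma poly_eval_const [simp]: "poly_eval (const_poly c) x = c"
  by (simp add: const_poly_def)

lemma poly_eval_one [simp]: "poly_eval 1 x = 1"
  using poly_eval_const[of 1 x] by (simp add: const_poly_def)

lemma poly_eval_uminus [simp]: "poly_eval (- f) x = - poly_eval f x"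
  using poly_eval_add[of f "- f" x] by (simp add: eq_neg_iff_add_eq_0 add.commute)

lemma poly_eval_diff [simp]: "poly_eval (f - g) x = poly_eval f x - poly_eval g x"
  using poly_eval_add[of f "- g" x] by simp

lemma poly_eval_var [simp]: "poly_eval (var_poly j) x = x $ j"
  by (simp add: var_poly_def)

lemma const_poly_zero [simp]: "const_poly 0 = 0"
  by (simp add: const_poly_def)

lemma const_poly_one [simp]: "const_poly 1 = 1"
  by (simp add: const_poly_def)

lemma const_poly_add: "const_poly (a + b) = const_poly a + const_poly b"
  by (simp add: const_poly_def single_add)

lemma const_poly_uminus: "const_poly (- a) = - const_poly a"
  by (simp add: const_poly_def single_uminus)

lemma const_poly_diff: "const_poly (a - b) = const_poly a - const_poly b"
  by (simp add: const_poly_def single_diff)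

lemma const_poly_mult: "const_poly (a * b) = const_poly a * const_poly b"
  by (simp add: const_poly_def mult_single)

lemma const_poly_sum: "const_poly (\<Sum>i\<in>S. a i) = (\<Sum>i\<in>S. const_poly (a i))"
  by (induction S rule: infinite_finite_induct) (simp_all add: const_poly_add)

lemma polys_zero [simp]: "0 \<in> polys q"
  by (simp add: polys_def)

lemma polys_const [simp]: "const_poly c \<in> polys q"
  by (cases "c = 0") (simp_all add: polys_def const_poly_def)

lemma polys_one [simp]: "1 \<in> polys q"
  using polys_const[of 1 q] by simp

lemma polys_var [simp]: "j < q \<Longrightarrow> var_poly j \<in> polys q"
  by (simp add: polys_def var_poly_def)

lemma polys_add [simp]: "f \<in> polys q \<Longrightarrow> g \<in> polys q \<Longrightarrow> f + g \<in> polys q"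
  using keys_add[of f g] by (auto simp: polys_def)

lemma polys_mult [simp]:
  assumes "f \<in> polys q" "g \<in> polys q"
  shows "f * g \<in> polys q"
proof -
  have "Poly_Mapping.keys m \<subseteq> {..<q}" if mem: "m \<in> Poly_Mapping.keys (f * g)" for m
  proof -
    obtain a b where ab: "m = a + b" "a \<in> Poly_Mapping.keys f" "b \<in> Poly_Mapping.keys g"
      using mem keys_mult[of f g] by blast
    then show ?thesis
      using assms keys_add[of a b] unfolding polys_def by fastforce
  qed
  then show ?thesis
    by (simp add: polys_def)
qed

lemma polys_uminus [simp]: "f \<in> polys q \<Longrightarrow> - f \<in> polys q"
  by (auto simp: polys_def in_keys_iff)

lemma polys_diff [simp]: "f \<in> polys q \<Longrightarrow> g \<in> polys q \<Longrightarrow> f - g \<in> polys q"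
  using polys_add[of f q "- g"] by simp

lemma polys_sum [simp]: "(\<And>i. i \<in> S \<Longrightarrow> f i \<in> polys q) \<Longrightarrow> sum f S \<in> polys q"
  by (induction S rule: infinite_finite_induct) auto

lemma single_eq_prod_var:
  "Poly_Mapping.single m c = const_poly c * (\<Prod>j \<in> Poly_Mapping.keys m. var_poly j ^ Poly_Mapping.lookup m j)"
proof -
  have pow: "var_poly j ^ k = Poly_Mapping.single (Poly_Mapping.single j k) 1" for j k
    by (induction k) (simp_all add: var_poly_def mult_single flip: single_add)
  have prd: "(\<Prod>j \<in> S. Poly_Mapping.single (Poly_Mapping.single j (g j)) (1::complex))
      = Poly_Mapping.single (\<Sum>j\<in>S. Poly_Mapping.single j (g j)) 1" for S :: "nat set" and g :: "nat \<Rightarrow> nat"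
    by (induction S rule: infinite_finite_induct) (simp_all add: mult_single)
  show ?thesis
    unfolding pow prd poly_mapping_sum_single[of m, symmetric] by (simp add: const_poly_def mult_single)
qed

text \<open>Monomials are products of variables, so the ring operations reach every polynomial from
  constants and variables. Membership in \<open>polys q\<close> is carried along in
  \<open>?Q\<close> because the cases \<open>add\<close> and \<open>mult\<close> may assume
  it.\<close>

lemma polys_induct [consumes 1, case_names const var add mult]:
  assumes "f \<in> polys q"
    and const: "\<And>c. P (const_poly c)" and var: "\<And>j. j < q \<Longrightarrow> P (var_poly j)"
    and add: "\<And>f g. f \<in> polys q \<Longrightarrow> g \<in> polys q \<Longrightarrow> P f \<Longrightarrow> P g \<Longrightarrow> P (f + g)"
    and mult: "\<And>f g. f \<in> polys q \<Longrightarrow> g \<in> polys q \<Longrightarrow> P f \<Longrightarrow> P g \<Longrightarrow> P (f * g)"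
  shows "P f"
proof -
  let ?Q = "\<lambda>f. f \<in> polys q \<and> P f"
  have zero: "?Q 0" and one: "?Q 1"
    using const[of 0] const[of 1] by simp_all
  have sum: "?Q (sum h S)" if "\<And>i. i \<in> S \<Longrightarrow> ?Q (h i)" for h and S :: "(nat \<Rightarrow>\<^sub>0 nat) set"
    using that by (induction S rule: infinite_finite_induct) (use zero add in auto)
  have prod: "?Q (prod h S)" if "\<And>i. i \<in> S \<Longrightarrow> ?Q (h i)" for h and S :: "nat set"
    using that by (induction S rule: infinite_finite_induct) (use one mult in auto)
  have pow: "?Q (h ^ k)" if "?Q h" for h k
    using that by (induction k) (use one mult in auto)
  have "?Q (\<Sum>m \<in> Poly_Mapping.keys f. Poly_Mapping.single m (Poly_Mapping.lookup f m))"
  proof (rule sum)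
    fix m assume "m \<in> Poly_Mapping.keys f"
    then have "Poly_Mapping.keys m \<subseteq> {..<q}"
      using assms(1) by (auto simp: polys_def)
    then have "?Q (\<Prod>j \<in> Poly_Mapping.keys m. var_poly j ^ Poly_Mapping.lookup m j)"
      by (intro prod pow) (use var in auto)
    then show "?Q (Poly_Mapping.single m (Poly_Mapping.lookup f m))"
      unfolding single_eq_prod_var[of m "Poly_Mapping.lookup f m"] using const mult by auto
  qed
  then show ?thesis
    using poly_mapping_sum_single[of f] by simp
qed

section \<open>Ideals and multiplicities\<close>

lemma poly_ideal_gen: "g \<in> G \<Longrightarrow> g \<in> poly_ideal q G"
  unfolding poly_ideal_def by (intro CollectI exI[of _ "{g}"] exI[of _ "\<lambda>_. 1"]) auto

lemma poly_ideal_zero [simp]: "0 \<in> poly_ideal q G"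
  unfolding poly_ideal_def by (intro CollectI exI[of _ "{}"] exI[of _ "\<lambda>_. 1"]) auto

lemma poly_ideal_add:
  assumes "f \<in> poly_ideal q G" "g \<in> poly_ideal q G"
  shows "f + g \<in> poly_ideal q G"
proof -
  obtain F c where F: "f = (\<Sum>g \<in> F. c g * g)" "finite F" "F \<subseteq> G" "\<forall>g \<in> F. c g \<in> polys q"
    using assms(1) unfolding poly_ideal_def by blast
  obtain F' c' where F': "g = (\<Sum>g \<in> F'. c' g * g)" "finite F'" "F' \<subseteq> G" "\<forall>g \<in> F'. c' g \<in> polys q"
    using assms(2) unfolding poly_ideal_def by blast
  let ?d = "\<lambda>g. (if g \<in> F then c g else 0) + (if g \<in> F' then c' g else 0)"
  have 1: "f = (\<Sum>g \<in> F \<union> F'. (if g \<in> F then c g else 0) * g)"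
    unfolding F(1) by (rule sum.mono_neutral_cong_left) (use F F' in auto)
  have 2: "g = (\<Sum>g \<in> F \<union> F'. (if g \<in> F' then c' g else 0) * g)"
    unfolding F'(1) by (rule sum.mono_neutral_cong_left) (use F F' in auto)
  have "f + g = (\<Sum>g \<in> F \<union> F'. ?d g * g)"
    by (subst 1, subst 2) (simp add: sum.distrib algebra_simps)
  then show ?thesis
    unfolding poly_ideal_def
    by (intro CollectI exI[of _ "F \<union> F'"] exI[of _ ?d]) (use F F' in auto)
qed

lemma poly_ideal_mult:
  assumes "f \<in> poly_ideal q G" "h \<in> polys q"
  shows "h * f \<in> poly_ideal q G"
proof -
  obtain F c where F: "f = (\<Sum>g \<in> F. c g * g)" "finite F" "F \<subseteq> G" "\<forall>g \<in> F. c g \<in> polys q"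
    using assms(1) unfolding poly_ideal_def by blast
  then show ?thesis
    unfolding poly_ideal_def
    by (intro CollectI exI[of _ F] exI[of _ "\<lambda>g. h * c g"]) (use assms in \<open>auto simp: sum_distrib_left mult_ac\<close>)
qed

lemma poly_ideal_uminus: "f \<in> poly_ideal q G \<Longrightarrow> - f \<in> poly_ideal q G"
  using poly_ideal_mult[of f q G "const_poly (-1)"] by (simp add: const_poly_uminus)

lemma poly_ideal_diff: "f \<in> poly_ideal q G \<Longrightarrow> g \<in> poly_ideal q G \<Longrightarrow> f - g \<in> poly_ideal q G"
  using poly_ideal_add[of f q G "- g"] poly_ideal_uminus[of g q G] by simp

lemma poly_ideal_sum: "(\<And>i. i \<in> S \<Longrightarrow> f i \<in> poly_ideal q G) \<Longrightarrow> sum f S \<in> poly_ideal q G"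
  by (induction S rule: infinite_finite_induct) (auto intro: poly_ideal_add)

lemma poly_eval_poly_ideal:
  assumes "f \<in> poly_ideal q G" "\<And>g. g \<in> G \<Longrightarrow> poly_eval g x = 0"
  shows "poly_eval f x = 0"
proof -
  obtain F c where F: "f = (\<Sum>g \<in> F. c g * g)" "F \<subseteq> G"
    using assms(1) unfolding poly_ideal_def by blast
  then have "poly_eval g x = 0" if "g \<in> F" for g
    using that assms(2) by blast
  then show ?thesis by (simp add: F(1))
qed

text \<open>Modulo the ideal every variable is a constant, hence so is every polynomial. For
  products, \<open>f * g - f(x) * g(x)\<close> equals
  \<open>g * (f - f(x)) + f(x) * (g - g(x))\<close>.\<close>

lemma poly_minus_value_mem_ideal:
  assumes "\<And>j. j < q \<Longrightarrow> var_poly j - const_poly (x $ j) \<in> poly_ideal q G" "f \<in> polys q"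
  shows "f - const_poly (poly_eval f x) \<in> poly_ideal q G"
  using assms(2)
proof (induction rule: polys_induct)
  case (const c)
  then show ?case by simp
next
  case (var j)
  then show ?case using assms(1) by simp
next
  case (add f g)
  then show ?case
    using poly_ideal_add[OF add(3,4)] by (simp add: const_poly_add algebra_simps)
next
  case (mult f g)
  have "g * (f - const_poly (poly_eval f x)) + const_poly (poly_eval f x) * (g - const_poly (poly_eval g x))
      \<in> poly_ideal q G"
    using mult by (intro poly_ideal_add poly_ideal_mult) auto
  then show ?case by (simp add: const_poly_mult algebra_simps)
qed

text \<open>The constant 1 is independent modulo the ideal: after clearing the denominator of a
  scalar multiple in the ideal, evaluation at \<open>x\<close> gives 0 for the numerator but not for
  the denominator, so the scalar is 0.\<close>

lemma point_multiplicity_ge_1: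
  assumes "\<And>f. f \<in> J \<Longrightarrow> poly_eval f x = 0"
  shows "point_multiplicity q J x \<ge> 1"
proof -
  let ?S = "{1 :: cpoly fract}"
  have "1 \<in> local_ring q x"
    unfolding local_ring_def by (intro CollectI exI[of _ 1]) (auto simp: One_fract_def)
  moreover have "c 1 = 0" if "(\<Sum>s\<in>?S. Fract (const_poly (c s)) 1 * s) \<in> local_ideal q x J"
    for c :: "cpoly fract \<Rightarrow> complex"
  proof -
    have "Fract (const_poly (c 1)) 1 \<in> local_ideal q x J"
      using that by simp
    then obtain f g where fg: "Fract (const_poly (c 1)) 1 = Fract f g" "f \<in> J" "poly_eval g x \<noteq> 0"
      unfolding local_ideal_def by blast
    then have "g \<noteq> 0" by auto
    then have "const_poly (c 1) * g = f"
      using fg(1) by (simp add: eq_fract)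
    then have "c 1 * poly_eval g x = poly_eval f x"
      by (metis poly_eval_const poly_eval_mult)
    then show ?thesis using fg assms by simp
  qed
  ultimately have "?S \<in> {S. finite S \<and> S \<subseteq> local_ring q x \<and>
        (\<forall>c :: cpoly fract \<Rightarrow> complex.
          (\<Sum>s\<in>S. Fract (const_poly (c s)) 1 * s) \<in> local_ideal q x J \<longrightarrow> (\<forall>s\<in>S. c s = 0))}"
    by auto
  then have "enat (card ?S) \<le> point_multiplicity q J x"
    unfolding point_multiplicity_def quotient_dim_def by (rule SUP_upper)
  then show ?thesis by (simp add: one_enat_def)
qed

lemma local_ring_mem_local_ideal:
  assumes "\<And>j. j < q \<Longrightarrow> var_poly j - const_poly (x $ j) \<in> poly_ideal q G"
    and "f \<in> polys q" "g \<in> polys q" "poly_eval g x \<noteq> 0" "poly_eval f x = 0"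
  shows "Fract f g \<in> local_ideal q x (poly_ideal q G)"
  using poly_minus_value_mem_ideal[OF assms(1,2)] assms unfolding local_ideal_def by auto

text \<open>Two local elements are never independent: a combination lies in the ideal once its
  numerator vanishes at \<open>x\<close>, and scalars that are not both zero achieve this.\<close>

lemma point_multiplicity_le_1:
  assumes lin: "\<And>j. j < q \<Longrightarrow> var_poly j - const_poly (x $ j) \<in> poly_ideal q G"
  shows "point_multiplicity q (poly_ideal q G) x \<le> 1"
  unfolding point_multiplicity_def quotient_dim_def
proof (rule SUP_least)
  let ?W = "local_ideal q x (poly_ideal q G)"
  fix S assume "S \<in> {S. finite S \<and> S \<subseteq> local_ring q x \<and>
        (\<forall>c :: cpoly fract \<Rightarrow> complex.
          (\<Sum>s\<in>S. Fract (const_poly (c s)) 1 * s) \<in> ?W \<longrightarrow> (\<forall>s\<in>S. c s = 0))}"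
  then have S: "finite S" "S \<subseteq> local_ring q x" and
    indep: "\<And>c s. (\<Sum>s\<in>S. Fract (const_poly (c s)) 1 * s) \<in> ?W \<Longrightarrow> s \<in> S \<Longrightarrow> c s = 0"
    by auto
  have "s = t" if st: "s \<in> S" "t \<in> S" for s t
  proof (rule ccontr)
    assume ne: "s \<noteq> t"
    obtain f g where s: "s = Fract f g" "f \<in> polys q" "g \<in> polys q" "poly_eval g x \<noteq> 0"
      using st S unfolding local_ring_def by blast
    obtain f' g' where t: "t = Fract f' g'" "f' \<in> polys q" "g' \<in> polys q" "poly_eval g' x \<noteq> 0"
      using st S unfolding local_ring_def by blast
    have gne: "g \<noteq> 0" "g' \<noteq> 0" using s t by auto
    have comb: "Fract (const_poly a) 1 * s + Fract (const_poly b) 1 * t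
        = Fract (const_poly a * f * g' + const_poly b * f' * g) (g * g')" for a b
      using gne by (simp add: s t mult_ac)
    have sum2: "(\<Sum>r\<in>S. Fract (const_poly (if r = s then a else if r = t then b else 0)) 1 * r)
        = Fract (const_poly a) 1 * s + Fract (const_poly b) 1 * t" for a b
    proof -
      have "(\<Sum>r\<in>S. Fract (const_poly (if r = s then a else if r = t then b else 0)) 1 * r)
          = (\<Sum>r\<in>{s, t}. Fract (const_poly (if r = s then a else if r = t then b else 0)) 1 * r)"
        using S st by (intro sum.mono_neutral_right) (auto simp: fract_collapse)
      then show ?thesis using ne by simp
    qed
    have key: "a = 0 \<and> b = 0"
      if "a * poly_eval f x * poly_eval g' x + b * poly_eval f' x * poly_eval g x = 0" for a b
    proof -
      have "Fract (const_poly a * f * g' + const_poly b * f' * g) (g * g') \<in> ?W"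
        by (rule local_ring_mem_local_ideal[OF lin]) (use s t that in auto)
      then have "(\<Sum>r\<in>S. Fract (const_poly (if r = s then a else if r = t then b else 0)) 1 * r) \<in> ?W"
        unfolding sum2 comb .
      from indep[OF this st(1)] indep[OF this st(2)] ne show ?thesis by auto
    qed
    \<comment> \<open>These scalars cancel the two terms. Being zero, they force both numerators to
      vanish at \<open>x\<close>, and then the scalars 1 and 0 contradict independence.\<close>
    have "poly_eval f' x * poly_eval g x = 0 \<and> - (poly_eval f x * poly_eval g' x) = 0"
      by (rule key) (simp add: algebra_simps)
    then have "poly_eval f' x = 0" "poly_eval f x = 0" using s t by auto
    then have "(1 :: complex) = 0 \<and> (0 :: complex) = 0" by (intro key) simp
    then show False by simp
  qed
  then have "card S \<le> 1"
    using S(1) by (metis One_nat_def card_le_Suc0_iff_eq)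
  then show "enat (card S) \<le> 1"
    by (simp add: one_enat_def)
qed

section \<open>Totally unimodular matrices and their circuits\<close>

text \<open>Kernel vectors are functions on column indices with arbitrary values beyond the last
  column, which spares dimension side conditions.\<close>

definition int_ker :: "int mat \<Rightarrow> (nat \<Rightarrow> int) \<Rightarrow> bool" where
  "int_ker A v \<longleftrightarrow> (\<forall>i<dim_row A. (\<Sum>j<dim_col A. A $$ (i, j) * v j) = 0)"

text \<open>The integral row space, read as functionals on column-indexed vectors that vanish on the
  kernel.\<close>

definition row_comb :: "int mat \<Rightarrow> (nat \<Rightarrow> int) \<Rightarrow> nat \<Rightarrow> int" where
  "row_comb A p j = (\<Sum>i<dim_row A. p i * A $$ (i, j))"

text \<open>Interchanging the sums turns the pairing into a combination of rows applied to
  \<open>y\<close>. The ring is arbitrary because integral functionals are also paired with real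
  vectors.\<close>

lemma row_comb_orthogonal:
  fixes y :: "nat \<Rightarrow> 'a :: comm_ring_1"
  assumes "\<And>i. i < dim_row A \<Longrightarrow> (\<Sum>j<dim_col A. of_int (A $$ (i, j)) * y j) = 0"
  shows "(\<Sum>j<dim_col A. of_int (row_comb A p j) * y j) = 0"
proof -
  have "(\<Sum>j<dim_col A. of_int (row_comb A p j) * y j)
      = (\<Sum>j<dim_col A. \<Sum>i<dim_row A. of_int (p i) * (of_int (A $$ (i, j)) * y j))"
    by (simp add: row_comb_def sum_distrib_right mult.assoc)
  also have "\<dots> = (\<Sum>i<dim_row A. of_int (p i) * (\<Sum>j<dim_col A. of_int (A $$ (i, j)) * y j))"
    by (subst sum.swap) (simp add: sum_distrib_left)
  also have "\<dots> = 0" using assms by simp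
  finally show ?thesis .
qed

lemma int_ker_orthogonal:
  assumes "int_ker A v"
  shows "(\<Sum>j<dim_col A. row_comb A p j * v j) = 0"
  using row_comb_orthogonal[of A v p] assms by (simp add: int_ker_def)

lemma int_ker_lin: "int_ker A v \<Longrightarrow> int_ker A w \<Longrightarrow> int_ker A (\<lambda>j. a * v j + b * w j)"
proof -
  have "(\<Sum>j<dim_col A. A $$ (i, j) * (a * v j + b * w j))
      = a * (\<Sum>j<dim_col A. A $$ (i, j) * v j) + b * (\<Sum>j<dim_col A. A $$ (i, j) * w j)" for i
    by (simp add: sum_distrib_left sum.distrib algebra_simps)
  then show "int_ker A v \<Longrightarrow> int_ker A w \<Longrightarrow> ?thesis"
    by (simp add: int_ker_def)
qed

lemma int_ker_cong: "(\<And>j. j < dim_col A \<Longrightarrow> v j = w j) \<Longrightarrow> int_ker A v = int_ker A w"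
  by (simp add: int_ker_def)

lemma row_comb_lin: "row_comb A (\<lambda>i. a * p i + b * q i) j = a * row_comb A p j + b * row_comb A q j"
  by (simp add: row_comb_def sum_distrib_left sum.distrib algebra_simps)

text \<open>\<open>submatrix\<close> lists its indices increasingly by \<open>pick\<close>. Sending
  \<open>i\<close> to the rank of \<open>f i\<close> in the image sorts an arbitrary injective index
  sequence.\<close>

lemma sorted_index_permutes:
  assumes "inj_on f {..<r}" and I: "I = f ` {..<r :: nat}"
  defines "\<pi> \<equiv> \<lambda>i. if i < r then card {a \<in> I. a < (f i :: nat)} else i"
  shows "\<pi> permutes {0..<r}" and "\<And>i. i < r \<Longrightarrow> f i = pick I (\<pi> i)"
proof -
  have finI: "finite I" and cardI: "card I = r"
    using assms by (simp_all add: card_image)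
  show pick: "f i = pick I (\<pi> i)" if "i < r" for i
    using pick_card_in_set[of "f i" I] that by (simp add: \<pi>_def I)
  have "inj_on \<pi> {0..<r}"
  proof (rule inj_onI)
    fix i j assume "i \<in> {0..<r}" "j \<in> {0..<r}" "\<pi> i = \<pi> j"
    then show "i = j"
      using pick[of i] pick[of j] assms(1) by (auto simp: inj_on_def)
  qed
  moreover have "\<pi> ` {0..<r} \<subseteq> {0..<r}"
  proof
    fix k assume "k \<in> \<pi> ` {0..<r}"
    then obtain i where i: "i < r" "k = card {a \<in> I. a < f i}"
      by (auto simp: \<pi>_def)
    have "{a \<in> I. a < f i} \<subset> I"
      using i by (auto simp: I)
    then show "k \<in> {0..<r}"
      using psubset_card_mono[OF finI] cardI i by auto
  qed
  ultimately have "bij_betw \<pi> {0..<r} {0..<r}"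
    by (simp add: bij_betw_def endo_inj_surj)
  then show "\<pi> permutes {0..<r}"
    by (rule bij_imp_permutes) (simp add: \<pi>_def)
qed

lemma signof_mult_unit: "x \<in> {0, 1, -1} \<Longrightarrow> signof p * x \<in> {0, 1, -1 :: int}"
  by (auto simp: sign_def)

text \<open>\<open>totally_unimodular\<close> speaks of increasing index sequences only. A repeated
  index makes the determinant 0; otherwise sorting rows and columns changes it by two signs.\<close>

lemma totally_unimodular_minor:
  assumes tu: "totally_unimodular A"
    and f: "\<And>a. a < r \<Longrightarrow> f a < dim_row A" and g: "\<And>a. a < r \<Longrightarrow> g a < dim_col A"
  shows "det (mat r r (\<lambda>(a, b). A $$ (f a, g b))) \<in> {0, 1, -1}"
proof -
  let ?M = "mat r r (\<lambda>(a, b). A $$ (f a, g b))"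
  have rep_row: "det (mat r r (\<lambda>(a, b). h (f a) b)) = 0" if ninj: "\<not> inj_on f {..<r}"
    for h :: "nat \<Rightarrow> nat \<Rightarrow> int" and f :: "nat \<Rightarrow> nat"
  proof -
    obtain i j where "i < r" "j < r" "i \<noteq> j" "f i = f j"
      using ninj by (auto simp: inj_on_def)
    then show ?thesis
      by (intro det_identical_rows[of _ r i j]) (auto intro!: eq_vecI)
  qed
  show ?thesis
  proof (cases "inj_on f {..<r} \<and> inj_on g {..<r}")
    case False
    have "det ?M = det (mat r r (\<lambda>(a, b). A $$ (f b, g a)))"
      by (subst det_transpose[of _ r, symmetric]) (auto intro!: arg_cong[of _ _ det] eq_matI)
    then have "det ?M = 0"
      using False rep_row[of f "\<lambda>x b. A $$ (x, g b)"] rep_row[of g "\<lambda>x b. A $$ (f b, x)"] by auto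
    then show ?thesis by simp
  next
    case True
    let ?I = "f ` {..<r}" and ?J = "g ` {..<r}"
    obtain \<pi> where \<pi>: "\<pi> permutes {0..<r}" "\<And>i. i < r \<Longrightarrow> f i = pick ?I (\<pi> i)"
      using sorted_index_permutes[of f r ?I] True by auto
    obtain \<rho> where \<rho>: "\<rho> permutes {0..<r}" "\<And>i. i < r \<Longrightarrow> g i = pick ?J (\<rho> i)"
      using sorted_index_permutes[of g r ?J] True by auto
    have lt: "\<pi> i < r" "\<rho> i < r" if "i < r" for i
      using permutes_in_image[OF \<pi>(1)] permutes_in_image[OF \<rho>(1)] that by auto
    have card: "card ?I = r" "card ?J = r"
      using True by (auto simp: card_image)
    have sub: "?I \<subseteq> {..<dim_row A}" "?J \<subseteq> {..<dim_col A}"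
      using f g by auto
    let ?S = "mat r r (\<lambda>(a, b). A $$ (pick ?I a, pick ?J b))"
    have "{i. i < dim_row A \<and> i \<in> ?I} = ?I" "{j. j < dim_col A \<and> j \<in> ?J} = ?J"
      using sub by auto
    then have "submatrix A ?I ?J = ?S"
      unfolding submatrix_def by (simp only: card)
    then have S: "det ?S \<in> {0, 1, -1}"
      using tu sub card unfolding totally_unimodular_def by metis
    \<comment> \<open>Columns are permuted after transposing, as \<open>det_permute_rows\<close>
      acts on rows.\<close>
    let ?T = "mat r r (\<lambda>(a, b). A $$ (pick ?I b, pick ?J a))"
    have "det ?T = det ?S"
      by (subst det_transpose[of _ r, symmetric]) (auto intro!: arg_cong[of _ _ det] eq_matI)
    moreover have "mat r r (\<lambda>(a, b). A $$ (pick ?I b, g a)) = mat r r (\<lambda>(a, b). ?T $$ (\<rho> a, b))"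
      by (rule eq_matI) (auto simp: \<rho>(2) lt)
    ultimately have "det (mat r r (\<lambda>(a, b). A $$ (pick ?I b, g a))) = signof \<rho> * det ?S"
      using det_permute_rows[of ?T r \<rho>] \<rho>(1) by simp
    moreover have "det (mat r r (\<lambda>(a, b). A $$ (pick ?I a, g b))) = det (mat r r (\<lambda>(a, b). A $$ (pick ?I b, g a)))"
      by (subst det_transpose[of _ r, symmetric]) (auto intro!: arg_cong[of _ _ det] eq_matI)
    moreover have "?M = mat r r (\<lambda>(a, b). mat r r (\<lambda>(a, b). A $$ (pick ?I a, g b)) $$ (\<pi> a, b))"
      by (rule eq_matI) (auto simp: \<pi>(2) lt)
    ultimately have "det ?M = signof \<pi> * (signof \<rho> * det ?S)"
      using det_permute_rows[of "mat r r (\<lambda>(a, b). A $$ (pick ?I a, g b))" r \<pi>] \<pi>(1) by simp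
    then show ?thesis
      using signof_mult_unit[OF signof_mult_unit[OF S]] by metis
  qed
qed

text \<open>Take a nonzero minor of maximal size with columns in \<open>J\<close>. If it uses all of
  \<open>J\<close>, it is 1 or -1 and its inverse is integral; the rows of the inverse are the dual
  functionals. Otherwise one more column depends on the chosen ones, and by Cramer's rule the
  coefficients are signed minors.\<close>

lemma totally_unimodular_dichotomy:
  assumes tu: "totally_unimodular A" and J: "J \<subseteq> {..<dim_col A}"
  obtains (dependent) w where "int_ker A w" "\<And>j. w j \<in> {0, 1, -1}" "\<And>j. j \<notin> J \<Longrightarrow> w j = 0" "\<exists>j. w j \<noteq> 0"
    | (independent) "\<And>j. j \<in> J \<Longrightarrow> \<exists>p. \<forall>k\<in>J. row_comb A p k = (if k = j then 1 else 0)"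
proof -
  define M where "M f g r = mat r r (\<lambda>(a, b). A $$ (f a, g b))" for f g r
  define P where "P r \<longleftrightarrow> (\<exists>f g. (\<forall>a<r. f a < dim_row A \<and> g a \<in> J) \<and> det (M f g r) \<noteq> 0)" for r
  have M_carrier [simp]: "M f g r \<in> carrier_mat r r" for f g r
    by (simp add: M_def)
  have finJ: "finite J"
    using J finite_subset by blast
  have inj: "inj_on g {..<r}" if "det (M f g r) \<noteq> 0" for f g r
  proof (rule ccontr)
    assume "\<not> inj_on g {..<r}"
    then obtain i j where ij: "i < r" "j < r" "i \<noteq> j" "g i = g j"
      by (auto simp: inj_on_def)
    have "det (M f g r) = det ((M f g r)\<^sup>T)"
      using det_transpose[OF M_carrier] by simp
    also have "\<dots> = 0"
      using ij by (intro det_identical_rows[of _ r i j]) (auto intro!: eq_vecI simp: M_def)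
    finally show False using that by simp
  qed
  have "P 0"
    by (auto simp: P_def M_def det_dim_zero)
  moreover have "r \<le> card J" if Pr: "P r" for r
  proof -
    obtain f g where fg: "\<forall>a<r. g a \<in> J" "det (M f g r) \<noteq> 0"
      using Pr by (auto simp: P_def)
    then show ?thesis
      using card_inj_on_le[of g "{..<r}" J] inj finJ by auto
  qed
  ultimately obtain r where r: "P r" and max: "\<And>k. P k \<Longrightarrow> k \<le> r"
    using Greatest_le_nat[of P _ "card J"] GreatestI_nat[of P 0 "card J"] by (metis (full_types))
  obtain f g where fg: "\<And>a. a < r \<Longrightarrow> f a < dim_row A" "\<And>a. a < r \<Longrightarrow> g a \<in> J" and det: "det (M f g r) \<noteq> 0"
    using r by (auto simp: P_def)
  have detu: "det (M f g r) \<in> {0, 1, -1}"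
    unfolding M_def using fg J by (intro totally_unimodular_minor tu) auto
  show thesis
  proof (cases "g ` {..<r} = J")
    case True
    have "\<exists>p. \<forall>k\<in>J. row_comb A p k = (if k = j then 1 else 0)" if jJ: "j \<in> J" for j
    proof -
      obtain b where b: "b < r" "j = g b"
        using True jJ by auto
      let ?adj = "adj_mat (M f g r)"
      \<comment> \<open>Since the determinant squares to 1, multiplying the adjugate by it gives the
        inverse; \<open>p\<close> places row \<open>b\<close> of the inverse on the rows chosen by
        \<open>f\<close>.\<close>
      define p where "p i = (\<Sum>a \<in> {a. a < r \<and> f a = i}. det (M f g r) * ?adj $$ (b, a))" for i
      have "row_comb A p k = (if k = j then 1 else 0)" if kJ: "k \<in> J" for k
      proof -
        obtain c where c: "c < r" "k = g c"
          using True kJ by auto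
        have "row_comb A p k = (\<Sum>i<dim_row A. \<Sum>a \<in> {a \<in> {..<r}. f a = i}. det (M f g r) * (?adj $$ (b, a) * A $$ (f a, k)))"
          by (auto simp: row_comb_def p_def sum_distrib_right sum_distrib_left mult_ac intro!: sum.cong)
        also have "\<dots> = (\<Sum>a<r. det (M f g r) * (?adj $$ (b, a) * A $$ (f a, k)))"
          by (rule sum.group) (use fg in auto)
        also have "\<dots> = det (M f g r) * (?adj * M f g r) $$ (b, c)"
          using b c adj_mat(1)[OF M_carrier, of f g r]
          by (simp add: scalar_prod_def sum_distrib_left atLeast0LessThan M_def)
        also have "\<dots> = det (M f g r) * (if b = c then det (M f g r) else 0)"
          using b c by (simp add: adj_mat(3)[OF M_carrier])
        also have "\<dots> = (if k = j then 1 else 0)"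
          using b c inj[OF det] det detu by (auto simp: inj_on_def)
        finally show ?thesis .
      qed
      then show ?thesis by blast
    qed
    then show thesis by (rule independent)
  next
    case False
    then obtain j where j: "j \<in> J" "j \<notin> g ` {..<r}"
      using fg by auto
    define g' where "g' = g(r := j)"
    have inj': "inj_on g' {..<Suc r}"
      using inj[OF det] j by (auto simp: inj_on_def g'_def less_Suc_eq)
    have g'J: "g' b \<in> J" if "b < Suc r" for b
      using that fg j by (auto simp: g'_def less_Suc_eq)
    \<comment> \<open>The cofactors along an appended row do not depend on that row, and by maximality of the minor
      every such determinant vanishes: the cofactors are the entries of a kernel vector.\<close>
    define C where "C b = (-1) ^ (r + b) * det (mat r r (\<lambda>(a, c). A $$ (f a, g' (if c < b then c else Suc c))))" for b
    have C: "C b \<in> {0, 1, -1}" if b: "b < Suc r" for b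
    proof -
      have g'col: "g' c < dim_col A" if "c < Suc r" for c
        using g'J[OF that] J by auto
      have "det (mat r r (\<lambda>(a, c). A $$ (f a, g' (if c < b then c else Suc c)))) \<in> {0, 1, -1}"
        by (rule totally_unimodular_minor[OF tu]) (auto intro!: fg(1) g'col)
      then show ?thesis
        by (cases "even (r + b)") (auto simp: C_def)
    qed
    \<comment> \<open>The coefficient of the appended column is the old minor; this makes
      \<open>w\<close> nonzero.\<close>
    have Cr: "C r = det (M f g r)"
    proof -
      have "mat r r (\<lambda>(a, c). A $$ (f a, g' (if c < r then c else Suc c))) = M f g r"
        by (rule eq_matI) (auto simp: M_def g'_def)
      then show ?thesis by (simp add: C_def)
    qed
    have rel: "(\<Sum>b<Suc r. A $$ (i, g' b) * C b) = 0" if i: "i < dim_row A" for i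
    proof -
      let ?N = "M (f(r := i)) g' (Suc r)"
      have "\<not> P (Suc r)"
        using max[of "Suc r"] by auto
      moreover have "\<forall>a<Suc r. (f(r := i)) a < dim_row A \<and> g' a \<in> J"
        using fg(1) g'J i by (auto simp: less_Suc_eq)
      ultimately have "det ?N = 0"
        unfolding P_def by blast
      moreover have "det ?N = (\<Sum>b<Suc r. ?N $$ (r, b) * cofactor ?N r b)"
        by (rule laplace_expansion_row) auto
      moreover have "mat_delete ?N r b = mat r r (\<lambda>(a, c). A $$ (f a, g' (if c < b then c else Suc c)))"
        if "b < Suc r" for b
        using that by (intro eq_matI) (auto simp: mat_delete_def M_def)
      ultimately show ?thesis
        by (simp add: cofactor_def C_def M_def)
    qed
    define w where "w k = (if k \<in> g' ` {..<Suc r} then C (inv_into {..<Suc r} g' k) else 0)" for k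
    have w_g': "w (g' b) = C b" if "b < Suc r" for b
      using that inj' by (auto simp: w_def)
    have "int_ker A w"
      unfolding int_ker_def
    proof (intro allI impI)
      fix i assume "i < dim_row A"
      have "(\<Sum>k<dim_col A. A $$ (i, k) * w k) = (\<Sum>k \<in> g' ` {..<Suc r}. A $$ (i, k) * w k)"
        by (rule sum.mono_neutral_right) (use g'J J in \<open>auto simp: w_def\<close>)
      also have "\<dots> = (\<Sum>b<Suc r. A $$ (i, g' b) * C b)"
        by (subst sum.reindex[OF inj']) (simp add: w_g')
      finally show "(\<Sum>k<dim_col A. A $$ (i, k) * w k) = 0"
        using rel \<open>i < dim_row A\<close> by simp
    qed
    moreover have "w k \<in> {0, 1, -1}" for k
      using C[of "inv_into {..<Suc r} g' k"] inv_into_into[of k g' "{..<Suc r}"] by (auto simp: w_def)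
    moreover have "w k = 0" if "k \<notin> J" for k
      using that g'J by (auto simp: w_def)
    moreover have "w (g' r) \<noteq> 0"
      using w_g'[of r] Cr det by simp
    ultimately show thesis
      by (intro dependent[of w]) blast+
  qed
qed

section \<open>Circuits as minimal kernel vectors\<close>

lemma mat_kernel_int_ker:
  "v \<in> mat_kernel A \<longleftrightarrow> dim_vec v = dim_col A \<and> int_ker A (\<lambda>j. v $ j)"
proof -
  have "A *\<^sub>v v = 0\<^sub>v (dim_row A) \<longleftrightarrow> int_ker A (\<lambda>j. v $ j)" if dim: "dim_vec v = dim_col A"
  proof -
    have "(A *\<^sub>v v) $ i = (\<Sum>j<dim_col A. A $$ (i, j) * v $ j)" if "i < dim_row A" for i
      using that dim by (auto simp: scalar_prod_def atLeast0LessThan intro!: sum.cong)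
    then show ?thesis
      unfolding vec_eq_iff int_ker_def by simp
  qed
  then show ?thesis
    unfolding mat_kernel_def carrier_vec_def by blast
qed

lemma circuitD:
  assumes "circuit A c"
  shows "dim_vec c = dim_col A" "int_ker A (\<lambda>j. c $ j)" "\<exists>j<dim_col A. c $ j \<noteq> 0"
    and "\<And>w. int_ker A w \<Longrightarrow> \<exists>j<dim_col A. w j \<noteq> 0 \<Longrightarrow> (\<And>j. j < dim_col A \<Longrightarrow> c $ j = 0 \<Longrightarrow> w j = 0) \<Longrightarrow>
      (\<And>j. j < dim_col A \<Longrightarrow> c $ j \<noteq> 0 \<Longrightarrow> w j \<noteq> 0)"
proof -
  show 1: "dim_vec c = dim_col A" "int_ker A (\<lambda>j. c $ j)"
    using assms unfolding circuit_def mat_kernel_int_ker by blast+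
  have "c \<noteq> 0\<^sub>v (dim_col A)"
    using assms unfolding circuit_def by blast
  then show "\<exists>j<dim_col A. c $ j \<noteq> 0"
    using 1(1) by (auto simp: vec_eq_iff)
  fix w j assume w: "int_ker A w" "\<exists>j<dim_col A. w j \<noteq> 0" "\<And>j. j < dim_col A \<Longrightarrow> c $ j = 0 \<Longrightarrow> w j = 0"
    and j: "j < dim_col A" "c $ j \<noteq> 0"
  let ?w = "vec (dim_col A) w"
  have "int_ker A (\<lambda>j. ?w $ j)"
    using w(1) by (subst int_ker_cong[of _ _ w]) auto
  then have "?w \<in> mat_kernel A" "?w \<noteq> 0\<^sub>v (dim_col A)"
    using w by (auto simp: mat_kernel_int_ker vec_eq_iff)
  moreover have "vec_support ?w \<subseteq> vec_support c"
    using w(3) 1 by (auto simp: vec_support_def)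
  ultimately have "vec_support ?w = vec_support c"
    using assms unfolding circuit_def by blast
  moreover have "j \<in> vec_support c"
    using j 1(1) by (simp add: vec_support_def)
  ultimately have "j \<in> vec_support ?w"
    by simp
  then show "w j \<noteq> 0"
    using j(1) by (simp add: vec_support_def)
qed

text \<open>Among the nonzero kernel vectors supported within \<open>v\<close>, one of least support
  size has minimal support; dividing by the gcd makes its entries coprime.\<close>

lemma exists_circuit:
  assumes "int_ker A v" "\<exists>j<dim_col A. v j \<noteq> 0"
  obtains c where "circuit A c" "\<And>j. j < dim_col A \<Longrightarrow> v j = 0 \<Longrightarrow> c $ j = 0"
proof -
  define supp where "supp w = {j. j < dim_col A \<and> w j \<noteq> 0}" for w :: "nat \<Rightarrow> int"
  define P where "P w \<longleftrightarrow> int_ker A w \<and> supp w \<noteq> {} \<and> supp w \<subseteq> supp v" for w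
  have "P v" using assms by (auto simp: P_def supp_def)
  define w where "w = arg_min (\<lambda>w. card (supp w)) P"
  have w: "P w" and min: "P w' \<Longrightarrow> card (supp w) \<le> card (supp w')" for w'
    using arg_min_nat_lemma[of P v "\<lambda>w. card (supp w)", OF \<open>P v\<close>] by (simp_all add: w_def)
  have fin: "finite (supp w)" for w by (simp add: supp_def)
  define G where "G = Gcd (w ` {..<dim_col A})"
  define c where "c = vec (dim_col A) (\<lambda>j. w j div G)"
  have dimc: "dim_vec c = dim_col A" by (simp add: c_def)
  have Gne: "G \<noteq> 0" using w by (auto simp: G_def P_def supp_def)
  have wG: "w j = G * c $ j" if "j < dim_col A" for j
  proof -
    have "G dvd w j" unfolding G_def using that by (intro Gcd_dvd) auto
    then show ?thesis using that by (simp add: c_def)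
  qed
  have kerc: "int_ker A (\<lambda>j. c $ j)"
  proof -
    have "G * (\<Sum>j<dim_col A. A $$ (i, j) * c $ j) = (\<Sum>j<dim_col A. A $$ (i, j) * w j)" for i
      by (auto simp: sum_distrib_left wG mult_ac intro!: sum.cong)
    moreover have "(\<Sum>j<dim_col A. A $$ (i, j) * w j) = 0" if "i < dim_row A" for i
      using w that by (simp add: P_def int_ker_def)
    ultimately have "G * (\<Sum>j<dim_col A. A $$ (i, j) * c $ j) = 0" if "i < dim_row A" for i
      using that by presburger
    then show ?thesis using Gne by (simp add: int_ker_def)
  qed
  have set: "set\<^sub>v c = (\<lambda>j. c $ j) ` {..<dim_col A}"
    by (auto simp: vec_set_def c_def)
  have "G = Gcd ((*) G ` set\<^sub>v c)"
  proof -
    have "(*) G ` set\<^sub>v c = w ` {..<dim_col A}"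
      unfolding set image_image by (rule image_cong) (simp_all add: wG)
    then show ?thesis by (simp only: G_def[symmetric])
  qed
  also have "\<dots> = normalize (G * Gcd (set\<^sub>v c))"
    by (rule Gcd_mult)
  also have "\<dots> = G * Gcd (set\<^sub>v c)"
    by (simp add: G_def abs_mult)
  finally have "G * 1 = G * Gcd (set\<^sub>v c)"
    by simp
  then have gcd: "Gcd (set\<^sub>v c) = 1" using Gne by simp
  have suppc: "vec_support c = supp w"
  proof -
    have "c $ j \<noteq> 0 \<longleftrightarrow> w j \<noteq> 0" if "j < dim_col A" for j
      using wG[OF that] Gne by (metis mult_eq_0_iff)
    then show ?thesis by (auto simp: vec_support_def supp_def dimc)
  qed
  have circ: "circuit A c"
    unfolding circuit_def
  proof (intro conjI ballI impI)
    show "c \<in> mat_kernel A" using kerc by (simp add: mat_kernel_int_ker c_def)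
    show "c \<noteq> 0\<^sub>v (dim_col A)"
    proof
      assume "c = 0\<^sub>v (dim_col A)"
      then have "vec_support c = {}" by (auto simp: vec_support_def)
      then show False using suppc w by (simp add: P_def)
    qed
    show "Gcd (set\<^sub>v c) = 1" by (rule gcd)
    fix u assume u: "u \<in> mat_kernel A" "u \<noteq> 0\<^sub>v (dim_col A)" "vec_support u \<subseteq> vec_support c"
    have dim: "dim_vec u = dim_col A" using u by (simp add: mat_kernel_int_ker)
    have su: "supp (\<lambda>j. u $ j) = vec_support u" using dim by (auto simp: supp_def vec_support_def)
    have "supp (\<lambda>j. u $ j) \<noteq> {}" using u dim by (auto simp: supp_def vec_eq_iff)
    then have "P (\<lambda>j. u $ j)"
      using u w unfolding P_def su suppc mat_kernel_int_ker by blast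
    from min[OF this] show "vec_support u = vec_support c"
      using u(3) card_subset_eq[OF fin[of w], of "vec_support u"] card_mono[OF fin[of w], of "vec_support u"]
      unfolding su suppc by auto
  qed
  show thesis
  proof (rule that[OF circ])
    fix j assume "j < dim_col A" "v j = 0"
    then have "j \<notin> supp w" using w by (auto simp: P_def supp_def)
    then show "c $ j = 0" using wG \<open>j < dim_col A\<close> Gne by (auto simp: supp_def)
  qed
qed

text \<open>On the support of \<open>c\<close> the dichotomy yields a kernel vector \<open>w\<close>
  with entries 0, 1, -1, as dual functionals would force \<open>c\<close> to vanish there.
  Cancelling one coordinate shows by minimality that \<open>c\<close> is a multiple of
  \<open>w\<close>, and coprimality makes the factor 1 or -1.\<close>

lemma totally_unimodular_circuit_entries:
  assumes tu: "totally_unimodular A" and c: "circuit A c" and j: "j < dim_col A"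
  shows "c $ j \<in> {0, 1, -1}"
proof -
  note D = circuitD[OF c]
  let ?J = "{j. j < dim_col A \<and> c $ j \<noteq> 0}"
  obtain k where k: "k < dim_col A" "c $ k \<noteq> 0" using D(3) by auto
  have "?J \<subseteq> {..<dim_col A}" by auto
  from tu this show ?thesis
  proof (cases rule: totally_unimodular_dichotomy)
    case (dependent w)
    obtain l where l: "w l \<noteq> 0" using dependent(4) by auto
    then have lJ: "l < dim_col A" "c $ l \<noteq> 0" using dependent(3)[of l] by auto
    let ?u = "\<lambda>j. c $ l * w j + (- w l) * c $ j"
    have ker: "int_ker A ?u"
      by (rule int_ker_lin) (use D(2) dependent(1) in auto)
    have zero: "?u i = 0" if i: "i < dim_col A" for i
    proof (rule ccontr)
      assume "?u i \<noteq> 0"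
      then have "\<exists>j<dim_col A. ?u j \<noteq> 0" using i by blast
      from D(4)[OF ker this _ lJ] have "?u l \<noteq> 0"
        using dependent(3) by auto
      then show False by simp
    qed
    have wl: "w l = 1 \<or> w l = -1" using l dependent(2)[of l] by auto
    have eq: "c $ i = (c $ l * w l) * w i" if "i < dim_col A" for i
      using zero[OF that] wl by auto
    have "c $ l * w l dvd Gcd (set\<^sub>v c)"
      by (rule Gcd_greatest) (use D(1) eq in \<open>auto simp: vec_set_def\<close>)
    then have "c $ l * w l dvd 1" using c by (simp add: circuit_def)
    then have "c $ l * w l = 1 \<or> c $ l * w l = -1" by auto
    then show ?thesis using eq[OF j] dependent(2)[of j] by auto
  next
    case independent
    obtain p where p: "\<forall>i\<in>?J. row_comb A p i = (if i = k then 1 else 0)"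
      using independent[of k] k by auto
    have "(\<Sum>j<dim_col A. row_comb A p j * c $ j) = (\<Sum>j<dim_col A. if j = k then c $ k else 0)"
      by (rule sum.cong) (use p in auto)
    then have "c $ k = 0" using int_ker_orthogonal[OF D(2), of p] k by simp
    then show ?thesis using k by simp
  qed
qed

section \<open>Consequences of total unimodularity and evenness\<close>

locale even_circuits =
  fixes A :: "int mat"
  assumes tu: "totally_unimodular A"
    and even_circuits: "\<And>v. circuit A v \<Longrightarrow> even (card (vec_support v))"
begin

abbreviation "n \<equiv> dim_col A"

text \<open>Entries 0, 1, -1 are congruent modulo 2 to the indicator of the support.\<close>

lemma circuit_sum_even:
  assumes "circuit A c"
  shows "even (\<Sum>j<n. c $ j)"
proof -
  have "(\<Sum>j<n. c $ j) mod 2 = (\<Sum>j<n. (c $ j) mod 2) mod 2"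
    by (simp add: mod_sum_eq)
  also have "(\<Sum>j<n. (c $ j) mod 2) = (\<Sum>j<n. if c $ j \<noteq> 0 then 1 else 0)"
    by (rule sum.cong) (use totally_unimodular_circuit_entries[OF tu assms] in force)+
  also have "\<dots> = int (card (vec_support c))"
    using circuitD(1)[OF assms] by (simp add: vec_support_def sum.If_cases Int_def lessThan_def)
  finally show ?thesis
    using even_circuits[OF assms] by presburger
qed

text \<open>Induction on the support size: subtracting a multiple of a circuit inside the support
  removes a coordinate, and the circuit has even sum.\<close>

lemma int_ker_sum_even: "int_ker A v \<Longrightarrow> even (\<Sum>j<n. v j)"
proof (induction "card {j. j < n \<and> v j \<noteq> 0}" arbitrary: v rule: less_induct)
  case (less v)
  show ?case
  proof (cases "\<exists>j<n. v j \<noteq> 0")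
    case True
    obtain c where c: "circuit A c" "\<And>j. j < n \<Longrightarrow> v j = 0 \<Longrightarrow> c $ j = 0"
      using exists_circuit[OF less.prems True] by blast
    obtain l where l: "l < n" "c $ l \<noteq> 0" using circuitD(3)[OF c(1)] by auto
    have cl: "c $ l = 1 \<or> c $ l = -1"
      using totally_unimodular_circuit_entries[OF tu c(1) l(1)] l by auto
    \<comment> \<open>\<open>c $ l\<close> is its own inverse, so this multiple cancels the entry
      \<open>l\<close>.\<close>
    let ?u = "\<lambda>j. 1 * v j + (- v l * c $ l) * c $ j"
    have ker: "int_ker A ?u"
      by (rule int_ker_lin) (use less.prems circuitD(2)[OF c(1)] in auto)
    have "{j. j < n \<and> ?u j \<noteq> 0} \<subset> {j. j < n \<and> v j \<noteq> 0}"
    proof (rule psubsetI)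
      show "{j. j < n \<and> ?u j \<noteq> 0} \<subseteq> {j. j < n \<and> v j \<noteq> 0}" using c(2) by auto
      have "v l \<noteq> 0" using c(2)[OF l(1)] l by auto
      moreover have "?u l = 0" using cl by auto
      ultimately show "{j. j < n \<and> ?u j \<noteq> 0} \<noteq> {j. j < n \<and> v j \<noteq> 0}" using l by blast
    qed
    then have "card {j. j < n \<and> ?u j \<noteq> 0} < card {j. j < n \<and> v j \<noteq> 0}"
      by (intro psubset_card_mono) auto
    from less.hyps[OF this ker] have "even (\<Sum>j<n. ?u j)" .
    moreover have "(\<Sum>j<n. ?u j) = (\<Sum>j<n. v j) + (- v l * c $ l) * (\<Sum>j<n. c $ j)"
      by (simp only: sum.distrib sum_distrib_left mult_1 mult.assoc)
    moreover have "even ((- v l * c $ l) * (\<Sum>j<n. c $ j))"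
      using circuit_sum_even[OF c(1)] by simp
    ultimately show ?thesis by (metis even_add)
  next
    case False
    then have "(\<Sum>j<n. v j) = 0" by (intro sum.neutral) auto
    then show ?thesis by simp
  qed
qed

text \<open>In the dependent case of the dichotomy the kernel vector on \<open>J\<close> would yield
  a circuit inside \<open>J\<close>.\<close>

lemma exists_functional:
  assumes J: "J \<subseteq> {..<n}" and indep: "\<And>c. circuit A c \<Longrightarrow> \<exists>j<n. j \<notin> J \<and> c $ j \<noteq> 0" and j: "j \<in> J"
  shows "\<exists>p. \<forall>k\<in>J. row_comb A p k = (if k = j then 1 else 0)"
  using tu J
proof (cases rule: totally_unimodular_dichotomy)
  case (dependent w)
  have "\<exists>j<n. w j \<noteq> 0" using dependent(3,4) J by (metis lessThan_iff subsetD)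
  then obtain c where "circuit A c" "\<And>j. j < n \<Longrightarrow> w j = 0 \<Longrightarrow> c $ j = 0"
    using exists_circuit[OF dependent(1)] by blast
  then show ?thesis using indep dependent(3) by blast
next
  case independent
  then show ?thesis using j by simp
qed

text \<open>Parity excludes size one, that is, zero columns.\<close>

lemma circuit_card_ge_2: "circuit A c \<Longrightarrow> card (vec_support c) \<ge> 2"
proof -
  assume c: "circuit A c"
  have "vec_support c \<noteq> {}" using circuitD(1,3)[OF c] by (auto simp: vec_support_def)
  moreover have "finite (vec_support c)" by (simp add: vec_support_def)
  ultimately have "card (vec_support c) > 0" by (simp add: card_gt_0_iff)
  with even_circuits[OF c] show ?thesis
    by (cases "card (vec_support c) = 1") auto
qed

lemma column_functional:
  assumes "i < n"
  obtains p where "row_comb A p i = 1"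
proof -
  have "\<exists>j<n. j \<notin> {i} \<and> c $ j \<noteq> 0" if "circuit A c" for c
  proof (rule ccontr)
    assume "\<not> ?thesis"
    then have "vec_support c \<subseteq> {i}" using circuitD(1)[OF that] by (auto simp: vec_support_def)
    then have "card (vec_support c) \<le> 1" using card_mono[of "{i}"] by fastforce
    then show False using circuit_card_ge_2[OF that] by simp
  qed
  from exists_functional[OF _ this, of i] show thesis
    using assms that by auto
qed

text \<open>The support has at least two elements, hence is \<open>{i, j}\<close>. The kernel
  relation then involves two columns only, and the entry at \<open>j\<close> is its own
  inverse.\<close>

lemma circuit_pair_parallel:
  assumes c: "circuit A c" and supp: "\<And>k. k < n \<Longrightarrow> k \<noteq> i \<Longrightarrow> k \<noteq> j \<Longrightarrow> c $ k = 0"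
    and ij: "i < n" "j < n"
  shows "i \<noteq> j \<and> c $ i \<in> {1, -1} \<and> c $ j \<in> {1, -1} \<and> (\<forall>r<dim_row A. A $$ (r, j) = (- c $ i * c $ j) * A $$ (r, i))"
proof -
  have sub: "vec_support c \<subseteq> {i, j}" using circuitD(1)[OF c] supp by (auto simp: vec_support_def)
  have "card {i, j} \<le> card (vec_support c)"
    using circuit_card_ge_2[OF c] by (simp add: card_insert_if)
  then have eq: "vec_support c = {i, j}"
    using sub by (simp add: card_seteq)
  have ne: "i \<noteq> j" using eq circuit_card_ge_2[OF c] by auto
  have nz: "c $ i \<noteq> 0" "c $ j \<noteq> 0" using eq by (auto simp: vec_support_def set_eq_iff)
  then have pm: "c $ i \<in> {1, -1}" "c $ j \<in> {1, -1}"
    using totally_unimodular_circuit_entries[OF tu c] ij by auto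
  have "A $$ (r, j) = (- c $ i * c $ j) * A $$ (r, i)" if "r < dim_row A" for r
  proof -
    have "0 = (\<Sum>k<n. A $$ (r, k) * c $ k)" using circuitD(2)[OF c] that by (simp add: int_ker_def)
    also have "\<dots> = (\<Sum>k\<in>{i, j}. A $$ (r, k) * c $ k)"
      by (rule sum.mono_neutral_right) (use ij supp in auto)
    also have "\<dots> = A $$ (r, i) * c $ i + A $$ (r, j) * c $ j" using ne by simp
    finally show ?thesis using pm by auto
  qed
  then show ?thesis using ne pm by blast
qed

text \<open>A circuit inside \<open>{i, j}\<close> would make the two columns equal up to sign, so
  the pair is circuit-free and has dual functionals.\<close>

lemma separating_functional:
  assumes ij: "i < n" "j < n" "i \<noteq> j"
    and npar: "\<And>e. e \<in> {1, -1} \<Longrightarrow> \<exists>r<dim_row A. A $$ (r, j) \<noteq> e * A $$ (r, i)"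
  obtains p where "row_comb A p j = 1" "row_comb A p i = 0"
proof -
  have "\<exists>k<n. k \<notin> {i, j} \<and> c $ k \<noteq> 0" if c: "circuit A c" for c
  proof (rule ccontr)
    assume "\<not> ?thesis"
    then have "i \<noteq> j \<and> c $ i \<in> {1, -1} \<and> c $ j \<in> {1, -1} \<and> (\<forall>r<dim_row A. A $$ (r, j) = (- c $ i * c $ j) * A $$ (r, i))"
      using c ij by (intro circuit_pair_parallel) auto
    then show False using npar[of "- c $ i * c $ j"] by auto
  qed
  from exists_functional[OF _ this, of j] show thesis
    using ij that by auto
qed

end

section \<open>An entropy maximisation argument\<close>

text \<open>The value at 0 is 0, the continuous extension, so that the entropy can be maximised over
  a closed region.\<close>

definition xlnx :: "real \<Rightarrow> real" where "xlnx t = t * ln t"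

lemma continuous_on_xlnx: "continuous_on {0..} xlnx"
proof -
  have "continuous (at t within {0..}) xlnx" if "t \<ge> 0" for t
  proof (cases "t = 0")
    case True
    have "(xlnx \<longlongrightarrow> 0) (at_right 0)"
      unfolding xlnx_def by real_asymp
    then show ?thesis
      using True by (simp add: continuous_within xlnx_def at_within_Ici_at_right)
  next
    case False
    then show ?thesis
      using that unfolding xlnx_def by (intro continuous_intros) auto
  qed
  then show ?thesis by (simp add: continuous_on_eq_continuous_within)
qed

lemma DERIV_xlnx: "t > 0 \<Longrightarrow> (xlnx has_real_derivative ln t + 1) (at t)"
  unfolding xlnx_def by (auto intro!: derivative_eq_intros)

text \<open>The constants 1 of the two derivatives cancel. What remains is the logarithm of the
  absolute ratio of \<open>x\<close> and \<open>s - x\<close>, which is why stationary points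
  satisfy the toric equations up to sign.\<close>

lemma DERIV_xlnx_line:
  assumes "x > s" "(s :: real) \<ge> 0"
  shows "((\<lambda>t. xlnx (x + t * h) - xlnx (x + t * h - s)) has_real_derivative h * ln (x / (x - s))) (at 0)"
proof -
  have 1: "((\<lambda>t. xlnx (x + t * h)) has_real_derivative (ln x + 1) * h) (at 0)"
    by (rule DERIV_chain'[where g = xlnx and f = "\<lambda>t. x + t * h", of h, unfolded mult.commute[of h]])
       (use assms in \<open>auto intro!: derivative_eq_intros DERIV_xlnx[THEN DERIV_cong]\<close>)
  have 2: "((\<lambda>t. xlnx (x + t * h - s)) has_real_derivative (ln (x - s) + 1) * h) (at 0)"
    by (rule DERIV_chain'[where g = xlnx and f = "\<lambda>t. x + t * h - s", of h, unfolded mult.commute[of h]])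
       (use assms in \<open>auto intro!: derivative_eq_intros DERIV_xlnx[THEN DERIV_cong]\<close>)
  show ?thesis
    by (rule DERIV_cong[OF DERIV_diff[OF 1 2]]) (use assms in \<open>simp add: ln_div algebra_simps\<close>)
qed

text \<open>The infinite inward slope keeps the maximum away from the boundary.\<close>

lemma xlnx_boundary_slope:
  assumes "(s :: real) > 0" "h > 0"
  shows "filterlim (\<lambda>t. ((xlnx (s + t * h) - xlnx (s + t * h - s)) - (xlnx s - xlnx (s - s))) / t) at_top (at_right 0)"
  unfolding xlnx_def using assms by real_asymp

text \<open>Keeps the other coordinates from outweighing an infinite slope: in the interior the
  slope converges, and at the boundary an inward direction makes it tend to infinity.\<close>

lemma xlnx_slope_bounded_below:
  assumes "x \<ge> s" "(s :: real) > 0" "x = s \<Longrightarrow> h > 0"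
  shows "\<exists>c. eventually (\<lambda>t. ((xlnx (x + t * h) - xlnx (x + t * h - s)) - (xlnx x - xlnx (x - s))) / t \<ge> c) (at_right 0)"
proof (cases "x = s")
  case True
  have "eventually (\<lambda>t. ((xlnx (s + t * h) - xlnx (s + t * h - s)) - (xlnx s - xlnx (s - s))) / t \<ge> 0) (at_right 0)"
    using xlnx_boundary_slope[of s h] assms True unfolding filterlim_at_top by blast
  then show ?thesis using True by blast
next
  case False
  let ?l = "h * ln (x / (x - s))"
  have "((\<lambda>t. ((xlnx (x + t * h) - xlnx (x + t * h - s)) - (xlnx x - xlnx (x - s))) / t) \<longlongrightarrow> ?l) (at 0)"
    using DERIV_xlnx_line[of s x h] False assms by (simp add: DERIV_def)
  then have "((\<lambda>t. ((xlnx (x + t * h) - xlnx (x + t * h - s)) - (xlnx x - xlnx (x - s))) / t) \<longlongrightarrow> ?l) (at_right 0)"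
    by (rule filterlim_mono) (auto simp: at_within_le_at)
  then have "eventually (\<lambda>t. ((xlnx (x + t * h) - xlnx (x + t * h - s)) - (xlnx x - xlnx (x - s))) / t > ?l - 1) (at_right 0)"
    by (rule order_tendstoD) simp
  then show ?thesis by (intro exI[of _ "?l - 1"]) (auto elim: eventually_mono)
qed

text \<open>By \<open>orth\<close> the functional \<open>w\<close> is constant on the slice
  \<open>K\<close>; as \<open>w\<close> is positive, \<open>K\<close> is bounded. A maximum of the
  entropy exists by compactness, is interior by the infinite slope towards \<open>z\<close>, and is
  therefore stationary in all kernel directions.\<close>

lemma exists_entropy_critical_point:
  fixes B :: "nat \<Rightarrow> nat \<Rightarrow> real" and s z w :: "nat \<Rightarrow> real"
  assumes s: "\<And>j. j < N \<Longrightarrow> s j > 0" and z: "\<And>j. j < N \<Longrightarrow> z j > s j" and w: "\<And>j. j < N \<Longrightarrow> w j > 0"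
    and orth: "\<And>v. (\<And>i. i < d \<Longrightarrow> (\<Sum>j<N. B i j * v j) = 0) \<Longrightarrow> (\<Sum>j<N. w j * v j) = 0"
  obtains x where "\<And>j. j < N \<Longrightarrow> x j > s j" "\<And>i. i < d \<Longrightarrow> (\<Sum>j<N. B i j * x j) = (\<Sum>j<N. B i j * z j)"
    "\<And>v. (\<And>i. i < d \<Longrightarrow> (\<Sum>j<N. B i j * v j) = 0) \<Longrightarrow> (\<Sum>j<N. v j * ln (x j / (x j - s j))) = 0"
proof -
  have lin: "(\<Sum>j<N. b j * (\<alpha> * p j + \<beta> * q j)) = \<alpha> * (\<Sum>j<N. b j * p j) + \<beta> * (\<Sum>j<N. b j * q j)"
    for b p q :: "nat \<Rightarrow> real" and \<alpha> \<beta>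
    by (simp add: sum_distrib_left sum.distrib algebra_simps)
  \<comment> \<open>Coordinates from \<open>N\<close> on are pinned to 0, so that \<open>K\<close>
    is compact in the product topology on functions.\<close>
  define K where "K = {x. (\<forall>j<N. s j \<le> x j) \<and> (\<forall>j\<ge>N. x j = 0) \<and> (\<forall>i<d. (\<Sum>j<N. B i j * x j) = (\<Sum>j<N. B i j * z j))}"
  define F where "F x = (\<Sum>j<N. xlnx (x j) - xlnx (x j - s j))" for x
  define W where "W = (\<Sum>j<N. w j * z j)"
  define Q where "Q = Pi UNIV (\<lambda>j. if j < N then {0..W / w j} else {0})"
  have KW: "x j \<le> W / w j" if x: "x \<in> K" and j: "j < N" for x j
  proof -
    have "(\<Sum>j<N. B i j * (x j - z j)) = 0" if "i < d" for i
      using x that by (simp add: K_def right_diff_distrib sum_subtractf)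
    then have "(\<Sum>j<N. w j * (x j - z j)) = 0" by (rule orth)
    then have eq: "(\<Sum>j<N. w j * x j) = W" by (simp add: W_def right_diff_distrib sum_subtractf)
    have nn: "w k * x k \<ge> 0" if "k < N" for k
      using x that s[of k] w[of k] unfolding K_def by (auto intro!: mult_nonneg_nonneg dest!: spec[of _ k])
    have "w j * x j \<le> (\<Sum>j<N. w j * x j)"
      by (rule member_le_sum) (use j nn in auto)
    then show ?thesis using w[OF j] eq by (simp add: field_simps)
  qed
  have "K \<subseteq> Q"
    using KW s unfolding Q_def K_def by (fastforce intro: less_imp_le order_trans)
  have "compact Q"
  proof -
    have "Q = PiE UNIV (\<lambda>j. if j < N then {0..W / w j} else {0})" by (simp add: Q_def PiE_UNIV_domain)
    moreover have "compactin (product_topology (\<lambda>i. euclidean) UNIV) (PiE UNIV (\<lambda>j. if j < N then {0..W / w j} else {0}))"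
      by (subst compactin_PiE) auto
    ultimately show ?thesis by (simp add: euclidean_product_topology)
  qed
  moreover have "closed K"
  proof -
    have c: "continuous_on UNIV (\<lambda>x :: nat \<Rightarrow> real. x j)" for j by simp
    have "K = (\<Inter>j\<in>{..<N}. {x. s j \<le> x j}) \<inter> (\<Inter>j\<in>{N..}. {x. x j = 0})
        \<inter> (\<Inter>i\<in>{..<d}. {x. (\<Sum>j<N. B i j * x j) = (\<Sum>j<N. B i j * z j)})"
      by (auto simp: K_def)
    also have "closed \<dots>"
      by (intro closed_Int closed_INT ballI closed_Collect_le closed_Collect_eq continuous_intros c)
    finally show ?thesis .
  qed
  ultimately have "compact K"
    using \<open>K \<subseteq> Q\<close> by (metis compact_Int_closed inf.absorb2)
  define z' where "z' j = (if j < N then z j else 0)" for j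
  have z'K: "z' \<in> K" using z by (auto simp: K_def z'_def intro: less_imp_le)
  have contF: "continuous_on K F"
  proof -
    have c: "continuous_on K (\<lambda>x :: nat \<Rightarrow> real. x j)" for j
      by (rule continuous_on_subset[of UNIV]) auto
    have comp: "continuous_on K (\<lambda>x. xlnx (g x))"
      if "continuous_on K g" "\<And>x. x \<in> K \<Longrightarrow> g x \<ge> 0" for g
      by (rule continuous_on_compose2[OF continuous_on_xlnx that(1)]) (use that(2) in auto)
    have nn: "0 \<le> x j" "0 \<le> x j - s j" if "x \<in> K" "j < N" for x j
    proof -
      have "s j \<le> x j" "0 < s j" using that s by (auto simp: K_def)
      then show "0 \<le> x j" "0 \<le> x j - s j" by linarith+
    qed
    have "continuous_on K (\<lambda>x. xlnx (x j))" "continuous_on K (\<lambda>x. xlnx (x j - s j))" if "j < N" for j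
      by (intro comp continuous_intros c nn that; assumption)+
    then show ?thesis unfolding F_def by (intro continuous_intros) auto
  qed
  obtain x where x: "x \<in> K" and max: "\<And>y. y \<in> K \<Longrightarrow> F y \<le> F x"
    using continuous_attains_sup[OF \<open>compact K\<close> _ contF] z'K by blast
  have interior: "x j > s j" if j: "j < N" for j
  proof (rule ccontr)
    assume "\<not> x j > s j"
    then have xj: "x j = s j" using x j by (auto simp: K_def)
    \<comment> \<open>The direction leads to the interior point \<open>z'\<close>, so it is strictly
      inward at every wall that \<open>x\<close> touches.\<close>
    define h where "h k = z' k - x k" for k
    define D where "D k t = ((xlnx (x k + t * h k) - xlnx (x k + t * h k - s k)) - (xlnx (x k) - xlnx (x k - s k))) / t" for k t
    have hpos: "h k > 0" if "k < N" "x k = s k" for k using that z by (simp add: h_def z'_def)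
    have "\<exists>c. eventually (\<lambda>t. D k t \<ge> c) (at_right 0)" if "k < N" for k
      unfolding D_def using x that s hpos by (intro xlnx_slope_bounded_below) (auto simp: K_def)
    then obtain c where c: "\<And>k. k < N \<Longrightarrow> eventually (\<lambda>t. D k t \<ge> c k) (at_right 0)" by metis
    have "filterlim (D j) at_top (at_right 0)"
      unfolding D_def using xlnx_boundary_slope[OF s[OF j] hpos[OF j xj]] xj by simp
    \<comment> \<open>The bound exceeds what the other slopes can lose, leaving a total slope of at
      least 1 against the maximality of \<open>x\<close>.\<close>
    then have "eventually (\<lambda>t. D j t \<ge> 1 - sum c ({..<N} - {j})) (at_right 0)"
      unfolding filterlim_at_top by blast
    moreover have "eventually (\<lambda>t. \<forall>k\<in>{..<N} - {j}. D k t \<ge> c k) (at_right 0)"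
      by (rule eventually_ball_finite) (use c in auto)
    moreover have "eventually (\<lambda>t. t < 1) (at_right (0::real))" "eventually (\<lambda>t. t > 0) (at_right (0::real))"
      by (auto simp: eventually_at_right_less eventually_at_right_field intro: exI[of _ 1])
    ultimately have "eventually (\<lambda>t. D j t \<ge> 1 - sum c ({..<N} - {j}) \<and> (\<forall>k\<in>{..<N} - {j}. D k t \<ge> c k) \<and> t < 1 \<and> t > 0) (at_right 0)"
      by eventually_elim auto
    then obtain t where t: "D j t \<ge> 1 - sum c ({..<N} - {j})" "\<forall>k\<in>{..<N} - {j}. D k t \<ge> c k" "t < 1" "t > 0"
      using eventually_happens'[OF trivial_limit_at_right_real] by blast
    define y where "y k = x k + t * h k" for k
    have ycomb: "y k = (1 - t) * x k + t * z' k" for k by (simp add: y_def h_def algebra_simps)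
    have "y \<in> K"
      unfolding K_def
    proof (intro CollectI conjI allI impI)
      fix k assume k: "k < N"
      have "(1 - t) * s k + t * s k \<le> (1 - t) * x k + t * z' k"
        using t x z'K k by (intro add_mono mult_left_mono) (auto simp: K_def)
      then show "s k \<le> y k" by (simp add: ycomb algebra_simps)
    next
      fix k assume "k \<ge> N" then show "y k = 0" using x z'K by (simp add: ycomb K_def)
    next
      fix i assume i: "i < d"
      have "(\<Sum>j<N. B i j * y j) = (1 - t) * (\<Sum>j<N. B i j * x j) + t * (\<Sum>j<N. B i j * z' j)"
        unfolding ycomb by (rule lin)
      also have "\<dots> = (1 - t) * (\<Sum>j<N. B i j * z j) + t * (\<Sum>j<N. B i j * z j)"
        using x z'K i unfolding K_def by auto
      finally show "(\<Sum>j<N. B i j * y j) = (\<Sum>j<N. B i j * z j)" by (simp add: algebra_simps)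
    qed
    then have "(F y - F x) / t \<le> 0" using max[of y] t by (simp add: divide_le_0_iff)
    moreover have "(F y - F x) / t = (\<Sum>k<N. D k t)"
      by (simp add: F_def D_def y_def sum_divide_distrib[symmetric] sum_subtractf)
    moreover have "(\<Sum>k<N. D k t) = D j t + (\<Sum>k\<in>{..<N} - {j}. D k t)"
      using j by (simp add: sum.remove)
    moreover have "(\<Sum>k\<in>{..<N} - {j}. D k t) \<ge> sum c ({..<N} - {j})"
      using t by (intro sum_mono) auto
    ultimately show False using t(1) by linarith
  qed
  have crit: "(\<Sum>j<N. v j * ln (x j / (x j - s j))) = 0" if v: "\<And>i. i < d \<Longrightarrow> (\<Sum>j<N. B i j * v j) = 0" for v
  proof -
    \<comment> \<open>An interior point can be moved both ways along \<open>v\<close>, so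
      \<open>t = 0\<close> is a local maximum and the derivative there vanishes.\<close>
    define y where "y t j = x j + t * (if j < N then v j else 0)" for t j
    have "eventually (\<lambda>t. \<forall>j\<in>{..<N}. x j + t * v j > s j) (nhds 0)"
    proof (rule eventually_ball_finite)
      show "\<forall>j\<in>{..<N}. eventually (\<lambda>t. x j + t * v j > s j) (nhds 0)"
      proof
        fix j assume "j \<in> {..<N}"
        have "((\<lambda>t. x j + t * v j) \<longlongrightarrow> x j + 0 * v j) (nhds 0)"
          by (intro tendsto_intros filterlim_ident)
        from order_tendstoD(1)[OF this, of "s j"] show "eventually (\<lambda>t. x j + t * v j > s j) (nhds 0)"
          using interior[of j] \<open>j \<in> {..<N}\<close> by simp
      qed
    qed simp
    then obtain e where e: "e > 0" "\<And>t j. dist t 0 < e \<Longrightarrow> j < N \<Longrightarrow> x j + t * v j > s j"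
      unfolding eventually_nhds_metric by auto
    have yK: "y t \<in> K" if t: "dist t 0 < e" for t
      unfolding K_def
    proof (intro CollectI conjI allI impI)
      fix i assume i: "i < d"
      have "(\<Sum>j<N. B i j * y t j) = (\<Sum>j<N. B i j * x j) + t * (\<Sum>j<N. B i j * v j)"
        by (simp add: y_def sum_distrib_left sum.distrib algebra_simps)
      then show "(\<Sum>j<N. B i j * y t j) = (\<Sum>j<N. B i j * z j)"
        using v[OF i] x i by (simp add: K_def)
    qed (use e(2)[OF t] x in \<open>auto simp: y_def K_def intro: less_imp_le\<close>)
    have Fy: "F (y t) = (\<Sum>j<N. xlnx (x j + t * v j) - xlnx (x j + t * v j - s j))" for t
      by (simp add: F_def y_def)
    have "((\<lambda>t. F (y t)) has_real_derivative (\<Sum>j<N. v j * ln (x j / (x j - s j)))) (at 0)"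
      unfolding Fy by (intro DERIV_sum DERIV_xlnx_line) (use interior s in \<open>auto intro: less_imp_le\<close>)
    moreover have "y 0 = x" by (auto simp: y_def)
    ultimately show ?thesis
      by (elim DERIV_local_max[OF _ e(1)]) (use max yK in \<open>auto simp: dist_real_def\<close>)
  qed
  show thesis
    by (rule that[of x]) (use interior crit x in \<open>auto simp: K_def\<close>)
qed

section \<open>Toric varieties\<close>

text \<open>The exponent vector of the Laurent monomial to which \<open>m\<close> is mapped, that
  is, \<open>B\<close> times \<open>m\<close>. The toric ideal is homogeneous for this
  grading.\<close>

definition mdeg :: "int mat \<Rightarrow> (nat \<Rightarrow>\<^sub>0 nat) \<Rightarrow> (nat \<Rightarrow>\<^sub>0 int)" where
  "mdeg B m = (\<Sum>i<dim_row B. Poly_Mapping.single i (\<Sum>j \<in> Poly_Mapping.keys m. int (Poly_Mapping.lookup m j) * B $$ (i, j)))"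

lemma lookup_mdeg: "Poly_Mapping.lookup (mdeg B m) i
    = (if i < dim_row B then \<Sum>j \<in> Poly_Mapping.keys m. int (Poly_Mapping.lookup m j) * B $$ (i, j) else 0)"
  by (simp add: mdeg_def lookup_sum lookup_single when_def)

lemma prod_single_one: "(\<Prod>i\<in>S. Poly_Mapping.single (f i) (1 :: complex)) = Poly_Mapping.single (\<Sum>i\<in>S. f i) 1"
  for f :: "nat \<Rightarrow> 'e :: comm_monoid_add"
  by (induction S rule: infinite_finite_induct) (simp_all add: mult_single)

lemma single_sum: "Poly_Mapping.single i (\<Sum>j\<in>S. f j) = (\<Sum>j\<in>S. Poly_Mapping.single i (f j))"
  for f :: "nat \<Rightarrow> 'e :: comm_monoid_add"
  by (induction S rule: infinite_finite_induct) (simp_all add: single_add)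

lemma laurent_monomial:
  "(\<Prod>j \<in> Poly_Mapping.keys m. (\<Prod>i<dim_row B. laurent_var_powi i (B $$ (i, j))) ^ Poly_Mapping.lookup m j)
    = Poly_Mapping.single (mdeg B m) 1"
proof -
  have pow: "laurent_var_powi i b ^ k = Poly_Mapping.single (Poly_Mapping.single i (int k * b)) 1" for i b k
    by (induction k) (simp_all add: laurent_var_powi_def mult_single single_add[symmetric] algebra_simps)
  have "(\<Prod>j \<in> Poly_Mapping.keys m. (\<Prod>i<dim_row B. laurent_var_powi i (B $$ (i, j))) ^ Poly_Mapping.lookup m j)
      = Poly_Mapping.single (\<Sum>j \<in> Poly_Mapping.keys m. \<Sum>i<dim_row B.
          Poly_Mapping.single i (int (Poly_Mapping.lookup m j) * B $$ (i, j))) 1"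
    by (simp add: prod_power_distrib pow prod_single_one)
  also have "(\<Sum>j \<in> Poly_Mapping.keys m. \<Sum>i<dim_row B.
          Poly_Mapping.single i (int (Poly_Mapping.lookup m j) * B $$ (i, j))) = mdeg B m"
    unfolding mdeg_def by (subst sum.swap) (simp add: single_sum)
  finally show ?thesis .
qed

lemma poly_mapping_zero_iff: "f = 0 \<longleftrightarrow> (\<forall>b. Poly_Mapping.lookup f b = 0)"
proof
  assume "\<forall>b. Poly_Mapping.lookup f b = 0"
  then show "f = 0" by (intro poly_mapping_eqI) simp
qed simp

text \<open>The coefficient of the image at the exponent \<open>b\<close> collects the coefficients
  of all monomials of degree \<open>b\<close>.\<close>

lemma toric_ideal_iff:
  "f \<in> toric_ideal B \<longleftrightarrow> f \<in> polys (dim_col B) \<and>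
    (\<forall>b. (\<Sum>m \<in> {m \<in> Poly_Mapping.keys f. mdeg B m = b}. Poly_Mapping.lookup f m) = 0)"
proof -
  let ?h = "poly_hom const_poly (\<lambda>j. \<Prod>i<dim_row B. laurent_var_powi i (B $$ (i, j))) f"
  have "?h = (\<Sum>m \<in> Poly_Mapping.keys f. Poly_Mapping.single (mdeg B m) (Poly_Mapping.lookup f m))"
    by (simp add: poly_hom_def laurent_monomial const_poly_def mult_single)
  then have "Poly_Mapping.lookup ?h b = (\<Sum>m \<in> {m \<in> Poly_Mapping.keys f. mdeg B m = b}. Poly_Mapping.lookup f m)" for b
    by (simp add: lookup_sum lookup_single when_def sum.inter_filter)
  then have "?h = 0 \<longleftrightarrow> (\<forall>b. (\<Sum>m \<in> {m \<in> Poly_Mapping.keys f. mdeg B m = b}. Poly_Mapping.lookup f m) = 0)"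
    by (simp only: poly_mapping_zero_iff)
  then show ?thesis
    unfolding toric_ideal_def mem_Collect_eq by (simp only:)
qed

lemma binomial_mem_toric_ideal:
  assumes "Poly_Mapping.keys m \<subseteq> {..<dim_col B}" "Poly_Mapping.keys m' \<subseteq> {..<dim_col B}" "mdeg B m = mdeg B m'"
  shows "Poly_Mapping.single m 1 - Poly_Mapping.single m' 1 \<in> toric_ideal B"
proof (cases "m = m'")
  case True
  then show ?thesis by (simp add: toric_ideal_iff)
next
  case False
  let ?f = "Poly_Mapping.single m 1 - Poly_Mapping.single m' (1 :: complex)"
  have lk: "Poly_Mapping.lookup ?f k = (if k = m then 1 else if k = m' then -1 else 0)" for k
    using False by (auto simp: lookup_minus lookup_single when_def)
  have keys: "Poly_Mapping.keys ?f = {m, m'}"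
    using False by (auto simp: in_keys_iff lk split: if_splits)
  have "(\<Sum>k \<in> {k \<in> {m, m'}. mdeg B k = b}. Poly_Mapping.lookup ?f k) = 0" for b
  proof -
    have "(\<Sum>k \<in> {k \<in> {m, m'}. mdeg B k = b}. Poly_Mapping.lookup ?f k)
        = (\<Sum>k \<in> {m, m'}. if mdeg B k = b then Poly_Mapping.lookup ?f k else 0)"
      by (rule sum.inter_filter) simp
    also have "\<dots> = 0" using False assms by (simp add: lk)
    finally show ?thesis .
  qed
  moreover have "?f \<in> polys (dim_col B)"
    using assms by (auto simp: polys_def keys)
  ultimately show ?thesis by (simp add: toric_ideal_iff keys)
qed

text \<open>Split \<open>f\<close> by degree. Within one degree all monomials take the same value at
  \<open>z\<close>, and by \<open>toric_ideal_iff\<close> their coefficients add up to 0.\<close>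

lemma toric_varietyI:
  assumes "z \<in> carrier_vec (dim_col B)" "\<And>j. j < dim_col B \<Longrightarrow> z $ j \<noteq> 0"
    and eq: "\<And>m m'. Poly_Mapping.keys m \<subseteq> {..<dim_col B} \<Longrightarrow> Poly_Mapping.keys m' \<subseteq> {..<dim_col B} \<Longrightarrow>
      mdeg B m = mdeg B m' \<Longrightarrow> point_eval (\<lambda>j. z $ j) m = point_eval (\<lambda>j. z $ j) m'"
  shows "z \<in> toric_variety B"
proof -
  have "poly_eval f z = 0" if f: "f \<in> toric_ideal B" for f
  proof -
    let ?K = "Poly_Mapping.keys f"
    have K: "m \<in> ?K \<Longrightarrow> Poly_Mapping.keys m \<subseteq> {..<dim_col B}" for m
      using f by (auto simp: toric_ideal_iff polys_def)
    have "poly_eval f z = (\<Sum>m\<in>?K. Poly_Mapping.lookup f m * point_eval (\<lambda>j. z $ j) m)"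
      by (rule poly_eval_conv)
    also have "\<dots> = (\<Sum>b\<in>mdeg B ` ?K. \<Sum>m\<in>{m \<in> ?K. mdeg B m = b}. Poly_Mapping.lookup f m * point_eval (\<lambda>j. z $ j) m)"
      by (rule sum.group[symmetric]) auto
    also have "\<dots> = 0"
    proof (rule sum.neutral, rule ballI)
      fix b assume "b \<in> mdeg B ` ?K"
      then obtain m0 where m0: "m0 \<in> ?K" "b = mdeg B m0" by blast
      have "(\<Sum>m\<in>{m \<in> ?K. mdeg B m = b}. Poly_Mapping.lookup f m * point_eval (\<lambda>j. z $ j) m)
          = (\<Sum>m\<in>{m \<in> ?K. mdeg B m = b}. Poly_Mapping.lookup f m * point_eval (\<lambda>j. z $ j) m0)"
      proof (rule sum.cong[OF refl])
        fix m assume "m \<in> {m \<in> ?K. mdeg B m = b}"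
        then have "point_eval (\<lambda>j. z $ j) m = point_eval (\<lambda>j. z $ j) m0"
          using m0 K by (intro eq) auto
        then show "Poly_Mapping.lookup f m * point_eval (\<lambda>j. z $ j) m = Poly_Mapping.lookup f m * point_eval (\<lambda>j. z $ j) m0"
          by simp
      qed
      also have "\<dots> = (\<Sum>m\<in>{m \<in> ?K. mdeg B m = b}. Poly_Mapping.lookup f m) * point_eval (\<lambda>j. z $ j) m0"
        by (simp add: sum_distrib_right)
      also have "\<dots> = 0"
        using f unfolding toric_ideal_iff by simp
      finally show "(\<Sum>m\<in>{m \<in> ?K. mdeg B m = b}. Poly_Mapping.lookup f m * point_eval (\<lambda>j. z $ j) m) = 0" .
    qed
    finally show ?thesis .
  qed
  then show ?thesis
    using assms by (simp add: toric_variety_def)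
qed

section \<open>The Lawrence lift\<close>

lemma sum_lessThan_add: "(\<Sum>j<m + k. f j) = (\<Sum>j<m. f j) + (\<Sum>j<k. f (m + j))" for f :: "nat \<Rightarrow> 'a :: comm_monoid_add"
  by (induction k) (simp_all add: add_ac)

lemma prod_lessThan_add: "(\<Prod>j<m + k. f j) = (\<Prod>j<m. f j) * (\<Prod>j<k. f (m + j))" for f :: "nat \<Rightarrow> 'a :: comm_monoid_mult"
  by (induction k) (simp_all add: mult_ac)

lemma dim_lawrence_lift [simp]:
  "dim_row (lawrence_lift A) = dim_row A + dim_row A + dim_col A"
  "dim_col (lawrence_lift A) = dim_col A + dim_col A"
  by (simp_all add: lawrence_lift_def Let_def append_rows_def)

lemma lawrence_lift_index:
  assumes "j < dim_col A"
  shows "i < dim_row A \<Longrightarrow> lawrence_lift A $$ (i, j) = A $$ (i, j)"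
    "i < dim_row A \<Longrightarrow> lawrence_lift A $$ (i, dim_col A + j) = 0"
    "i < dim_row A \<Longrightarrow> lawrence_lift A $$ (dim_row A + i, j) = 0"
    "i < dim_row A \<Longrightarrow> lawrence_lift A $$ (dim_row A + i, dim_col A + j) = A $$ (i, j)"
    "i < dim_col A \<Longrightarrow> lawrence_lift A $$ (dim_row A + dim_row A + i, j) = (if i = j then 1 else 0)"
    "i < dim_col A \<Longrightarrow> lawrence_lift A $$ (dim_row A + dim_row A + i, dim_col A + j) = (if i = j then 1 else 0)"
  using assms by (simp_all add: lawrence_lift_def Let_def append_rows_def)

text \<open>The ring is arbitrary because the rows are applied to integral exponents, real and
  complex coordinates and polynomial variables.\<close>

lemma lawrence_lift_row_sum:
  fixes f :: "nat \<Rightarrow> 'a :: comm_ring_1" and A :: "int mat"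
  defines "L \<equiv> (\<lambda>i. \<Sum>j<dim_col A + dim_col A. of_int (lawrence_lift A $$ (i, j)) * f j)"
  shows "i < dim_row A \<Longrightarrow> L i = (\<Sum>j<dim_col A. of_int (A $$ (i, j)) * f j)"
    "i < dim_row A \<Longrightarrow> L (dim_row A + i) = (\<Sum>j<dim_col A. of_int (A $$ (i, j)) * f (dim_col A + j))"
    "i < dim_col A \<Longrightarrow> L (dim_row A + dim_row A + i) = f i + f (dim_col A + i)"
proof -
  have if1: "(\<Sum>j<n. of_int (if i = j then 1 else 0) * g j) = g i" if "i < n" for n and g :: "nat \<Rightarrow> 'a"
  proof -
    have "(\<Sum>j<n. of_int (if i = j then 1 else 0) * g j) = (\<Sum>j<n. if i = j then g j else 0)"
      by (rule sum.cong) auto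
    then show ?thesis using that by simp
  qed
  show "i < dim_row A \<Longrightarrow> L i = (\<Sum>j<dim_col A. of_int (A $$ (i, j)) * f j)"
    "i < dim_row A \<Longrightarrow> L (dim_row A + i) = (\<Sum>j<dim_col A. of_int (A $$ (i, j)) * f (dim_col A + j))"
    unfolding L_def sum_lessThan_add by (simp_all add: lawrence_lift_index)
  show "i < dim_col A \<Longrightarrow> L (dim_row A + dim_row A + i) = f i + f (dim_col A + i)"
    unfolding L_def sum_lessThan_add by (simp add: lawrence_lift_index if1 cong: sum.cong_simp)
qed

lemma lawrence_lift_row_cases:
  assumes "i < dim_row (lawrence_lift A)"
  obtains k where "k < dim_row A" "i = k" | k where "k < dim_row A" "i = dim_row A + k"
    | k where "k < dim_col A" "i = dim_row A + dim_row A + k"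
proof -
  consider "i < dim_row A" | "dim_row A \<le> i" "i < dim_row A + dim_row A" | "dim_row A + dim_row A \<le> i"
    by linarith
  then show thesis
  proof cases
    case 1 then show thesis using that(1)[of i] by simp
  next
    case 2 then show thesis using that(2)[of "i - dim_row A"] by simp
  next
    case 3 then show thesis using that(3)[of "i - (dim_row A + dim_row A)"] assms by simp
  qed
qed

lemma mdeg_eq_iff:
  assumes "Poly_Mapping.keys m \<subseteq> {..<dim_col B}" "Poly_Mapping.keys m' \<subseteq> {..<dim_col B}"
  shows "mdeg B m = mdeg B m' \<longleftrightarrow> (\<forall>i<dim_row B.
    (\<Sum>j<dim_col B. of_int (B $$ (i, j)) * (int (Poly_Mapping.lookup m j) - int (Poly_Mapping.lookup m' j))) = 0)"
proof -
  have ext: "(\<Sum>j \<in> Poly_Mapping.keys m. int (Poly_Mapping.lookup m j) * B $$ (i, j))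
      = (\<Sum>j<dim_col B. int (Poly_Mapping.lookup m j) * B $$ (i, j))"
    if "Poly_Mapping.keys m \<subseteq> {..<dim_col B}" for m i
    using that by (intro sum.mono_neutral_left) (auto simp: in_keys_iff)
  show ?thesis
    by (auto simp: poly_mapping_eq_iff fun_eq_iff lookup_mdeg ext assms right_diff_distrib sum_subtractf mult.commute)
qed

text \<open>For monomials of equal degree the identity blocks force the exponent difference to be
  \<open>(v, -v)\<close>, and the first block puts \<open>v\<close> into the kernel. The quotient of
  their values is then the product in \<open>ker\<close>.\<close>

lemma lawrence_toric_varietyI:
  fixes z :: "complex vec" and A :: "int mat"
  defines "n \<equiv> dim_col A"
  assumes z: "z \<in> carrier_vec (n + n)" and nz: "\<And>j. j < n + n \<Longrightarrow> z $ j \<noteq> 0"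
    and ker: "\<And>v. int_ker A v \<Longrightarrow> (\<Prod>j<n. (z $ j / z $ (n + j)) powi v j) = 1"
  shows "z \<in> toric_variety (lawrence_lift A)"
proof (rule toric_varietyI)
  fix m m' :: "nat \<Rightarrow>\<^sub>0 nat"
  assume K: "Poly_Mapping.keys m \<subseteq> {..<dim_col (lawrence_lift A)}" "Poly_Mapping.keys m' \<subseteq> {..<dim_col (lawrence_lift A)}"
    and eq: "mdeg (lawrence_lift A) m = mdeg (lawrence_lift A) m'"
  define v where "v j = int (Poly_Mapping.lookup m j) - int (Poly_Mapping.lookup m' j)" for j
  have rows: "(\<Sum>j<n + n. of_int (lawrence_lift A $$ (i, j)) * v j) = 0" if "i < dim_row (lawrence_lift A)" for i
    using eq that unfolding mdeg_eq_iff[OF K] v_def n_def by simp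
  have "int_ker A v"
    unfolding int_ker_def
  proof (intro allI impI)
    fix i assume "i < dim_row A"
    then show "(\<Sum>j<dim_col A. A $$ (i, j) * v j) = 0"
      using rows[of i] lawrence_lift_row_sum(1)[of i A v] by (simp add: n_def)
  qed
  moreover have neg: "v (n + j) = - v j" if "j < n" for j
    using rows[of "dim_row A + dim_row A + j"] lawrence_lift_row_sum(3)[of j A v] that by (simp add: n_def)
  ultimately have "1 = (\<Prod>j<n. (z $ j / z $ (n + j)) powi v j)" using ker by simp
  also have "\<dots> = (\<Prod>j<n. z $ j powi v j) * (\<Prod>j<n. z $ (n + j) powi v (n + j))"
    unfolding prod.distrib[symmetric]
    by (rule prod.cong) (auto simp: neg power_int_divide_distrib power_int_minus field_class.field_divide_inverse[of "_ powi _"])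
  also have "\<dots> = (\<Prod>j<n + n. z $ j powi v j)"
    by (simp add: prod_lessThan_add)
  also have "\<dots> = (\<Prod>j<n + n. z $ j ^ Poly_Mapping.lookup m j / z $ j ^ Poly_Mapping.lookup m' j)"
    by (rule prod.cong) (auto simp: v_def power_int_diff nz)
  also have "\<dots> = point_eval (\<lambda>j. z $ j) m / point_eval (\<lambda>j. z $ j) m'"
    using K by (simp add: prod_dividef point_eval_superset[of "{..<n + n}"] n_def)
  finally show "point_eval (\<lambda>j. z $ j) m = point_eval (\<lambda>j. z $ j) m'"
    by (metis divide_eq_1_iff zero_neq_one)
qed (use z nz in \<open>auto simp: n_def\<close>)

section \<open>Counting critical points\<close>

lemma poly_eval_likelihood_equation:
  assumes "i < dim_row B"
  shows "poly_eval (likelihood_equation B u i) x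
    = (\<Sum>j<dim_col B. of_int (B $$ (i, j)) * x $ j) - (map_mat of_int B *\<^sub>v u) $ i"
  by (simp add: likelihood_equation_def)

lemma mult_map_mat_index:
  assumes "i < dim_row B" "x \<in> carrier_vec (dim_col B)"
  shows "(map_mat of_int B *\<^sub>v x) $ i = (\<Sum>j<dim_col B. of_int (B $$ (i, j)) * x $ j)"
  using assms by (auto simp: scalar_prod_def atLeast0LessThan intro!: sum.cong)

lemma poly_eval_likelihood_ideal:
  assumes x: "x \<in> critical_points B u" and f: "f \<in> likelihood_ideal B u"
  shows "poly_eval f x = 0"
proof (rule poly_eval_poly_ideal[OF f[unfolded likelihood_ideal_def]])
  fix g assume "g \<in> toric_ideal B \<union> likelihood_equation B u ` {..<dim_row B}"
  then show "poly_eval g x = 0"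
  proof
    assume "g \<in> toric_ideal B"
    then show ?thesis using x by (simp add: critical_points_def toric_variety_def)
  next
    assume "g \<in> likelihood_equation B u ` {..<dim_row B}"
    then obtain i where i: "i < dim_row B" "g = likelihood_equation B u i" by blast
    have "x \<in> carrier_vec (dim_col B)" "map_mat of_int B *\<^sub>v x = map_mat of_int B *\<^sub>v u"
      using x by (auto simp: critical_points_def toric_variety_def)
    then show ?thesis
      using i mult_map_mat_index[of i B x] by (simp add: poly_eval_likelihood_equation)
  qed
qed

lemma critical_point_multiplicity_ge_1:
  "x \<in> critical_points B u \<Longrightarrow> point_multiplicity (dim_col B) (likelihood_ideal B u) x \<ge> 1"
  by (rule point_multiplicity_ge_1) (rule poly_eval_likelihood_ideal)

text \<open>Each point contributes at least 1, so a finite set of critical points has count at least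
  2; for an infinite set the count is infinite.\<close>

lemma critical_count_ne_1:
  assumes "x \<in> critical_points B u" "y \<in> critical_points B u" "x \<noteq> y"
  shows "critical_count B u \<noteq> 1"
proof (cases "finite (critical_points B u)")
  case True
  let ?\<mu> = "point_multiplicity (dim_col B) (likelihood_ideal B u)"
  have "(2 :: enat) = 1 + 1" by simp
  also have "\<dots> \<le> ?\<mu> x + ?\<mu> y"
    using assms by (intro add_mono critical_point_multiplicity_ge_1)
  also have "\<dots> = (\<Sum>p\<in>{x, y}. ?\<mu> p)" using assms by simp
  also have "\<dots> \<le> (\<Sum>p\<in>critical_points B u. ?\<mu> p)"
    by (rule sum_mono2) (use True assms in auto)
  finally have "critical_count B u \<ge> 2" using True by (simp add: critical_count_def)
  then show ?thesis by auto
qed (simp add: critical_count_def)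

text \<open>The linear polynomials vanish at every critical point, which leaves only
  \<open>c\<close>, and they bound its multiplicity by 1.\<close>

lemma critical_count_eq_1:
  assumes c: "c \<in> critical_points B u"
    and lin: "\<And>j. j < dim_col B \<Longrightarrow> var_poly j - const_poly (c $ j) \<in> likelihood_ideal B u"
  shows "critical_count B u = 1"
proof -
  have "x = c" if x: "x \<in> critical_points B u" for x
  proof (rule eq_vecI)
    show "dim_vec x = dim_vec c" using x c by (auto simp: critical_points_def toric_variety_def)
    fix j assume "j < dim_vec c"
    then have "j < dim_col B" using c by (auto simp: critical_points_def toric_variety_def)
    from poly_eval_likelihood_ideal[OF x lin[OF this]] show "x $ j = c $ j" by simp
  qed
  then have eq: "critical_points B u = {c}" using c by blast
  have "point_multiplicity (dim_col B) (likelihood_ideal B u) c \<le> 1"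
    unfolding likelihood_ideal_def by (rule point_multiplicity_le_1) (use lin in \<open>simp add: likelihood_ideal_def\<close>)
  then have "point_multiplicity (dim_col B) (likelihood_ideal B u) c = 1"
    using critical_point_multiplicity_ge_1[OF c] by simp
  then show ?thesis by (simp add: critical_count_def eq)
qed

section \<open>Generic points\<close>

text \<open>The induction removes the last variable: the coefficient of one of its powers is nonzero
  at some choice of the others, and the resulting univariate polynomial has finitely many
  roots.\<close>

lemma monomial_sum_nonvanishing:
  fixes M :: "(nat \<Rightarrow> nat) set" and c :: "(nat \<Rightarrow> nat) \<Rightarrow> complex"
  assumes "finite M" "m0 \<in> M" "c m0 \<noteq> 0" "\<And>m j. m \<in> M \<Longrightarrow> j \<ge> q \<Longrightarrow> m j = 0" "\<And>j. j < q \<Longrightarrow> infinite (S j)"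
  shows "\<exists>u. (\<forall>j<q. u j \<in> S j) \<and> (\<Sum>m\<in>M. c m * (\<Prod>j<q. u j ^ m j)) \<noteq> 0"
  using assms
proof (induction q arbitrary: M c m0)
  case 0
  have "m = m'" if "m \<in> M" "m' \<in> M" for m m'
    using 0(4)[OF that(1)] 0(4)[OF that(2)] by auto
  then have "M = {m0}" using 0(2) by blast
  then show ?case using 0(3) by simp
next
  case (Suc q)
  \<comment> \<open>The exponent of the last variable in \<open>m0\<close> selects a power whose
    coefficient is a nonzero polynomial; \<open>?r\<close> deletes this exponent and is injective on
    the selected monomials.\<close>
  let ?k = "m0 q"
  let ?Mk = "{m \<in> M. m q = ?k}"
  let ?r = "\<lambda>m :: nat \<Rightarrow> nat. m(q := 0)"
  have inj: "inj_on ?r ?Mk"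
  proof (rule inj_onI)
    fix m m' assume m: "m \<in> ?Mk" "m' \<in> ?Mk" "?r m = ?r m'"
    show "m = m'"
    proof
      fix j
      have "m j = m' j" if "j \<noteq> q"
        using fun_cong[OF m(3), of j] that by simp
      then show "m j = m' j"
        using m(1,2) by (cases "j = q") auto
    qed
  qed
  have "\<exists>u. (\<forall>j<q. u j \<in> S j) \<and> (\<Sum>m\<in>?r ` ?Mk. c (m(q := ?k)) * (\<Prod>j<q. u j ^ m j)) \<noteq> 0"
  proof (rule Suc.IH)
    show "finite (?r ` ?Mk)" using Suc.prems by simp
    show "?r m0 \<in> ?r ` ?Mk" using Suc.prems by simp
    show "c ((?r m0)(q := ?k)) \<noteq> 0" using Suc.prems by simp
    show "\<And>m j. m \<in> ?r ` ?Mk \<Longrightarrow> q \<le> j \<Longrightarrow> m j = 0" using Suc.prems(4) by (auto simp: Suc_le_eq)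
    show "\<And>j. j < q \<Longrightarrow> infinite (S j)" using Suc.prems by simp
  qed
  then obtain u where u: "\<forall>j<q. u j \<in> S j" "(\<Sum>m\<in>?r ` ?Mk. c (m(q := ?k)) * (\<Prod>j<q. u j ^ m j)) \<noteq> 0" by blast
  define a where "a m = c m * (\<Prod>j<q. u j ^ m j)" for m
  have "(\<Sum>m\<in>?r ` ?Mk. c (m(q := ?k)) * (\<Prod>j<q. u j ^ m j)) = (\<Sum>m\<in>?Mk. a m)"
  proof (subst sum.reindex[OF inj], rule sum.cong[OF refl])
    fix m assume "m \<in> ?Mk"
    then have "m(q := ?k) = m" by auto
    then show "((\<lambda>m. c (m(q := ?k)) * (\<Prod>j<q. u j ^ m j)) \<circ> ?r) m = a m"
      by (simp add: a_def)
  qed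
  then have ak: "(\<Sum>m\<in>?Mk. a m) \<noteq> 0" using u by simp
  define p where "p = (\<Sum>m\<in>M. Polynomial.monom (a m) (m q))"
  have "poly.coeff p ?k = (\<Sum>m\<in>?Mk. a m)"
    using Suc.prems(1) by (simp add: p_def coeff_sum sum.inter_filter)
  then have "p \<noteq> 0" using ak by auto
  then have "finite {t. poly p t = 0}" by (rule poly_roots_finite)
  then obtain t where t: "t \<in> S q" "poly p t \<noteq> 0"
    using Suc.prems(5)[of q] by (metis (mono_tags, lifting) finite_subset lessI mem_Collect_eq subsetI)
  have "poly p t = (\<Sum>m\<in>M. c m * (\<Prod>j<Suc q. (u(q := t)) j ^ m j))"
    by (simp add: p_def poly_sum poly_monom a_def mult_ac)
  moreover have "\<forall>j<Suc q. (u(q := t)) j \<in> S j" using u t by (simp add: less_Suc_eq)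
  ultimately show ?case using t by metis
qed

lemma polys_nonvanishing:
  assumes h: "h \<in> polys q" "h \<noteq> 0" and S: "\<And>j. j < q \<Longrightarrow> infinite (S j)"
  obtains u where "u \<in> carrier_vec q" "\<And>j. j < q \<Longrightarrow> u $ j \<in> S j" "poly_eval h u \<noteq> 0"
proof -
  let ?L = "Poly_Mapping.lookup :: (nat \<Rightarrow>\<^sub>0 nat) \<Rightarrow> nat \<Rightarrow> nat"
  let ?K = "Poly_Mapping.keys h"
  have inj: "inj_on ?L ?K" by (simp add: inj_on_def lookup_inject)
  have K: "m \<in> ?K \<Longrightarrow> Poly_Mapping.keys m \<subseteq> {..<q}" for m using h by (auto simp: polys_def)
  obtain m0 where m0: "m0 \<in> ?K"
    using h(2) poly_mapping_sum_single[of h] by (metis ex_in_conv sum.empty)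
  let ?c = "\<lambda>m. Poly_Mapping.lookup h (Abs_poly_mapping m)"
  have "\<exists>u. (\<forall>j<q. u j \<in> S j) \<and> (\<Sum>m\<in>?L ` ?K. ?c m * (\<Prod>j<q. u j ^ m j)) \<noteq> 0"
  proof (rule monomial_sum_nonvanishing[where ?m0.0 = "?L m0"])
    show "m j = 0" if mj: "m \<in> ?L ` ?K" "q \<le> j" for m j
    proof -
      obtain k where "k \<in> ?K" "m = ?L k" using mj(1) by blast
      then show ?thesis using K[of k] mj(2) by (auto simp: in_keys_iff subset_iff)
    qed
    show "?c (?L m0) \<noteq> 0" using m0 by (simp add: in_keys_iff lookup_inverse)
  qed (use m0 S in simp_all)
  then obtain u where u: "\<forall>j<q. u j \<in> S j" "(\<Sum>m\<in>?L ` ?K. ?c m * (\<Prod>j<q. u j ^ m j)) \<noteq> 0" by blast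
  have "poly_eval h (vec q u) = (\<Sum>m\<in>?K. Poly_Mapping.lookup h m * (\<Prod>j<q. u j ^ ?L m j))"
    unfolding poly_eval_conv
    by (rule sum.cong) (auto simp: point_eval_superset[OF finite_lessThan K])
  also have "\<dots> = (\<Sum>m\<in>?L ` ?K. ?c m * (\<Prod>j<q. u j ^ m j))"
    by (simp add: sum.reindex[OF inj] lookup_inverse)
  finally show thesis
    using u by (intro that[of "vec q u"]) auto
qed

text \<open>The product of the two polynomials is nonzero because polynomials form an integral
  domain.\<close>

lemma generically_conj:
  assumes "generically q P" "generically q Q"
  shows "generically q (\<lambda>u. P u \<and> Q u)"
proof -
  obtain h where h: "h \<in> polys q" "h \<noteq> 0" "\<And>u. u \<in> carrier_vec q \<Longrightarrow> poly_eval h u \<noteq> 0 \<Longrightarrow> P u"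
    using assms(1) by (auto simp: generically_def)
  obtain g where g: "g \<in> polys q" "g \<noteq> 0" "\<And>u. u \<in> carrier_vec q \<Longrightarrow> poly_eval g u \<noteq> 0 \<Longrightarrow> Q u"
    using assms(2) by (auto simp: generically_def)
  show ?thesis
    unfolding generically_def using h g by (intro bexI[of _ "h * g"]) auto
qed

lemma generically_mono:
  assumes "generically q P" "\<And>u. u \<in> carrier_vec q \<Longrightarrow> P u \<Longrightarrow> Q u"
  shows "generically q Q"
  using assms unfolding generically_def by blast

lemma generically_ball:
  assumes "finite I" "\<And>i. i \<in> I \<Longrightarrow> generically q (P i)"
  shows "generically q (\<lambda>u. \<forall>i\<in>I. P i u)"
  using assms
proof (induction I rule: finite_induct)
  case empty
  show ?case unfolding generically_def by (intro bexI[of _ 1]) auto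
next
  case (insert i I)
  then show ?case using generically_conj[of q "P i" "\<lambda>u. \<forall>i\<in>I. P i u"] by simp
qed

text \<open>The coefficient sum is the value at the all-ones vector, so the form is not the zero
  polynomial.\<close>

lemma generically_linear_form:
  assumes "(\<Sum>j<q. a j) \<noteq> 0"
  shows "generically q (\<lambda>u. (\<Sum>j<q. a j * u $ j) \<noteq> 0)"
proof -
  let ?h = "\<Sum>j<q. const_poly (a j) * var_poly j"
  have "poly_eval ?h (vec q (\<lambda>_. 1)) = (\<Sum>j<q. a j)" by simp
  then have "?h \<noteq> 0" using assms by (metis poly_eval_zero)
  then show ?thesis
    unfolding generically_def by (intro bexI[of _ ?h] conjI polys_sum polys_mult) auto
qed

text \<open>Taking real intervals for the sets \<open>S j\<close> gives real data in a prescribed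
  open box.\<close>

lemma generically_exists:
  assumes "generically q P" "\<And>j. j < q \<Longrightarrow> infinite (S j)"
  obtains u where "u \<in> carrier_vec q" "\<And>j. j < q \<Longrightarrow> u $ j \<in> S j" "P u"
proof -
  obtain h where h: "h \<in> polys q" "h \<noteq> 0" "\<And>u. u \<in> carrier_vec q \<Longrightarrow> poly_eval h u \<noteq> 0 \<Longrightarrow> P u"
    using assms(1) by (auto simp: generically_def)
  show thesis
    by (rule polys_nonvanishing[OF h(1,2), of S]) (use assms(2) h(3) that in blast)+
qed

text \<open>Two generic values agree at a common point, so \<open>THE\<close> returns any generic
  value; the default 0 differs from 1.\<close>

lemma mldeg_eq_1_iff: "mldeg B = 1 \<longleftrightarrow> generically (dim_col B) (\<lambda>u. critical_count B u = 1)"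
proof -
  let ?G = "\<lambda>k. generically (dim_col B) (\<lambda>u. critical_count B u = enat k)"
  have unique: "k = l" if kl: "?G k" "?G l" for k l
  proof -
    obtain u where "critical_count B u = enat k \<and> critical_count B u = enat l"
      using generically_exists[OF generically_conj[OF kl], of "\<lambda>_. UNIV"] infinite_UNIV_char_0 by blast
    then show ?thesis by (metis enat.inject)
  qed
  have eq: "mldeg B = k" if "?G k" for k
    using that unique unfolding mldeg_def by (metis (no_types, lifting) the_equality)
  have "?G (mldeg B)" if nz: "mldeg B \<noteq> 0"
  proof -
    obtain k where "?G k" using nz unfolding mldeg_def by presburger
    with eq[OF this] show ?thesis by simp
  qed
  then show ?thesis using eq[of 1] by (auto simp: one_enat_def)
qed

section \<open>Circuits of size two\<close>

lemma powi_sum: "finite S \<Longrightarrow> (g :: 'a :: field) \<noteq> 0 \<Longrightarrow> (\<Prod>j\<in>S. g powi f j) = g powi (\<Sum>j\<in>S. f j)"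
  by (induction S rule: finite_induct) (auto simp: power_int_add)

text \<open>The parallel classes as data: \<open>\<rho>\<close> picks a representative column,
  \<open>\<epsilon>\<close> is the sign of a column relative to it, and \<open>P r\<close> is the
  functional dual to the representative \<open>r\<close>.\<close>

locale parallel_classes = even_circuits +
  fixes \<rho> :: "nat \<Rightarrow> nat" and \<epsilon> :: "nat \<Rightarrow> int" and P :: "nat \<Rightarrow> nat \<Rightarrow> int"
  assumes rho_less: "j < dim_col A \<Longrightarrow> \<rho> j < dim_col A"
    and rho_idem: "j < dim_col A \<Longrightarrow> \<rho> (\<rho> j) = \<rho> j"
    and eps_cases: "\<epsilon> j = 1 \<or> \<epsilon> j = - 1"
    and eps_rho: "j < dim_col A \<Longrightarrow> \<epsilon> (\<rho> j) = 1"
    and column_rho: "j < dim_col A \<Longrightarrow> i < dim_row A \<Longrightarrow> A $$ (i, j) = \<epsilon> j * A $$ (i, \<rho> j)"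
    and functional: "j < dim_col A \<Longrightarrow> k < dim_col A \<Longrightarrow>
      row_comb A (P (\<rho> k)) j = (if \<rho> j = \<rho> k then \<epsilon> j else 0)"
begin

definition cls :: "nat \<Rightarrow> nat set" where "cls j = {k. k < n \<and> \<rho> k = \<rho> j}"

text \<open>For \<open>\<epsilon> k = - 1\<close> the two variables belonging to column \<open>k\<close> are interchanged; this makes all
  columns of a parallel class equal.\<close>

definition xi :: "nat \<Rightarrow> nat" where "xi k = (if \<epsilon> k = 1 then k else n + k)"
definition yi :: "nat \<Rightarrow> nat" where "yi k = (if \<epsilon> k = 1 then n + k else k)"

lemma finite_cls [simp]: "finite (cls j)" by (simp add: cls_def)

lemma cls_less: "k \<in> cls j \<Longrightarrow> k < n" by (simp add: cls_def)

lemma cls_nonempty: "j < n \<Longrightarrow> cls j \<noteq> {}" by (auto simp: cls_def)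

lemma cls_rho: "k \<in> cls j \<Longrightarrow> \<rho> k = \<rho> j" by (simp add: cls_def)

lemma cls_cong: "\<rho> j = \<rho> k \<Longrightarrow> cls j = cls k" by (simp add: cls_def)

lemma xi_yi_less: "k < n \<Longrightarrow> xi k < n + n" "k < n \<Longrightarrow> yi k < n + n"
  by (auto simp: xi_def yi_def)

lemma xi_yi_sum: "f (xi k) + f (yi k) = f k + f (n + k)" for f :: "nat \<Rightarrow> 'a :: ab_semigroup_add"
  by (auto simp: xi_def yi_def add.commute)

lemma inj_xi: "inj_on xi (cls j)" and inj_yi: "inj_on yi (cls j)"
  by (auto simp: inj_on_def xi_def yi_def cls_def split: if_splits)

lemma index_cases:
  assumes "t < n + n"
  obtains k where "k < n" "t = xi k" | k where "k < n" "t = yi k"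
proof -
  define k where "k = (if t < n then t else t - n)"
  have "k < n" "t = k \<or> t = n + k" using assms by (auto simp: k_def)
  then show thesis using that[of k] by (cases "\<epsilon> k = 1") (auto simp: xi_def yi_def)
qed

text \<open>The functional of the class of \<open>k\<close> vanishes on the kernel and sees only
  that class.\<close>

lemma int_ker_cls_sum:
  assumes "int_ker A v" "k < n"
  shows "(\<Sum>j\<in>cls k. \<epsilon> j * v j) = 0"
proof -
  have "0 = (\<Sum>j<n. row_comb A (P (\<rho> k)) j * v j)"
    using int_ker_orthogonal[OF assms(1)] by simp
  also have "\<dots> = (\<Sum>j<n. if \<rho> j = \<rho> k then \<epsilon> j * v j else 0)"
    by (rule sum.cong) (use functional assms in auto)
  also have "\<dots> = (\<Sum>j\<in>cls k. \<epsilon> j * v j)"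
    by (simp add: cls_def sum.inter_filter[symmetric] lessThan_def)
  finally show ?thesis by simp
qed

text \<open>Converse to \<open>int_ker_cls_sum\<close>: within a class the columns are signed copies
  of the representative, which can be factored out.\<close>

lemma sum_by_class:
  fixes g :: "nat \<Rightarrow> 'a :: comm_ring_1"
  assumes i: "i < dim_row A" and g: "\<And>k. k < n \<Longrightarrow> (\<Sum>j\<in>cls k. of_int (\<epsilon> j) * g j) = 0"
  shows "(\<Sum>j<n. of_int (A $$ (i, j)) * g j) = 0"
proof -
  have "(\<Sum>j<n. of_int (A $$ (i, j)) * g j) = (\<Sum>r\<in>\<rho> ` {..<n}. \<Sum>j\<in>{j \<in> {..<n}. \<rho> j = r}. of_int (A $$ (i, j)) * g j)"
    by (rule sum.group[symmetric]) auto
  also have "\<dots> = 0"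
  proof (rule sum.neutral, rule ballI)
    fix r assume "r \<in> \<rho> ` {..<n}"
    then obtain k where k: "k < n" "r = \<rho> k" by auto
    then have "{j \<in> {..<n}. \<rho> j = r} = cls k" by (auto simp: cls_def)
    moreover have "(\<Sum>j\<in>cls k. of_int (A $$ (i, j)) * g j) = of_int (A $$ (i, r)) * (\<Sum>j\<in>cls k. of_int (\<epsilon> j) * g j)"
      unfolding sum_distrib_left
    proof (rule sum.cong[OF refl])
      fix j assume "j \<in> cls k"
      then have "A $$ (i, j) = \<epsilon> j * A $$ (i, r)"
        using column_rho[of j i] i k by (simp add: cls_def)
      then show "of_int (A $$ (i, j)) * g j = of_int (A $$ (i, r)) * (of_int (\<epsilon> j) * g j)"
        by (simp add: mult_ac)
    qed
    ultimately show "(\<Sum>j\<in>{j \<in> {..<n}. \<rho> j = r}. of_int (A $$ (i, j)) * g j) = 0"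
      using g[OF k(1)] by simp
  qed
  finally show ?thesis .
qed

text \<open>On each class the base is constant and the exponents sum to 0 by
  \<open>int_ker_cls_sum\<close>.\<close>

lemma prod_by_class:
  fixes g :: "nat \<Rightarrow> complex"
  assumes "int_ker A v" and g: "\<And>k. k < n \<Longrightarrow> g k \<noteq> 0" "\<And>j k. j < n \<Longrightarrow> k < n \<Longrightarrow> \<rho> j = \<rho> k \<Longrightarrow> g j = g k"
  shows "(\<Prod>j<n. (g j powi \<epsilon> j) powi v j) = 1"
proof -
  have "(\<Prod>j<n. (g j powi \<epsilon> j) powi v j) = (\<Prod>r\<in>\<rho> ` {..<n}. \<Prod>j\<in>{j \<in> {..<n}. \<rho> j = r}. g j powi (\<epsilon> j * v j))"
    by (subst prod.group) (auto simp: power_int_mult)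
  also have "\<dots> = 1"
  proof (rule prod.neutral, rule ballI)
    fix r assume "r \<in> \<rho> ` {..<n}"
    then obtain k where k: "k < n" "r = \<rho> k" by auto
    then have "{j \<in> {..<n}. \<rho> j = r} = cls k" by (auto simp: cls_def)
    moreover have "(\<Prod>j\<in>cls k. g j powi (\<epsilon> j * v j)) = (\<Prod>j\<in>cls k. g k powi (\<epsilon> j * v j))"
    proof (rule prod.cong[OF refl])
      fix j assume "j \<in> cls k"
      then have "g j = g k" using g(2)[of j k] k by (simp add: cls_def)
      then show "g j powi (\<epsilon> j * v j) = g k powi (\<epsilon> j * v j)" by simp
    qed
    moreover have "\<dots> = 1"
      using int_ker_cls_sum[OF assms(1) k(1)] g(1)[OF k(1)] by (simp add: powi_sum)
    ultimately show "(\<Prod>j\<in>{j \<in> {..<n}. \<rho> j = r}. g j powi (\<epsilon> j * v j)) = 1" by simp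
  qed
  finally show ?thesis .
qed

section \<open>The candidate for the critical point\<close>

context
  fixes u :: "complex vec"
  assumes u: "u \<in> carrier_vec (n + n)"
begin

definition "s k = u $ k + u $ (n + k)"
definition "U k = (\<Sum>j\<in>cls k. u $ xi j)"
definition "V k = (\<Sum>j\<in>cls k. u $ yi j)"
definition "S k = (\<Sum>j\<in>cls k. s j)"

text \<open>A common ratio in a class together with \<open>x + y = s\<close> makes \<open>x\<close>
  proportional to \<open>s\<close> there; the class total \<open>U\<close> fixes the factor
  \<open>U / S\<close>.\<close>

definition xsol :: "nat \<Rightarrow> complex" where "xsol k = s k * U k / S k"
definition ysol :: "nat \<Rightarrow> complex" where "ysol k = s k * V k / S k"

definition solution :: "complex vec" where
  "solution = vec (n + n) (\<lambda>t. let k = (if t < n then t else t - n) in if t = xi k then xsol k else ysol k)"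

lemma solution_index: "k < n \<Longrightarrow> solution $ xi k = xsol k" "k < n \<Longrightarrow> solution $ yi k = ysol k"
  using xi_yi_less[of k] by (auto simp: solution_def Let_def xi_def yi_def)

lemma U_plus_V: "U k + V k = S k"
proof -
  have "U k + V k = (\<Sum>j\<in>cls k. u $ xi j + u $ yi j)"
    by (simp add: U_def V_def sum.distrib)
  also have "\<dots> = S k"
    unfolding S_def s_def by (rule sum.cong[OF refl]) (rule xi_yi_sum[of "\<lambda>t. u $ t"])
  finally show ?thesis .
qed

lemma class_const:
  assumes "\<rho> j = \<rho> k"
  shows "U j = U k" "V j = V k" "S j = S k"
  unfolding U_def V_def S_def cls_cong[OF assms] by (rule refl)+

context
  assumes s_nz: "\<And>k. k < n \<Longrightarrow> s k \<noteq> 0" and S_nz: "\<And>k. k < n \<Longrightarrow> S k \<noteq> 0"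
    and U_nz: "\<And>k. k < n \<Longrightarrow> U k \<noteq> 0" and V_nz: "\<And>k. k < n \<Longrightarrow> V k \<noteq> 0"
    and total_nz: "(\<Sum>k<n. s k) \<noteq> 0"
begin

lemma xsol_ysol: "k < n \<Longrightarrow> xsol k + ysol k = s k"
proof -
  assume "k < n"
  have "xsol k + ysol k = s k * (U k + V k) / S k"
    by (simp add: xsol_def ysol_def add_divide_distrib ring_distribs)
  then show ?thesis using S_nz[OF \<open>k < n\<close>] by (simp add: U_plus_V)
qed

lemma solution_pair_sum: "k < n \<Longrightarrow> solution $ k + solution $ (n + k) = s k"
  using xi_yi_sum[of "\<lambda>t. solution $ t" k] solution_index[of k] xsol_ysol[of k] by simp

text \<open>Equal pair sums make the deviations of the two coordinates of a column opposite, so the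
  sign \<open>\<epsilon>\<close> converts the deviation at \<open>j\<close> into that at
  \<open>xi j\<close>; the class total of \<open>xsol\<close> is \<open>U\<close>.\<close>

lemma solution_dev_sum:
  assumes k: "k < n"
  shows "(\<Sum>j\<in>cls k. of_int (\<epsilon> j) * (solution $ j - u $ j)) = 0"
proof -
  have "of_int (\<epsilon> j) * (solution $ j - u $ j) = xsol j - u $ xi j" if "j \<in> cls k" for j
  proof (cases "\<epsilon> j = 1")
    case True
    then show ?thesis using solution_index(1)[of j] cls_less[OF that] by (simp add: xi_def)
  next
    case False
    then have e: "\<epsilon> j = - 1" using eps_cases[of j] by simp
    then have "solution $ (n + j) = xsol j" "xi j = n + j"
      using solution_index(1)[of j] cls_less[OF that] by (simp_all add: xi_def)
    then show ?thesis
      using solution_pair_sum[of j] cls_less[OF that] e by (simp add: s_def algebra_simps)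
  qed
  then have "(\<Sum>j\<in>cls k. of_int (\<epsilon> j) * (solution $ j - u $ j)) = (\<Sum>j\<in>cls k. xsol j) - U k"
    by (simp add: sum_subtractf U_def)
  also have "(\<Sum>j\<in>cls k. xsol j) = (\<Sum>j\<in>cls k. s j * (U k / S k))"
    by (rule sum.cong) (auto simp: xsol_def class_const[OF cls_rho])
  also have "\<dots> = S k * (U k / S k)"
    unfolding S_def by (rule sum_distrib_right[symmetric])
  also have "\<dots> = U k"
    using S_nz[OF k] by simp
  finally show ?thesis by simp
qed

lemma solution_critical: "solution \<in> critical_points (lawrence_lift A) u"
proof -
  have carr: "solution \<in> carrier_vec (n + n)" by (simp add: solution_def)
  have nz: "solution $ t \<noteq> 0" if "t < n + n" for t
    using that
  proof (cases rule: index_cases)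
    case (1 k)
    then show ?thesis using solution_index(1)[of k] s_nz S_nz U_nz by (simp add: xsol_def)
  next
    case (2 k)
    then show ?thesis using solution_index(2)[of k] s_nz S_nz V_nz by (simp add: ysol_def)
  qed
  have ratio: "solution $ j / solution $ (n + j) = (U j / V j) powi \<epsilon> j" if j: "j < n" for j
  proof (cases "\<epsilon> j = 1")
    case True
    then have "solution $ j = xsol j" "solution $ (n + j) = ysol j"
      using solution_index[of j] j by (simp_all add: xi_def yi_def)
    then show ?thesis using True s_nz[OF j] S_nz[OF j] by (simp add: xsol_def ysol_def)
  next
    case False
    then have e: "\<epsilon> j = - 1" using eps_cases[of j] by simp
    then have "solution $ j = ysol j" "solution $ (n + j) = xsol j"
      using solution_index[of j] j by (simp_all add: xi_def yi_def)
    then show ?thesis using e s_nz[OF j] S_nz[OF j] by (simp add: xsol_def ysol_def power_int_minus)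
  qed
  have "solution \<in> toric_variety (lawrence_lift A)"
  proof (rule lawrence_toric_varietyI[OF carr nz])
    fix v assume v: "int_ker A v"
    have "(\<Prod>j<n. (solution $ j / solution $ (n + j)) powi v j) = (\<Prod>j<n. ((U j / V j) powi \<epsilon> j) powi v j)"
      by (rule prod.cong) (simp_all add: ratio)
    also have "\<dots> = 1"
    proof (rule prod_by_class[OF v, of "\<lambda>j. U j / V j"])
      show "U k / V k \<noteq> 0" if "k < n" for k using U_nz[OF that] V_nz[OF that] by simp
      show "U j / V j = U k / V k" if "\<rho> j = \<rho> k" for j k using class_const[OF that] by simp
    qed
    finally show "(\<Prod>j<n. (solution $ j / solution $ (n + j)) powi v j) = 1" .
  qed
  moreover have "map_mat of_int (lawrence_lift A) *\<^sub>v solution = map_mat of_int (lawrence_lift A) *\<^sub>v u"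
  proof (rule eq_vecI)
    fix i assume "i < dim_vec (map_mat of_int (lawrence_lift A) *\<^sub>v u)"
    then have i: "i < dim_row (lawrence_lift A)" by simp
    let ?d = "\<lambda>t. solution $ t - u $ t"
    have "(\<Sum>t<n + n. of_int (lawrence_lift A $$ (i, t)) * ?d t) = 0"
      using i
    proof (cases rule: lawrence_lift_row_cases)
      case (1 r)
      then show ?thesis
        using lawrence_lift_row_sum(1)[of r A ?d] sum_by_class[of r ?d] solution_dev_sum by simp
    next
      case (2 r)
      \<comment> \<open>With equal pair sums the deviations satisfy the second block of equations as
        soon as they satisfy the first.\<close>
      have neg: "?d (n + j) = - ?d j" if "j < n" for j
        using solution_pair_sum[OF that] by (simp add: s_def algebra_simps)
      have "(\<Sum>j<n. of_int (A $$ (r, j)) * ?d (n + j)) = - (\<Sum>j<n. of_int (A $$ (r, j)) * ?d j)"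
        unfolding sum_negf[symmetric]
        by (rule sum.cong[OF refl]) (simp only: lessThan_iff neg mult_minus_right)
      then show ?thesis
        using 2(1) lawrence_lift_row_sum(2)[of r A ?d] sum_by_class[of r ?d] solution_dev_sum
        unfolding 2(2) by simp
    next
      case (3 r)
      then show ?thesis
        using lawrence_lift_row_sum(3)[of r A ?d] solution_pair_sum[of r] by (simp add: s_def algebra_simps)
    qed
    then have "(\<Sum>t<n + n. of_int (lawrence_lift A $$ (i, t)) * solution $ t)
        = (\<Sum>t<n + n. of_int (lawrence_lift A $$ (i, t)) * u $ t)"
      by (simp add: right_diff_distrib sum_subtractf)
    then show "(map_mat of_int (lawrence_lift A) *\<^sub>v solution) $ i = (map_mat of_int (lawrence_lift A) *\<^sub>v u) $ i"
      using i carr u mult_map_mat_index[of i "lawrence_lift A" solution] mult_map_mat_index[of i "lawrence_lift A" u]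
      by simp
  qed simp
  moreover have "(\<Sum>t<n + n. solution $ t) = (\<Sum>k<n. s k)"
    unfolding sum_lessThan_add sum.distrib[symmetric] by (rule sum.cong) (simp_all add: solution_pair_sum)
  ultimately show ?thesis using total_nz by (simp add: critical_points_def)
qed

section \<open>Linear equations of the solution in the likelihood ideal\<close>

abbreviation "I \<equiv> likelihood_ideal (lawrence_lift A) u"

lemma I_add: "f \<in> I \<Longrightarrow> g \<in> I \<Longrightarrow> f + g \<in> I"
  and I_diff: "f \<in> I \<Longrightarrow> g \<in> I \<Longrightarrow> f - g \<in> I"
  and I_mult: "f \<in> I \<Longrightarrow> h \<in> polys (n + n) \<Longrightarrow> h * f \<in> I"
  and I_sum: "(\<And>i. i \<in> T \<Longrightarrow> F i \<in> I) \<Longrightarrow> sum F T \<in> I"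
  unfolding likelihood_ideal_def dim_lawrence_lift
  by (auto intro: poly_ideal_add poly_ideal_diff poly_ideal_mult poly_ideal_sum)

lemma I_zero: "0 \<in> I"
  by (simp add: likelihood_ideal_def)

lemma I_equation: "i < dim_row (lawrence_lift A) \<Longrightarrow>
  (\<Sum>t<n + n. const_poly (of_int (lawrence_lift A $$ (i, t))) * (var_poly t - const_poly (u $ t))) \<in> I"
proof -
  assume i: "i < dim_row (lawrence_lift A)"
  have "likelihood_equation (lawrence_lift A) u i \<in> I"
    unfolding likelihood_ideal_def by (rule poly_ideal_gen) (use i in auto)
  moreover have "(map_mat of_int (lawrence_lift A) *\<^sub>v u) $ i = (\<Sum>t<n + n. of_int (lawrence_lift A $$ (i, t)) * u $ t)"
    using mult_map_mat_index[OF i, of u] u by simp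
  ultimately show ?thesis
    by (simp add: likelihood_equation_def right_diff_distrib sum_subtractf const_poly_sum const_poly_mult)
qed

lemma const_poly_of_int: "const_poly (of_int k) = of_int k" for k
  by (simp add: const_poly_def)

lemma I_pair: "k < n \<Longrightarrow> var_poly (xi k) + var_poly (yi k) - const_poly (s k) \<in> I"
proof -
  assume k: "k < n"
  have "(\<Sum>t<n + n. of_int (lawrence_lift A $$ (dim_row A + dim_row A + k, t)) * (var_poly t - const_poly (u $ t))) \<in> I"
    using I_equation[of "dim_row A + dim_row A + k"] k by (simp add: const_poly_of_int)
  then have "(var_poly k - const_poly (u $ k)) + (var_poly (n + k) - const_poly (u $ (n + k))) \<in> I"
    using lawrence_lift_row_sum(3)[of k A "\<lambda>t. var_poly t - const_poly (u $ t)"] k by simp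
  then show ?thesis
    using xi_yi_sum[of var_poly k] by (simp add: s_def const_poly_add algebra_simps)
qed

text \<open>The functional of the class combines the equations of the first block into one for this
  class alone; the pair equations then replace the variable \<open>j\<close> by \<open>xi j\<close>
  where the sign is -1.\<close>

lemma I_class_sum: "k < n \<Longrightarrow> (\<Sum>j\<in>cls k. var_poly (xi j)) - const_poly (U k) \<in> I"
proof -
  assume k: "k < n"
  let ?w = "\<lambda>t. var_poly t - const_poly (u $ t)"
  have row: "(\<Sum>j<n. of_int (A $$ (i, j)) * ?w j) \<in> I" if "i < dim_row A" for i
    using I_equation[of i] lawrence_lift_row_sum(1)[of i A ?w] that by (simp add: const_poly_of_int)
  have "(\<Sum>i<dim_row A. const_poly (of_int (P (\<rho> k) i)) * (\<Sum>j<n. of_int (A $$ (i, j)) * ?w j)) \<in> I"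
    by (intro I_sum I_mult row) auto
  also have "(\<Sum>i<dim_row A. const_poly (of_int (P (\<rho> k) i)) * (\<Sum>j<n. of_int (A $$ (i, j)) * ?w j))
      = (\<Sum>j<n. of_int (row_comb A (P (\<rho> k)) j) * ?w j)"
    unfolding const_poly_of_int row_comb_def sum_distrib_left of_int_sum of_int_mult sum_distrib_right
    by (subst sum.swap) (simp add: mult.assoc)
  also have "\<dots> = (\<Sum>j<n. if \<rho> j = \<rho> k then of_int (\<epsilon> j) * ?w j else 0)"
    by (rule sum.cong) (use functional k in auto)
  also have "\<dots> = (\<Sum>j\<in>cls k. of_int (\<epsilon> j) * ?w j)"
    by (simp add: cls_def sum.inter_filter[symmetric] lessThan_def)
  finally have 1: "(\<Sum>j\<in>cls k. of_int (\<epsilon> j) * ?w j) \<in> I" .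
  have 2: "?w (xi j) - of_int (\<epsilon> j) * ?w j \<in> I" if "j \<in> cls k" for j
  proof (cases "\<epsilon> j = 1")
    case True
    then show ?thesis by (simp add: xi_def I_zero)
  next
    case False
    then have "\<epsilon> j = - 1" using eps_cases[of j] by simp
    then have eq: "?w (xi j) - of_int (\<epsilon> j) * ?w j = var_poly (xi j) + var_poly (yi j) - const_poly (s j)"
      by (simp add: xi_def yi_def s_def const_poly_add algebra_simps)
    show ?thesis unfolding eq by (rule I_pair[OF cls_less[OF that]])
  qed
  have "(\<Sum>j\<in>cls k. of_int (\<epsilon> j) * ?w j) + (\<Sum>j\<in>cls k. ?w (xi j) - of_int (\<epsilon> j) * ?w j) \<in> I"
    by (intro I_add 1 I_sum 2)
  then show ?thesis
    by (simp add: sum.distrib[symmetric] sum_subtractf U_def const_poly_sum)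
qed

text \<open>The exponent difference is \<open>(v, -v)\<close> with \<open>v\<close> equal to
  \<open>\<epsilon> j\<close> at \<open>j\<close> and -1 at the representative, a kernel vector as
  the columns are parallel; for \<open>\<rho> j = j\<close> it is 0.\<close>

lemma I_binomial:
  assumes j: "j < n"
  shows "var_poly (xi j) * var_poly (yi (\<rho> j)) - var_poly (yi j) * var_poly (xi (\<rho> j)) \<in> I"
proof -
  let ?m = "Poly_Mapping.single (xi j) (1::nat) + Poly_Mapping.single (yi (\<rho> j)) 1"
  let ?m' = "Poly_Mapping.single (yi j) (1::nat) + Poly_Mapping.single (xi (\<rho> j)) 1"
  let ?L = "lawrence_lift A"
  have r: "\<rho> j < n" using rho_less[OF j] .
  have xr: "xi (\<rho> j) = \<rho> j" "yi (\<rho> j) = n + \<rho> j" using eps_rho[OF j] by (simp_all add: xi_def yi_def)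
  have K: "Poly_Mapping.keys ?m \<subseteq> {..<dim_col ?L}" "Poly_Mapping.keys ?m' \<subseteq> {..<dim_col ?L}"
    using keys_add[of "Poly_Mapping.single (xi j) (1::nat)" "Poly_Mapping.single (yi (\<rho> j)) 1"]
      keys_add[of "Poly_Mapping.single (yi j) (1::nat)" "Poly_Mapping.single (xi (\<rho> j)) 1"]
      xi_yi_less[OF j] xi_yi_less[OF r] by fastforce+
  define g where "g t = int (Poly_Mapping.lookup ?m t) - int (Poly_Mapping.lookup ?m' t)" for t
  define \<delta> where "\<delta> t k = (if t = k then 1 else 0 :: int)" for t k :: nat
  have \<delta>_sum: "(\<Sum>t<n. a t * \<delta> t k) = a k" if "k < n" for a k
    using that by (simp add: \<delta>_def if_distrib cong: if_cong)
  have ne: "\<rho> j \<noteq> j" if "\<epsilon> j = - 1"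
    using eps_rho[OF j] that by auto
  have g: "g t = \<epsilon> j * \<delta> t j - \<delta> t (\<rho> j) \<and> g (n + t) = - (\<epsilon> j * \<delta> t j - \<delta> t (\<rho> j))" if t: "t < n" for t
  proof (cases "\<epsilon> j = 1")
    case True
    then show ?thesis
      using t j r by (auto simp: g_def \<delta>_def lookup_add lookup_single when_def xr xi_def[of j] yi_def[of j])
  next
    case False
    then have "\<epsilon> j = - 1" using eps_cases[of j] by simp
    then show ?thesis
      using t j r ne by (auto simp: g_def \<delta>_def lookup_add lookup_single when_def xr xi_def[of j] yi_def[of j])
  qed
  then have gx: "g t = \<epsilon> j * \<delta> t j - \<delta> t (\<rho> j)" and gy: "g (n + t) = - (\<epsilon> j * \<delta> t j - \<delta> t (\<rho> j))" if "t < n" for t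
    using that by blast+
  have Ag: "(\<Sum>t<n. A $$ (i, t) * (\<epsilon> j * \<delta> t j - \<delta> t (\<rho> j))) = 0" if i: "i < dim_row A" for i
  proof -
    have "(\<Sum>t<n. A $$ (i, t) * (\<epsilon> j * \<delta> t j - \<delta> t (\<rho> j)))
        = \<epsilon> j * (\<Sum>t<n. A $$ (i, t) * \<delta> t j) - (\<Sum>t<n. A $$ (i, t) * \<delta> t (\<rho> j))"
      by (simp add: right_diff_distrib sum_subtractf sum_distrib_left mult_ac)
    also have "\<dots> = \<epsilon> j * A $$ (i, j) - A $$ (i, \<rho> j)"
      by (simp only: \<delta>_sum[OF j] \<delta>_sum[OF r])
    also have "\<dots> = 0"
      using column_rho[OF j i] eps_cases[of j] by auto
    finally show ?thesis .
  qed
  have "(\<Sum>t<n + n. of_int (?L $$ (i, t)) * g t) = 0" if i: "i < dim_row ?L" for i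
    using i
  proof (cases rule: lawrence_lift_row_cases)
    case (1 r)
    then show ?thesis using lawrence_lift_row_sum(1)[of r A g] Ag[of r] by (simp add: gx)
  next
    case (2 r)
    have "(\<Sum>t<n. A $$ (r, t) * g (n + t)) = - (\<Sum>t<n. A $$ (r, t) * (\<epsilon> j * \<delta> t j - \<delta> t (\<rho> j)))"
      unfolding sum_negf[symmetric]
      by (rule sum.cong[OF refl]) (simp only: lessThan_iff gy mult_minus_right)
    then show ?thesis using 2(1) lawrence_lift_row_sum(2)[of r A g] Ag[of r] unfolding 2(2) by simp
  next
    case (3 r)
    then show ?thesis using lawrence_lift_row_sum(3)[of r A g] by (simp add: gx gy)
  qed
  then have "mdeg ?L ?m = mdeg ?L ?m'"
    unfolding mdeg_eq_iff[OF K] g_def by simp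
  then have "Poly_Mapping.single ?m 1 - Poly_Mapping.single ?m' 1 \<in> toric_ideal ?L"
    by (intro binomial_mem_toric_ideal K)
  then have "Poly_Mapping.single ?m 1 - Poly_Mapping.single ?m' 1 \<in> I"
    unfolding likelihood_ideal_def by (intro poly_ideal_gen) blast
  then show ?thesis by (simp add: var_poly_def mult_single)
qed

text \<open>Substituting \<open>y = s - x\<close> for both columns in the binomial cancels the
  quadratic terms.\<close>

lemma I_proportional:
  assumes j: "j < n"
  shows "const_poly (s (\<rho> j)) * var_poly (xi j) - const_poly (s j) * var_poly (xi (\<rho> j)) \<in> I"
proof -
  let ?X = "var_poly (xi j)" and ?Y = "var_poly (yi j)" and ?X' = "var_poly (xi (\<rho> j))" and ?Y' = "var_poly (yi (\<rho> j))"
  have r: "\<rho> j < n" using rho_less[OF j] .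
  have "(?X * ?Y' - ?Y * ?X') - ?X * (?X' + ?Y' - const_poly (s (\<rho> j))) + ?X' * (?X + ?Y - const_poly (s j)) \<in> I"
    by (intro I_add I_diff I_mult I_binomial I_pair j r polys_var xi_yi_less)
  then show ?thesis by (simp add: algebra_simps)
qed

text \<open>Summing the proportionalities over the class and using the class total solves for the
  variable of the representative; proportionality then gives the others.\<close>

lemma I_solution_x:
  assumes j: "j < n"
  shows "var_poly (xi j) - const_poly (xsol j) \<in> I"
proof -
  let ?r = "\<rho> j"
  have r: "?r < n" using rho_less[OF j] .
  have cls: "k < n" "\<rho> k = ?r" if "k \<in> cls j" for k using that by (simp_all add: cls_def)
  have nz: "s ?r \<noteq> 0" "S j \<noteq> 0" using s_nz[OF r] S_nz[OF j] .
  have "(\<Sum>k\<in>cls j. const_poly (s ?r) * var_poly (xi k) - const_poly (s k) * var_poly (xi ?r)) \<in> I"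
    by (rule I_sum) (use I_proportional cls in metis)
  then have "const_poly (s ?r) * ((\<Sum>k\<in>cls j. var_poly (xi k)) - const_poly (U j))
      - (\<Sum>k\<in>cls j. const_poly (s ?r) * var_poly (xi k) - const_poly (s k) * var_poly (xi ?r)) \<in> I"
    by (intro I_diff I_mult I_class_sum j) auto
  also have "const_poly (s ?r) * ((\<Sum>k\<in>cls j. var_poly (xi k)) - const_poly (U j))
      - (\<Sum>k\<in>cls j. const_poly (s ?r) * var_poly (xi k) - const_poly (s k) * var_poly (xi ?r))
      = const_poly (S j) * var_poly (xi ?r) - const_poly (s ?r * U j)"
    by (simp add: sum_subtractf sum_distrib_left sum_distrib_right right_diff_distrib S_def const_poly_sum const_poly_mult)
  finally have 1: "const_poly (S j) * var_poly (xi ?r) - const_poly (s ?r * U j) \<in> I" .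
  have "const_poly (1 / s ?r) * (const_poly (s ?r) * var_poly (xi j) - const_poly (s j) * var_poly (xi ?r))
      + const_poly (s j / (s ?r * S j)) * (const_poly (S j) * var_poly (xi ?r) - const_poly (s ?r * U j)) \<in> I"
    by (intro I_add I_mult 1 I_proportional j) auto
  also have "const_poly (1 / s ?r) * (const_poly (s ?r) * var_poly (xi j) - const_poly (s j) * var_poly (xi ?r))
      + const_poly (s j / (s ?r * S j)) * (const_poly (S j) * var_poly (xi ?r) - const_poly (s ?r * U j))
      = const_poly (1 / s ?r * s ?r) * var_poly (xi j)
        + const_poly (s j / (s ?r * S j) * S j - 1 / s ?r * s j) * var_poly (xi ?r)
        - const_poly (s j / (s ?r * S j) * (s ?r * U j))"
    by (simp only: const_poly_mult const_poly_diff) (simp add: algebra_simps)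
  also have "\<dots> = var_poly (xi j) - const_poly (xsol j)"
    using nz by (simp add: xsol_def)
  finally show ?thesis .
qed

lemma I_solution_y:
  assumes j: "j < n"
  shows "var_poly (yi j) - const_poly (ysol j) \<in> I"
proof -
  have "(var_poly (xi j) + var_poly (yi j) - const_poly (s j)) - (var_poly (xi j) - const_poly (xsol j)) \<in> I"
    by (intro I_diff I_pair I_solution_x j)
  then show ?thesis
    using xsol_ysol[OF j, symmetric] by (simp add: const_poly_add algebra_simps)
qed

lemma critical_count_solution: "critical_count (lawrence_lift A) u = 1"
proof (rule critical_count_eq_1[OF solution_critical])
  fix t assume "t < dim_col (lawrence_lift A)"
  then have "t < n + n" by simp
  then show "var_poly t - const_poly (solution $ t) \<in> I"
    by (cases rule: index_cases) (use I_solution_x I_solution_y solution_index in auto)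
qed

end

end

section \<open>Genericity of the nonvanishing conditions\<close>

lemma generically_index_sum:
  assumes "T \<subseteq> {..<q}" "T \<noteq> {}"
  shows "generically q (\<lambda>u. (\<Sum>t\<in>T. u $ t) \<noteq> 0)"
proof -
  let ?a = "\<lambda>t. if t \<in> T then 1 else 0 :: complex"
  have restrict: "(\<Sum>t<q. ?a t * f t) = (\<Sum>t\<in>T. f t)" for f
    using assms(1) by (intro sum.mono_neutral_cong_right) auto
  have "card T \<noteq> 0" using assms finite_subset[OF assms(1)] by simp
  then have "(\<Sum>t<q. ?a t) \<noteq> 0" using restrict[of "\<lambda>_. 1"] by simp
  from generically_linear_form[OF this] show ?thesis by (simp only: restrict)
qed

text \<open>Each condition is a sum of coordinates of \<open>u\<close> over a nonempty index set,
  hence a nonzero linear form. For the total sum this uses \<open>n > 0\<close>.\<close>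

lemma generically_critical_count_eq_1:
  assumes "n > 0"
  shows "generically (n + n) (\<lambda>u. critical_count (lawrence_lift A) u = 1)"
proof -
  have gs: "generically (n + n) (\<lambda>u. u $ k + u $ (n + k) \<noteq> 0)" if "k < n" for k
  proof (rule generically_mono[OF generically_index_sum[of "{k, n + k}"]])
  qed (use that assms in auto)
  have gU: "generically (n + n) (\<lambda>u. (\<Sum>j\<in>cls k. u $ xi j) \<noteq> 0)" if "k < n" for k
    by (rule generically_mono[OF generically_index_sum[of "xi ` cls k"]])
       (use cls_nonempty[OF that] cls_less xi_yi_less in \<open>auto simp: sum.reindex[OF inj_xi]\<close>)
  have gV: "generically (n + n) (\<lambda>u. (\<Sum>j\<in>cls k. u $ yi j) \<noteq> 0)" if "k < n" for k
    by (rule generically_mono[OF generically_index_sum[of "yi ` cls k"]])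
       (use cls_nonempty[OF that] cls_less xi_yi_less in \<open>auto simp: sum.reindex[OF inj_yi]\<close>)
  have gS: "generically (n + n) (\<lambda>u. (\<Sum>j\<in>cls k. u $ j + u $ (n + j)) \<noteq> 0)" if k: "k < n" for k
  proof (rule generically_mono[OF generically_index_sum[of "cls k \<union> (+) n ` cls k"]])
    show "cls k \<union> (+) n ` cls k \<subseteq> {..<n + n}" using cls_less by fastforce
    show "cls k \<union> (+) n ` cls k \<noteq> {}" using cls_nonempty[OF k] by simp
    fix u :: "complex vec" assume "(\<Sum>t\<in>cls k \<union> (+) n ` cls k. u $ t) \<noteq> 0"
    moreover have "(\<Sum>t\<in>cls k \<union> (+) n ` cls k. u $ t) = (\<Sum>t\<in>cls k. u $ t) + (\<Sum>t\<in>(+) n ` cls k. u $ t)"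
      by (rule sum.union_disjoint) (use cls_less in fastforce)+
    ultimately show "(\<Sum>j\<in>cls k. u $ j + u $ (n + j)) \<noteq> 0"
      by (simp add: sum.reindex sum.distrib)
  qed
  have gT: "generically (n + n) (\<lambda>u. (\<Sum>k<n. u $ k + u $ (n + k)) \<noteq> 0)"
    by (rule generically_mono[OF generically_index_sum[of "{..<n + n}"]])
       (use assms in \<open>auto simp: sum_lessThan_add sum.distrib\<close>)
  have "generically (n + n) (\<lambda>u. ((\<forall>k\<in>{..<n}. u $ k + u $ (n + k) \<noteq> 0) \<and> (\<forall>k\<in>{..<n}. (\<Sum>j\<in>cls k. u $ xi j) \<noteq> 0)) \<and>
      ((\<forall>k\<in>{..<n}. (\<Sum>j\<in>cls k. u $ yi j) \<noteq> 0) \<and> (\<forall>k\<in>{..<n}. (\<Sum>j\<in>cls k. u $ j + u $ (n + j)) \<noteq> 0)) \<and>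
      (\<Sum>k<n. u $ k + u $ (n + k)) \<noteq> 0)"
    by (intro generically_conj generically_ball gs gU gV gS gT) auto
  then show ?thesis
  proof (rule generically_mono)
    fix u :: "complex vec"
    assume u: "u \<in> carrier_vec (n + n)" and nz: "((\<forall>k\<in>{..<n}. u $ k + u $ (n + k) \<noteq> 0) \<and> (\<forall>k\<in>{..<n}. (\<Sum>j\<in>cls k. u $ xi j) \<noteq> 0)) \<and>
      ((\<forall>k\<in>{..<n}. (\<Sum>j\<in>cls k. u $ yi j) \<noteq> 0) \<and> (\<forall>k\<in>{..<n}. (\<Sum>j\<in>cls k. u $ j + u $ (n + j)) \<noteq> 0)) \<and>
      (\<Sum>k<n. u $ k + u $ (n + k)) \<noteq> 0"
    show "critical_count (lawrence_lift A) u = 1"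
      by (rule critical_count_solution[OF u])
         (use nz in \<open>auto simp: s_def[OF u] U_def[OF u] V_def[OF u] S_def[OF u]\<close>)
  qed
qed

end

section \<open>Construction of the parallel classes\<close>

context even_circuits
begin

text \<open>Proportional nonzero columns of a totally unimodular matrix differ by a sign, so other
  factors do not occur.\<close>

definition parallel :: "nat \<Rightarrow> nat \<Rightarrow> bool" where
  "parallel i j \<longleftrightarrow> (\<exists>e. (e = 1 \<or> e = - 1) \<and> (\<forall>r<dim_row A. A $$ (r, j) = e * A $$ (r, i)))"

lemma parallel_refl: "parallel i i"
  unfolding parallel_def by (intro exI[of _ 1]) simp

lemma parallel_sym: "parallel i j \<Longrightarrow> parallel j i"
proof -
  assume "parallel i j"
  then obtain e where e: "e = 1 \<or> e = - 1" "\<forall>r<dim_row A. A $$ (r, j) = e * A $$ (r, i)"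
    by (auto simp: parallel_def)
  then show ?thesis unfolding parallel_def by (intro exI[of _ e]) auto
qed

lemma parallel_trans: "parallel i j \<Longrightarrow> parallel j k \<Longrightarrow> parallel i k"
proof -
  assume "parallel i j" "parallel j k"
  then obtain e f where e: "e = 1 \<or> e = - 1" "\<forall>r<dim_row A. A $$ (r, j) = e * A $$ (r, i)"
    and f: "f = 1 \<or> f = - 1" "\<forall>r<dim_row A. A $$ (r, k) = f * A $$ (r, j)"
    unfolding parallel_def by blast
  then show ?thesis unfolding parallel_def by (intro exI[of _ "f * e"]) auto
qed

lemma row_comb_scaled: "(\<And>r. r < dim_row A \<Longrightarrow> A $$ (r, j) = e * A $$ (r, i)) \<Longrightarrow> row_comb A p j = e * row_comb A p i"
  by (simp add: row_comb_def sum_distrib_left mult_ac)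

text \<open>The least index of a parallel class represents it. A circuit among representatives would
  have size two and make two of them parallel, so they have dual functionals; the signs extend these
  to all columns.\<close>

lemma exists_parallel_classes:
  assumes two: "\<And>c. circuit A c \<Longrightarrow> card (vec_support c) = 2"
  obtains \<rho> \<epsilon> P where "parallel_classes A \<rho> \<epsilon> P"
proof -
  define \<rho> where "\<rho> j = (LEAST i. i < n \<and> parallel i j)" for j
  have \<rho>: "\<rho> j < n \<and> parallel (\<rho> j) j" if "j < n" for j
    unfolding \<rho>_def by (rule LeastI[of _ j]) (simp add: that parallel_refl)
  have \<rho>_eq: "\<rho> i = \<rho> j" if par: "parallel i j" for i j
  proof -
    have "parallel l i \<longleftrightarrow> parallel l j" for l
      using parallel_trans[of l i j] parallel_trans[of l j i] parallel_sym[OF par] par by blast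
    then show ?thesis by (simp add: \<rho>_def)
  qed
  have idem: "\<rho> (\<rho> j) = \<rho> j" if "j < n" for j
    using \<rho>_eq \<rho> that by blast
  have "\<exists>e. (e = 1 \<or> e = - 1) \<and> (\<rho> j = j \<longrightarrow> e = 1) \<and> (j < n \<longrightarrow> (\<forall>r<dim_row A. A $$ (r, j) = e * A $$ (r, \<rho> j)))" for j
  proof (cases "j < n \<and> \<rho> j \<noteq> j")
    case True
    then show ?thesis using \<rho>[of j] unfolding parallel_def by blast
  next
    case False
    then show ?thesis by (intro exI[of _ 1]) auto
  qed
  then obtain \<epsilon> where \<epsilon>: "\<And>j. \<epsilon> j = 1 \<or> \<epsilon> j = - 1" "\<And>j. \<rho> j = j \<Longrightarrow> \<epsilon> j = 1"
    "\<And>j r. j < n \<Longrightarrow> r < dim_row A \<Longrightarrow> A $$ (r, j) = \<epsilon> j * A $$ (r, \<rho> j)"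
    by metis
  let ?R = "\<rho> ` {..<n}"
  have R: "?R \<subseteq> {..<n}" using \<rho> by auto
  have "\<exists>j<n. j \<notin> ?R \<and> c $ j \<noteq> 0" if c: "circuit A c" for c
  proof (rule ccontr)
    assume contra: "\<not> ?thesis"
    obtain i j where ij: "vec_support c = {i, j}" "i \<noteq> j"
      using two[OF c] by (auto simp: card_2_iff)
    then have ijn: "i < n" "j < n" "c $ i \<noteq> 0" "c $ j \<noteq> 0"
      using circuitD(1)[OF c] by (auto simp: vec_support_def)
    have "c $ k = 0" if "k < n" "k \<noteq> i" "k \<noteq> j" for k
    proof -
      have "k \<notin> vec_support c" using ij that by simp
      then show ?thesis using that circuitD(1)[OF c] by (simp add: vec_support_def)
    qed
    from circuit_pair_parallel[OF c this ijn(1,2)] have "parallel i j"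
      unfolding parallel_def by (intro exI[of _ "- c $ i * c $ j"]) auto
    then have "\<rho> i = \<rho> j" by (rule \<rho>_eq)
    moreover have "i \<in> ?R" "j \<in> ?R" using contra ijn by auto
    then have "\<rho> i = i" "\<rho> j = j" using idem by auto
    ultimately show False using ij by simp
  qed
  then have "\<exists>p. \<forall>k\<in>?R. row_comb A p k = (if k = r then 1 else 0)" if "r \<in> ?R" for r
    by (intro exists_functional R that) auto
  then obtain P where P: "\<And>r k. r \<in> ?R \<Longrightarrow> k \<in> ?R \<Longrightarrow> row_comb A (P r) k = (if k = r then 1 else 0)"
    by metis
  have "parallel_classes A \<rho> \<epsilon> P"
  proof
    fix j k assume jk: "j < n" "k < n"
    have "row_comb A (P (\<rho> k)) j = \<epsilon> j * row_comb A (P (\<rho> k)) (\<rho> j)"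
      by (rule row_comb_scaled) (rule \<epsilon>(3)[OF jk(1)])
    then show "row_comb A (P (\<rho> k)) j = (if \<rho> j = \<rho> k then \<epsilon> j else 0)"
      using P[of "\<rho> k" "\<rho> j"] jk by simp
  qed (use \<rho> idem \<epsilon> in blast)+
  then show thesis by (rule that)
qed

end

section \<open>Two critical points from a longer circuit\<close>

lemma prod_powi_eq_1:
  fixes g :: "nat \<Rightarrow> real"
  assumes "finite S" "\<And>j. j \<in> S \<Longrightarrow> g j > 0" "(\<Sum>j\<in>S. of_int (f j) * ln (g j)) = 0"
  shows "(\<Prod>j\<in>S. g j powi f j) = 1"
proof -
  have "(\<Prod>j\<in>S. g j powi f j) = (\<Prod>j\<in>S. exp (of_int (f j) * ln (g j)))"
  proof (rule prod.cong[OF refl])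
    fix j assume "j \<in> S"
    then have g: "g j > 0" by (rule assms(2))
    then have "g j powi f j = g j powr of_int (f j)" by (simp add: powr_real_of_int')
    then show "g j powi f j = exp (of_int (f j) * ln (g j))" using g by (simp add: powr_def)
  qed
  also have "\<dots> = exp (\<Sum>j\<in>S. of_int (f j) * ln (g j))"
    using assms(1) by (simp add: exp_sum)
  finally show ?thesis using assms(3) by simp
qed

context even_circuits
begin

text \<open>Flipping the coordinates with \<open>\<sigma> j = - 1\<close> turns the region into the orthant of the entropy
  argument. All ratios of critical coordinates are negative there, and the signs cancel because the
  entries of a kernel vector have even sum.\<close>

lemma region_critical_point:
  fixes a b :: "nat \<Rightarrow> real" and \<sigma> k p :: "nat \<Rightarrow> int"
  assumes n: "n > 0" and u: "u \<in> carrier_vec (n + n)"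
    and ua: "\<And>j. j < n \<Longrightarrow> u $ j = of_real (a j)" and ub: "\<And>j. j < n \<Longrightarrow> u $ (n + j) = of_real (b j)"
    and s: "\<And>j. j < n \<Longrightarrow> a j + b j > 0"
    and \<sigma>: "\<And>j. \<sigma> j = 1 \<or> \<sigma> j = - 1" and p: "\<And>j. j < n \<Longrightarrow> \<sigma> j * row_comb A p j > 0"
    and k: "int_ker A k"
    and pos: "\<And>j. j < n \<Longrightarrow> \<sigma> j = 1 \<Longrightarrow> a j + of_int (k j) > a j + b j"
    and neg: "\<And>j. j < n \<Longrightarrow> \<sigma> j = - 1 \<Longrightarrow> a j + of_int (k j) < 0"
  obtains x where "vec (n + n) (\<lambda>t. complex_of_real (x t)) \<in> critical_points (lawrence_lift A) u"
    "\<And>j. j < n \<Longrightarrow> \<sigma> j = 1 \<Longrightarrow> x j > 0" "\<And>j. j < n \<Longrightarrow> \<sigma> j = - 1 \<Longrightarrow> x j < 0"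
proof -
  define S where "S j = a j + b j" for j
  \<comment> \<open>The shifted point \<open>a + k\<close> is flipped: where
    \<open>\<sigma> j = - 1\<close>, \<open>x\<close> is replaced by \<open>S - x\<close>, and
    \<open>x < 0\<close> becomes \<open>S - x > S\<close>.\<close>
  define z where "z j = (if \<sigma> j = 1 then a j + of_int (k j) else S j - (a j + of_int (k j)))" for j
  define B where "B i j = real_of_int (A $$ (i, j)) * of_int (\<sigma> j)" for i j :: nat
  have Spos: "S j > 0" if "j < n" for j using s[OF that] by (simp add: S_def)
  have z: "z j > S j" if "j < n" for j
    using pos[OF that] neg[OF that] \<sigma>[of j] by (auto simp: z_def S_def)
  \<comment> \<open>After the flip \<open>row_comb A p\<close> has positive coefficients and still
    vanishes on the kernel; it is the weight that bounds the region.\<close>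
  have orth: "(\<Sum>j<n. of_int (\<sigma> j * row_comb A p j) * v j) = 0"
    if v: "\<And>i. i < dim_row A \<Longrightarrow> (\<Sum>j<n. B i j * v j) = 0" for v :: "nat \<Rightarrow> real"
  proof -
    have "(\<Sum>j<n. of_int (row_comb A p j) * (of_int (\<sigma> j) * v j)) = 0"
      by (rule row_comb_orthogonal) (use v in \<open>simp add: B_def mult.assoc\<close>)
    then show ?thesis by (simp add: mult_ac)
  qed
  obtain X where X: "\<And>j. j < n \<Longrightarrow> X j > S j"
    and XB: "\<And>i. i < dim_row A \<Longrightarrow> (\<Sum>j<n. B i j * X j) = (\<Sum>j<n. B i j * z j)"
    and Xcrit: "\<And>v. (\<And>i. i < dim_row A \<Longrightarrow> (\<Sum>j<n. B i j * v j) = 0) \<Longrightarrow> (\<Sum>j<n. v j * ln (X j / (X j - S j))) = 0"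
  proof (rule exists_entropy_critical_point[of n S z "\<lambda>j. of_int (\<sigma> j * row_comb A p j)" "dim_row A" B])
    show "0 < real_of_int (\<sigma> j * row_comb A p j)" if "j < n" for j
      using p[OF that] by (simp only: of_int_0_less_iff)
    show "S j > 0" "z j > S j" if "j < n" for j
      using Spos[OF that] z[OF that] .
    show "(\<Sum>j<n. real_of_int (\<sigma> j * row_comb A p j) * v j) = 0"
      if "\<And>i. i < dim_row A \<Longrightarrow> (\<Sum>j<n. B i j * v j) = 0" for v
      by (rule orth) (rule that)
    fix X assume "\<And>j. j < n \<Longrightarrow> X j > S j"
      "\<And>i. i < dim_row A \<Longrightarrow> (\<Sum>j<n. B i j * X j) = (\<Sum>j<n. B i j * z j)"
      "\<And>v. (\<And>i. i < dim_row A \<Longrightarrow> (\<Sum>j<n. B i j * v j) = 0) \<Longrightarrow> (\<Sum>j<n. v j * ln (X j / (X j - S j))) = 0"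
    then show thesis by (rule that)
  qed
  \<comment> \<open>Flip back; the second half holds the partner \<open>S - x\<close> of each
    coordinate.\<close>
  define x where "x t = (if t < n then (if \<sigma> t = 1 then X t else S t - X t)
      else (if \<sigma> (t - n) = 1 then S (t - n) - X (t - n) else X (t - n)))" for t
  have xl: "x j = (if \<sigma> j = 1 then X j else S j - X j)" "x (n + j) = (if \<sigma> j = 1 then S j - X j else X j)" if "j < n" for j
    using that by (simp_all add: x_def)
  have pair: "x j + x (n + j) = S j" if "j < n" for j using xl[OF that] by simp
  define c where "c = vec (n + n) (\<lambda>t. complex_of_real (x t))"
  have ci: "c $ t = of_real (x t)" if "t < n + n" for t using that by (simp add: c_def)
  have xnz: "x j \<noteq> 0 \<and> x (n + j) \<noteq> 0" if "j < n" for j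
    using xl[OF that] X[OF that] Spos[OF that] by (cases "\<sigma> j = 1") auto
  have rows: "(\<Sum>j<n. of_int (A $$ (i, j)) * x j) = (\<Sum>j<n. of_int (A $$ (i, j)) * a j)" if i: "i < dim_row A" for i
  proof -
    have "(\<Sum>j<n. of_int (A $$ (i, j)) * (x j - (a j + of_int (k j)))) = (\<Sum>j<n. B i j * (X j - z j))"
    proof (rule sum.cong[OF refl])
      fix j assume "j \<in> {..<n}"
      then have "x j - (a j + of_int (k j)) = of_int (\<sigma> j) * (X j - z j)"
        using xl[of j] \<sigma>[of j] by (auto simp: z_def)
      then show "of_int (A $$ (i, j)) * (x j - (a j + of_int (k j))) = B i j * (X j - z j)"
        by (simp add: B_def)
    qed
    also have "\<dots> = 0" using XB[OF i] by (simp add: right_diff_distrib sum_subtractf)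
    finally have 1: "(\<Sum>j<n. of_int (A $$ (i, j)) * (x j - (a j + of_int (k j)))) = 0" .
    have "(\<Sum>j<n. real_of_int (A $$ (i, j)) * of_int (k j)) = of_int (\<Sum>j<n. A $$ (i, j) * k j)" by simp
    also have "\<dots> = 0" using k i unfolding int_ker_def by simp
    finally show ?thesis
      using 1 by (simp add: right_diff_distrib distrib_left sum_subtractf sum.distrib)
  qed
  have "c \<in> toric_variety (lawrence_lift A)"
  proof (rule lawrence_toric_varietyI)
    show "c \<in> carrier_vec (n + n)" by (simp add: c_def)
    show "c $ t \<noteq> 0" if "t < n + n" for t
      using ci[OF that] xnz[of t] xnz[of "t - n"] that by (cases "t < n") auto
    fix v assume v: "int_ker A v"
    define g where "g j = X j / (X j - S j)" for j
    have gpos: "g j > 0" if "j < n" for j using X[OF that] Spos[OF that] by (simp add: g_def)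
    \<comment> \<open>The flip inverts the absolute ratio, which the exponent
      \<open>\<sigma> j\<close> records; the sign is negative either way.\<close>
    have ratio: "x j / x (n + j) = - (g j powi \<sigma> j)" if "j < n" for j
    proof (cases "\<sigma> j = 1")
      case True
      then have "x j / x (n + j) = X j / (- (X j - S j))" using xl[OF that] by simp
      then show ?thesis using True by (simp only: minus_divide_right[symmetric] g_def power_int_1_right)
    next
      case False
      then have "g j powi \<sigma> j = (X j - S j) / X j"
        using \<sigma>[of j] by (simp add: g_def power_int_minus)
      moreover have "x j / x (n + j) = (- (X j - S j)) / X j" using False xl[OF that] by simp
      ultimately show ?thesis by (simp only: minus_divide_left[symmetric])
    qed
    have "(\<Prod>j<n. (x j / x (n + j)) powi v j) = (\<Prod>j<n. (- 1) powi v j * g j powi (\<sigma> j * v j))"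
    proof (rule prod.cong[OF refl])
      fix j assume "j \<in> {..<n}"
      then have "(x j / x (n + j)) powi v j = ((- 1) * (g j powi \<sigma> j)) powi v j" by (simp add: ratio)
      then show "(x j / x (n + j)) powi v j = (- 1) powi v j * g j powi (\<sigma> j * v j)"
        by (simp only: power_int_mult_distrib power_int_mult)
    qed
    also have "\<dots> = (- 1) powi (\<Sum>j<n. v j) * (\<Prod>j<n. g j powi (\<sigma> j * v j))"
      by (simp add: prod.distrib powi_sum)
    also have "(- 1 :: real) powi (\<Sum>j<n. v j) = 1"
      using int_ker_sum_even[OF v] by (simp add: power_int_minus_left)
    also have "(\<Prod>j<n. g j powi (\<sigma> j * v j)) = 1"
    proof (rule prod_powi_eq_1)
      \<comment> \<open>Since \<open>B\<close> carries the signs, stationarity is used in the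
        direction of the flipped kernel vector.\<close>
      have "(\<Sum>j<n. (of_int (\<sigma> j * v j)) * ln (X j / (X j - S j))) = 0"
      proof (rule Xcrit)
        fix i assume i: "i < dim_row A"
        have "(\<Sum>j<n. B i j * of_int (\<sigma> j * v j)) = (\<Sum>j<n. real_of_int (A $$ (i, j) * v j))"
        proof (rule sum.cong[OF refl])
          fix j show "B i j * of_int (\<sigma> j * v j) = real_of_int (A $$ (i, j) * v j)"
            using \<sigma>[of j] by (auto simp: B_def)
        qed
        also have "\<dots> = of_int (\<Sum>j<n. A $$ (i, j) * v j)" by simp
        also have "\<dots> = 0" using v i unfolding int_ker_def by simp
        finally show "(\<Sum>j<n. B i j * of_int (\<sigma> j * v j)) = 0" .
      qed
      then show "(\<Sum>j<n. of_int (\<sigma> j * v j) * ln (g j)) = 0" by (simp only: g_def)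
    qed (use gpos in auto)
    finally have real: "(\<Prod>j<n. (x j / x (n + j)) powi v j) = 1" by simp
    have "(\<Prod>j<n. (c $ j / c $ (n + j)) powi v j) = (\<Prod>j<n. of_real ((x j / x (n + j)) powi v j))"
      by (rule prod.cong) (simp_all add: ci)
    also have "\<dots> = of_real (\<Prod>j<n. (x j / x (n + j)) powi v j)" by simp
    finally show "(\<Prod>j<n. (c $ j / c $ (n + j)) powi v j) = 1" by (simp only: real of_real_1)
  qed
  moreover have "map_mat of_int (lawrence_lift A) *\<^sub>v c = map_mat of_int (lawrence_lift A) *\<^sub>v u"
  proof (rule eq_vecI)
    fix i assume "i < dim_vec (map_mat of_int (lawrence_lift A) *\<^sub>v u)"
    then have i: "i < dim_row (lawrence_lift A)" by simp
    define y where "y t = (if t < n then a t else b (t - n))" for t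
    have uy: "u $ t = of_real (y t)" if "t < n + n" for t
      using that ua[of t] ub[of "t - n"] by (auto simp: y_def)
    let ?L = "\<lambda>t. real_of_int (lawrence_lift A $$ (i, t))"
    have "(\<Sum>t<n + n. ?L t * x t) = (\<Sum>t<n + n. ?L t * y t)"
      using i
    proof (cases rule: lawrence_lift_row_cases)
      case (1 r)
      then show ?thesis
        using lawrence_lift_row_sum(1)[of r A x] lawrence_lift_row_sum(1)[of r A y] rows[of r] by (simp add: y_def)
    next
      case (2 r)
      have x2: "x (n + j) = S j - x j" if "j < n" for j using pair[OF that] by simp
      have "(\<Sum>j<n. of_int (A $$ (r, j)) * x (n + j)) = (\<Sum>j<n. of_int (A $$ (r, j)) * (S j - x j))"
        by (rule sum.cong[OF refl]) (simp only: lessThan_iff x2)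
      also have "\<dots> = (\<Sum>j<n. of_int (A $$ (r, j)) * S j) - (\<Sum>j<n. of_int (A $$ (r, j)) * a j)"
        using rows[OF 2(1)] by (simp add: right_diff_distrib sum_subtractf)
      also have "\<dots> = (\<Sum>j<n. of_int (A $$ (r, j)) * b j)"
        by (simp add: S_def distrib_left sum.distrib)
      finally show ?thesis
        using lawrence_lift_row_sum(2)[of r A x] lawrence_lift_row_sum(2)[of r A y] 2(1)
        unfolding 2(2) by (simp add: y_def)
    next
      case (3 r)
      then show ?thesis
        using lawrence_lift_row_sum(3)[of r A x] lawrence_lift_row_sum(3)[of r A y] pair[of r] by (simp add: y_def S_def)
    qed
    then have eq: "of_real (\<Sum>t<n + n. ?L t * x t) = (of_real (\<Sum>t<n + n. ?L t * y t) :: complex)" by (rule arg_cong)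
    have "(\<Sum>t<n + n. of_int (lawrence_lift A $$ (i, t)) * c $ t) = of_real (\<Sum>t<n + n. ?L t * x t)"
      unfolding of_real_sum by (rule sum.cong) (simp_all add: ci)
    moreover have "(\<Sum>t<n + n. of_int (lawrence_lift A $$ (i, t)) * u $ t) = of_real (\<Sum>t<n + n. ?L t * y t)"
      unfolding of_real_sum by (rule sum.cong) (simp_all add: uy)
    ultimately have "(\<Sum>t<n + n. of_int (lawrence_lift A $$ (i, t)) * c $ t) = (\<Sum>t<n + n. of_int (lawrence_lift A $$ (i, t)) * u $ t)"
      by (simp only: eq)
    moreover have "c \<in> carrier_vec (n + n)" by (simp add: c_def)
    ultimately show "(map_mat of_int (lawrence_lift A) *\<^sub>v c) $ i = (map_mat of_int (lawrence_lift A) *\<^sub>v u) $ i"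
      using mult_map_mat_index[OF i, of c] mult_map_mat_index[OF i, of u] u by (simp only: dim_lawrence_lift)
  qed simp
  moreover have "(\<Sum>t<n + n. c $ t) \<noteq> 0"
  proof -
    have "(\<Sum>t<n + n. c $ t) = of_real (\<Sum>t<n + n. x t)"
      unfolding of_real_sum by (rule sum.cong) (simp_all add: ci)
    also have "(\<Sum>t<n + n. x t) = (\<Sum>j<n. S j)"
      unfolding sum_lessThan_add sum.distrib[symmetric] by (rule sum.cong) (simp_all add: pair)
    also have "(\<Sum>j<n. S j) > 0" using n Spos by (intro sum_pos) auto
    then have "complex_of_real (\<Sum>j<n. S j) \<noteq> 0" by (simp only: of_real_eq_0_iff)
    finally show ?thesis .
  qed
  ultimately have "c \<in> critical_points (lawrence_lift A) u"
    by (simp add: critical_points_def)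
  then show thesis
    unfolding c_def by (rule that) (use xl X Spos in fastforce)+
qed

text \<open>Any integer multiple of a functional separating \<open>j\<close> from \<open>i\<close>
  may be added, and each column of the finite set rules out at most one multiple.\<close>

lemma generic_functional:
  assumes i: "i < n" and T: "finite T" "\<And>j. j \<in> T \<Longrightarrow> j < n \<and> \<not> parallel i j"
  shows "\<exists>p. row_comb A p i = 0 \<and> (\<forall>j\<in>T. row_comb A p j \<noteq> 0)"
  using T
proof (induction T rule: finite_induct)
  case empty
  show ?case by (rule exI[of _ "\<lambda>_. 0"]) (simp add: row_comb_def)
next
  case (insert j T)
  then obtain p where p: "row_comb A p i = 0" "\<forall>l\<in>T. row_comb A p l \<noteq> 0" by auto
  have j: "j < n" "\<not> parallel i j" using insert.prems by auto
  then have "i \<noteq> j" using parallel_refl by auto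
  moreover have "\<exists>r<dim_row A. A $$ (r, j) \<noteq> e * A $$ (r, i)" if "e \<in> {1, - 1}" for e
    using j(2) that unfolding parallel_def by auto
  ultimately obtain q where q: "row_comb A q j = 1" "row_comb A q i = 0"
    using separating_functional[OF i j(1)] by blast
  have fin: "finite {t. row_comb A p l + t * row_comb A q l = 0}" if "l \<in> insert j T" for l
  proof (cases "row_comb A q l = 0")
    case True
    then have "row_comb A p l \<noteq> 0" using that p q by auto
    then show ?thesis using True by simp
  next
    case False
    have "{t. row_comb A p l + t * row_comb A q l = 0} \<subseteq> {- (row_comb A p l div row_comb A q l)}"
    proof
      fix t assume "t \<in> {t. row_comb A p l + t * row_comb A q l = 0}"
      then have "row_comb A p l = - t * row_comb A q l" by simp
      then have "row_comb A p l div row_comb A q l = - t"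
        using False by (metis nonzero_mult_div_cancel_right)
      then show "t \<in> {- (row_comb A p l div row_comb A q l)}" by simp
    qed
    then show ?thesis using finite_subset by blast
  qed
  have "finite (\<Union>l\<in>insert j T. {t. row_comb A p l + t * row_comb A q l = 0})"
    using fin insert.hyps by blast
  then obtain t where t: "t \<notin> (\<Union>l\<in>insert j T. {t. row_comb A p l + t * row_comb A q l = 0})"
    using ex_new_if_finite infinite_UNIV_int by blast
  let ?p = "\<lambda>i. 1 * p i + t * q i"
  have "row_comb A ?p l = row_comb A p l + t * row_comb A q l" for l
    unfolding row_comb_lin by simp
  then show ?case using t p q by (intro exI[of _ ?p]) auto
qed

lemma infinite_complex_interval:
  assumes "x < (y :: real)"
  shows "infinite (complex_of_real ` {x<..<y})"
  using assms by (subst finite_image_iff) (auto simp: inj_on_def)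

text \<open>Kernel shifts by \<open>k\<close> and by its negative lead from the same data into two
  regions that differ exactly on \<open>S\<close>; their critical points have opposite signs at
  \<open>i\<close>.\<close>

lemma not_generically_critical_count_eq_1:
  assumes c: "circuit A c" "card (vec_support c) \<noteq> 2"
    and gen: "generically (n + n) (\<lambda>u. critical_count (lawrence_lift A) u = 1)"
  shows False
proof -
  obtain i where i: "i < n" "c $ i \<noteq> 0" using circuitD(3)[OF c(1)] by auto
  have ci: "c $ i * c $ i = 1"
    using totally_unimodular_circuit_entries[OF tu c(1) i(1)] i(2) by auto
  define S where "S = {j. j < n \<and> parallel i j}"
  have finS: "finite S" and iS: "i \<in> S" using i by (auto simp: S_def parallel_refl)
  have "\<exists>e. (e = 1 \<or> e = - 1) \<and> (j \<in> S \<longrightarrow> (\<forall>r<dim_row A. A $$ (r, j) = e * A $$ (r, i)))" for j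
  proof (cases "j \<in> S")
    case True
    then show ?thesis by (auto simp: S_def parallel_def)
  qed auto
  then obtain \<epsilon> where \<epsilon>: "\<And>j. \<epsilon> j = 1 \<or> \<epsilon> j = - 1"
    "\<And>j r. j \<in> S \<Longrightarrow> r < dim_row A \<Longrightarrow> A $$ (r, j) = \<epsilon> j * A $$ (r, i)"
    by metis
  have cS: "c $ j = 0" if j: "j \<in> S" "j \<noteq> i" for j
  proof (rule ccontr)
    assume cj: "c $ j \<noteq> 0"
    have jn: "j < n" using j by (simp add: S_def)
    \<comment> \<open>A second column parallel to \<open>i\<close> in the support would give this
      kernel vector on the two of them, and minimality would reduce the circuit to size two.\<close>
    define w where "w t = (if t = j then 1 else if t = i then - \<epsilon> j else 0)" for t
    have "int_ker A w"
      unfolding int_ker_def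
    proof (intro allI impI)
      fix r assume r: "r < dim_row A"
      have "(\<Sum>t<n. A $$ (r, t) * w t) = (\<Sum>t\<in>{i, j}. A $$ (r, t) * w t)"
        by (rule sum.mono_neutral_right) (use i jn in \<open>auto simp: w_def\<close>)
      also have "\<dots> = 0" using j \<epsilon>(2)[OF j(1) r] by (simp add: w_def)
      finally show "(\<Sum>t<n. A $$ (r, t) * w t) = 0" .
    qed
    then have wt: "w t \<noteq> 0" if "t < n" "c $ t \<noteq> 0" for t
      by (rule circuitD(4)[OF c(1)]) (use jn cj i that in \<open>auto simp: w_def\<close>)
    have "vec_support c \<subseteq> {i, j}"
    proof
      fix t assume "t \<in> vec_support c"
      then have "w t \<noteq> 0" using circuitD(1)[OF c(1)] by (intro wt) (auto simp: vec_support_def)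
      then show "t \<in> {i, j}" by (auto simp: w_def split: if_splits)
    qed
    moreover have "{i, j} \<subseteq> vec_support c"
      using circuitD(1)[OF c(1)] i cj jn by (auto simp: vec_support_def)
    ultimately show False using c(2) j by auto
  qed
  \<comment> \<open>On \<open>S\<close> the columns weighted by \<open>k\<close> add up to
    \<open>3 * card S\<close> times column \<open>i\<close>; the circuit expresses column
    \<open>i\<close> by columns outside \<open>S\<close>, which balances this. The 3 carries a value
    near 0 past both walls 0 and \<open>a j + b j\<close>, the latter less than 3/2.\<close>
  define k where "k j = (if j \<in> S then 3 * \<epsilon> j else 3 * int (card S) * (c $ i * c $ j))" for j
  have kerk: "int_ker A k"
    unfolding int_ker_def
  proof (intro allI impI)
    fix r assume r: "r < dim_row A"
    have Sn: "S \<subseteq> {..<n}" by (auto simp: S_def)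
    have split: "(\<Sum>j<n. f j) = (\<Sum>j\<in>S. f j) + (\<Sum>j\<in>{..<n} - S. f j)" for f :: "nat \<Rightarrow> int"
      using sum.subset_diff[OF Sn, of f] by simp
    have "(\<Sum>j\<in>S. A $$ (r, j) * k j) = (\<Sum>j\<in>S. 3 * A $$ (r, i))"
    proof (rule sum.cong[OF refl])
      fix j assume j: "j \<in> S"
      show "A $$ (r, j) * k j = 3 * A $$ (r, i)"
        using \<epsilon>(2)[OF j r] \<epsilon>(1)[of j] j by (auto simp: k_def)
    qed
    then have 1: "(\<Sum>j\<in>S. A $$ (r, j) * k j) = 3 * int (card S) * A $$ (r, i)" by simp
    have "(\<Sum>j\<in>S. A $$ (r, j) * c $ j) = (\<Sum>j\<in>{i}. A $$ (r, j) * c $ j)"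
      by (rule sum.mono_neutral_right) (use finS iS cS in auto)
    moreover have "(\<Sum>j<n. A $$ (r, j) * c $ j) = 0"
      using circuitD(2)[OF c(1)] r by (simp add: int_ker_def)
    ultimately have "(\<Sum>j\<in>{..<n} - S. A $$ (r, j) * c $ j) = - (A $$ (r, i) * c $ i)"
      using split[of "\<lambda>j. A $$ (r, j) * c $ j"] by simp
    moreover have "(\<Sum>j\<in>{..<n} - S. A $$ (r, j) * k j)
        = 3 * int (card S) * c $ i * (\<Sum>j\<in>{..<n} - S. A $$ (r, j) * c $ j)"
      unfolding sum_distrib_left by (rule sum.cong) (auto simp: k_def)
    ultimately have "(\<Sum>j\<in>{..<n} - S. A $$ (r, j) * k j) = - (3 * int (card S) * A $$ (r, i) * (c $ i * c $ i))"
      by (simp add: mult_ac)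
    then show "(\<Sum>j<n. A $$ (r, j) * k j) = 0" using 1 ci split by simp
  qed
  \<comment> \<open>The functional \<open>N p + \<tau> q\<close> changes its sign with \<open>\<tau> = 1, - 1\<close> exactly on the columns
    parallel to column \<open>i\<close>. Near the base point \<open>\<alpha>\<close> both regions of sign vectors \<open>\<sigma> \<tau>\<close> are reached,
    by adding \<open>\<tau> k\<close>, and they are bounded because the functional is constant along the kernel.\<close>
  obtain q where q: "row_comb A q i = 1" using column_functional[OF i(1)] .
  have "\<exists>p. row_comb A p i = 0 \<and> (\<forall>j\<in>{..<n} - S. row_comb A p j \<noteq> 0)"
    by (rule generic_functional[OF i(1)]) (simp_all add: S_def)
  then obtain p where p: "row_comb A p i = 0" "\<forall>j\<in>{..<n} - S. row_comb A p j \<noteq> 0" by blast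
  have pq: "row_comb A q j = \<epsilon> j" "row_comb A p j = 0" if "j \<in> S" for j
    using row_comb_scaled[of j "\<epsilon> j" i q] row_comb_scaled[of j "\<epsilon> j" i p] \<epsilon>(2)[OF that] p q by auto
  define M where "M = (\<Sum>j<n. \<bar>k j\<bar>)"
  have M: "\<bar>k j\<bar> \<le> M" if "j < n" for j
    unfolding M_def by (rule member_le_sum) (use that in auto)
  \<comment> \<open>\<open>N\<close> dominates the values of \<open>q\<close>, and \<open>p\<close>
    takes nonzero integer values outside \<open>S\<close>; so \<open>p\<close> decides the sign
    there, and \<open>q\<close> decides it on \<open>S\<close>, where \<open>p\<close>
    vanishes.\<close>
  define N where "N = 1 + (\<Sum>j<n. \<bar>row_comb A q j\<bar>)"
  have N: "\<bar>row_comb A q j\<bar> < N" if "j < n" for j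
    using member_le_sum[of j "{..<n}" "\<lambda>j. \<bar>row_comb A q j\<bar>"] that unfolding N_def by auto
  define \<sigma> where "\<sigma> \<tau> j = (if j \<in> S then \<tau> * \<epsilon> j else if row_comb A p j > 0 then 1 else - 1)" for \<tau> j
  have \<sigma>_cases: "\<sigma> \<tau> j = 1 \<or> \<sigma> \<tau> j = - 1" if "\<tau> = 1 \<or> \<tau> = - 1" for \<tau> j
    using that \<epsilon>(1)[of j] by (auto simp: \<sigma>_def)
  \<comment> \<open>Outside \<open>S\<close> the base value lies deeper in the region than
    \<open>M\<close>, which bounds every shift; on \<open>S\<close> it is near 0 and the shift
    chooses the side.\<close>
  define \<alpha> where "\<alpha> j = (if j \<in> S then 0 else if row_comb A p j > 0 then real_of_int M + 3 else - real_of_int M - 3)" for j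
  \<comment> \<open>Centring the second half at \<open>1 - \<alpha>\<close> keeps each pair sum
    within 1/2 of 1, hence positive.\<close>
  obtain u where u: "u \<in> carrier_vec (n + n)"
    and box: "\<And>t. t < n + n \<Longrightarrow> u $ t \<in> of_real ` (if t < n then {\<alpha> t - 1/4 <..< \<alpha> t + 1/4}
        else {1 - \<alpha> (t - n) - 1/4 <..< 1 - \<alpha> (t - n) + 1/4})"
    and count: "critical_count (lawrence_lift A) u = 1"
    by (rule generically_exists[OF gen, of "\<lambda>t. of_real ` (if t < n then {\<alpha> t - 1/4 <..< \<alpha> t + 1/4}
        else {1 - \<alpha> (t - n) - 1/4 <..< 1 - \<alpha> (t - n) + 1/4})"])
       (auto simp: infinite_complex_interval)
  define a where "a j = Re (u $ j)" for j
  define b where "b j = Re (u $ (n + j))" for j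
  have ua: "u $ j = of_real (a j)" "\<alpha> j - 1/4 < a j" "a j < \<alpha> j + 1/4" if "j < n" for j
    using box[of j] that by (auto simp: a_def)
  have ub: "u $ (n + j) = of_real (b j)" "1 - \<alpha> j - 1/4 < b j" "b j < 1 - \<alpha> j + 1/4" if "j < n" for j
    using box[of "n + j"] that by (auto simp: b_def)
  have ex: "\<exists>x. vec (n + n) (\<lambda>t. complex_of_real (x t)) \<in> critical_points (lawrence_lift A) u \<and> of_int (\<tau> * \<epsilon> i) * x i > 0"
    if \<tau>: "\<tau> = 1 \<or> \<tau> = - 1" for \<tau>
  proof -
    \<comment> \<open>The summand with factor 0 gives \<open>?k\<close> the shape of
      \<open>int_ker_lin\<close>.\<close>
    let ?p = "\<lambda>r. N * p r + \<tau> * q r" and ?k = "\<lambda>j. \<tau> * k j + 0 * k j"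
    have kj: "?k j = \<tau> * k j" for j by simp
    have bound: "\<bar>real_of_int (?k j)\<bar> \<le> real_of_int M" if "j < n" for j
      using M[OF that] \<tau> by auto
    have kS: "?k j = 3 * \<sigma> \<tau> j" if "j \<in> S" for j using that by (simp add: k_def \<sigma>_def)
    obtain x where "vec (n + n) (\<lambda>t. complex_of_real (x t)) \<in> critical_points (lawrence_lift A) u"
      and x: "\<And>j. j < n \<Longrightarrow> \<sigma> \<tau> j = 1 \<Longrightarrow> x j > 0" "\<And>j. j < n \<Longrightarrow> \<sigma> \<tau> j = - 1 \<Longrightarrow> x j < 0"
    proof (rule region_critical_point[of u a b "\<sigma> \<tau>" ?p ?k])
      show "0 < n" using i by simp
      show "a j + b j > 0" if "j < n" for j using ua[OF that] ub[OF that] by linarith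
      show "\<sigma> \<tau> j * row_comb A ?p j > 0" if j: "j < n" for j
      proof (cases "j \<in> S")
        case True
        then show ?thesis
          unfolding row_comb_lin using pq[OF True] \<tau> \<epsilon>(1)[of j] by (auto simp: \<sigma>_def)
      next
        case False
        then have pj: "row_comb A p j \<noteq> 0" using p j by auto
        have "N \<ge> 0" using N[OF j] by linarith
        have q': "\<bar>\<tau> * row_comb A q j\<bar> < N" using N[OF j] \<tau> by auto
        show ?thesis
        proof (cases "row_comb A p j > 0")
          case True
          then have "N * 1 \<le> N * row_comb A p j" using \<open>N \<ge> 0\<close> by (intro mult_left_mono) auto
          then have "N * row_comb A p j + \<tau> * row_comb A q j > 0" using q' by linarith
          then show ?thesis unfolding row_comb_lin using True False by (simp add: \<sigma>_def)
        next
          case neg: False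
          then have "N * row_comb A p j \<le> N * (- 1)" using \<open>N \<ge> 0\<close> pj by (intro mult_left_mono) auto
          then have "N * row_comb A p j + \<tau> * row_comb A q j < 0" using q' by linarith
          then show ?thesis unfolding row_comb_lin using neg False by (simp add: \<sigma>_def)
        qed
      qed
      show "int_ker A ?k" by (rule int_ker_lin) (rule kerk)+
      show "a j + b j < a j + of_int (?k j)" if j: "j < n" and s: "\<sigma> \<tau> j = 1" for j
      proof (cases "j \<in> S")
        case True
        then have "\<alpha> j = 0" "real_of_int (?k j) = 3" using kS[OF True] s by (simp_all add: \<alpha>_def)
        then show ?thesis using ua[OF j] ub[OF j] by linarith
      next
        case False
        then have "\<alpha> j = real_of_int M + 3" using s by (auto simp: \<alpha>_def \<sigma>_def split: if_splits)
        then show ?thesis using ua[OF j] ub[OF j] bound[OF j] by linarith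
      qed
      show "a j + of_int (?k j) < 0" if j: "j < n" and s: "\<sigma> \<tau> j = - 1" for j
      proof (cases "j \<in> S")
        case True
        then have "\<alpha> j = 0" "real_of_int (?k j) = - 3" using kS[OF True] s by (simp_all add: \<alpha>_def)
        then show ?thesis using ua[OF j] by linarith
      next
        case False
        then have "\<alpha> j = - real_of_int M - 3" using s by (auto simp: \<alpha>_def \<sigma>_def split: if_splits)
        then show ?thesis using ua[OF j] bound[OF j] by linarith
      qed
    qed (use u ua ub \<sigma>_cases[OF \<tau>] in auto)
    moreover have "of_int (\<tau> * \<epsilon> i) * x i > 0"
    proof -
      have eq: "\<tau> * \<epsilon> i = \<sigma> \<tau> i" using iS by (simp add: \<sigma>_def)
      show ?thesis unfolding eq using x[OF i(1)] \<sigma>_cases[OF \<tau>, of i] by auto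
    qed
    ultimately show ?thesis by blast
  qed
  obtain x y where x: "vec (n + n) (\<lambda>t. complex_of_real (x t)) \<in> critical_points (lawrence_lift A) u" "of_int (1 * \<epsilon> i) * x i > 0"
    and y: "vec (n + n) (\<lambda>t. complex_of_real (y t)) \<in> critical_points (lawrence_lift A) u" "of_int (- 1 * \<epsilon> i) * y i > 0"
    using ex[of 1] ex[of "- 1"] by blast
  have "vec (n + n) (\<lambda>t. complex_of_real (x t)) \<noteq> vec (n + n) (\<lambda>t. complex_of_real (y t))"
  proof
    assume "vec (n + n) (\<lambda>t. complex_of_real (x t)) = vec (n + n) (\<lambda>t. complex_of_real (y t))"
    then have "vec (n + n) (\<lambda>t. complex_of_real (x t)) $ i = vec (n + n) (\<lambda>t. complex_of_real (y t)) $ i" by simp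
    then have "x i = y i" using i by simp
    then show False using x(2) y(2) by simp
  qed
  from critical_count_ne_1[OF x(1) y(1) this] count show False by simp
qed

end

theorem proposition26:
  fixes A :: "int mat" and d n :: nat
  assumes "A \<in> carrier_mat d n"
    and "n > 0"
    and "totally_unimodular A"
    and "\<And>v. circuit A v \<Longrightarrow> even (card (vec_support v))"
  shows "mldeg (lawrence_lift A) = 1 \<longleftrightarrow>
    (\<forall>v. circuit A v \<longrightarrow> card (vec_support v) = 2)"
proof -
  interpret even_circuits A
    using assms by unfold_locales
  have n: "dim_col A = n" using assms by simp
  show ?thesis
    unfolding mldeg_eq_1_iff dim_lawrence_lift
  proof
    assume "generically (dim_col A + dim_col A) (\<lambda>u. critical_count (lawrence_lift A) u = 1)"
    then show "\<forall>v. circuit A v \<longrightarrow> card (vec_support v) = 2"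
      using not_generically_critical_count_eq_1 by blast
  next
    assume two: "\<forall>v. circuit A v \<longrightarrow> card (vec_support v) = 2"
    obtain \<rho> \<epsilon> P where "parallel_classes A \<rho> \<epsilon> P"
      using exists_parallel_classes two by blast
    then interpret parallel_classes A \<rho> \<epsilon> P .
    show "generically (dim_col A + dim_col A) (\<lambda>u. critical_count (lawrence_lift A) u = 1)"
      using generically_critical_count_eq_1 assms(2) n by simp
  qed
qed

end
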